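(* Let $\phi:(0,\infty)\to\mathbb{C}$ be mellin-proper and define $\psi(x):=x^{-1}\mathbf{G}\phi(x^{-1})$ for $x>0$. Then the Riemann hypothesis holds if and only if $\|\psi\|_p<\infty$ for every $p\in[1,2)$. Furthermore, unconditionally, if $\phi^\wedge$ is analytic in the strip $-\tfrac12\le\Re s<0$ and does not vanish on the line $\Re s=-\tfrac12$, then $\|\psi\|_2=\infty$.
   Context: $\mu$ is the Möbius function and $g(x):=\sum_{n\le x}\mu(n)n^{-1}$ for $x>0$. For $1\le p<\infty$, $\|f\|_p=\left(\int_0^\infty|f(x)|^p\,dx\right)^{1/p}$ (Lebesgue measure). For $a\in\mathbb{R}$, $N_a(f):=\int_0^\infty t^{-a-1}|f(t)|\,dt$. The (left-)Mellin transform of $f:(0,\infty)\to\mathbb{C}$ is $f^\wedge(s):=\int_0^\infty t^{-s-1}f(t)\,dt$ where the integral converges absolutely. $\phi$ is called proper if $N_\sigma(\phi)<\infty$ for all $\sigma\in(-\tfrac12,1]$, and mellin-proper if it is proper and $\phi^\wedge(s)\neq0$ for all $s$ with $-\tfrac12<\Re s<0$. For measurable $\phi$ and $x>0$, $\mathbf{G}\phi(x):=\int_0^\infty g(xt)\phi(t^{-1})t^{-1}\,dt$ whenever this integral converges absolutely. *)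

theory Defs
  imports
    "HOL-Complex_Analysis.Complex_Analysis"
    "HOL-Computational_Algebra.Squarefree"
begin

text \<open>
  Functions on \<open>(0,\<infinity>)\<close> are represented as functions on all of \<^typ>\<open>real\<close> whose values
  on \<open>(-\<infinity>,0]\<close> are never used. Measurability and integration are with respect to
  \<^const>\<open>lebesgue\<close>, i.e. Lebesgue measure on the Lebesgue-measurable (not just Borel) sets.
\<close>

definition moebius_mu :: "nat \<Rightarrow> int" where
  "moebius_mu n = (if squarefree n then (- 1) ^ card (prime_factors n) else 0)"

definition g :: "real \<Rightarrow> real" where
  "g x = (\<Sum>n | 1 \<le> n \<and> real n \<le> x. real_of_int (moebius_mu n) / real n)"

text \<open>
  The analytic continuation of the Dirichlet series to \<open>\<complex> - {1}\<close>. By the identity theorem the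
  choice only affects the value at the pole \<open>s = 1\<close>, which is irrelevant below.
\<close>

definition riemann_zeta :: "complex \<Rightarrow> complex" where
  "riemann_zeta = (SOME f. f holomorphic_on (- {1}) \<and>
     (\<forall>s. Re s > 1 \<longrightarrow> f s = (\<Sum>n. 1 / of_nat (Suc n) powr s)))"

definition riemann_hypothesis :: bool where
  "riemann_hypothesis \<longleftrightarrow>
     (\<forall>s. 0 < Re s \<and> Re s < 1 \<and> riemann_zeta s = 0 \<longrightarrow> Re s = 1 / 2)"

text \<open>The exponent \<open>1/p\<close> is applied by hand as there is no real power on \<^typ>\<open>ennreal\<close>.\<close>

definition Lp_norm :: "real \<Rightarrow> (real \<Rightarrow> complex) \<Rightarrow> ennreal" where
  "Lp_norm p f =
     (let I = (\<integral>\<^sup>+x\<in>{0<..}. ennreal (cmod (f x) powr p) \<partial>lebesgue)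
      in if I = \<infinity> then \<infinity> else ennreal (enn2real I powr (1 / p)))"

definition mellin_norm :: "real \<Rightarrow> (real \<Rightarrow> complex) \<Rightarrow> ennreal" where
  "mellin_norm a f = (\<integral>\<^sup>+t\<in>{0<..}. ennreal (t powr (- a - 1) * cmod (f t)) \<partial>lebesgue)"

text \<open>
  The left Mellin transform. As usual for Bochner integrals the value is \<open>0\<close> when
  the integral does not converge absolutely; for proper \<open>f\<close> it converges absolutely whenever
  \<open>- 1/2 < Re s \<le> 1\<close>.
\<close>

definition mellin :: "(real \<Rightarrow> complex) \<Rightarrow> complex \<Rightarrow> complex" where
  "mellin f s = (LINT t:{0<..}|lebesgue. complex_of_real t powr (- s - 1) * f t)"

definition proper_fun :: "(real \<Rightarrow> complex) \<Rightarrow> bool" where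
  "proper_fun f \<longleftrightarrow> set_borel_measurable lebesgue {0<..} f \<and>
     (\<forall>\<sigma>::real. - 1 / 2 < \<sigma> \<and> \<sigma> \<le> 1 \<longrightarrow> mellin_norm \<sigma> f < \<infinity>)"

definition mellin_proper :: "(real \<Rightarrow> complex) \<Rightarrow> bool" where
  "mellin_proper f \<longleftrightarrow> proper_fun f \<and>
     (\<forall>s. - 1 / 2 < Re s \<and> Re s < 0 \<longrightarrow> mellin f s \<noteq> 0)"

text \<open>
  For proper \<open>f\<close> the integral converges absolutely for every \<open>x > 0\<close>, because \<open>g\<close> is bounded,
  vanishes on \<open>(0,1)\<close>, and \<^term>\<open>mellin_norm 0 f\<close> is finite.
\<close>

definition G_op :: "(real \<Rightarrow> complex) \<Rightarrow> real \<Rightarrow> complex" where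
  "G_op f x = (LINT t:{0<..}|lebesgue. complex_of_real (g (x * t)) * f (1 / t) / complex_of_real t)"

end

theory Submission
  imports Defs "HOL-Number_Theory.Prime_Powers" "HOL-Real_Asymp.Real_Asymp"
begin

text \<open>
  The function \<open>\<psi>\<close> is a multiplicative convolution of \<open>\<phi>\<close> with \<open>x \<mapsto> g(1/x)/x\<close>, so that
  \<open>\<integral> x powr s * \<psi> x dx = \<phi>\<^sup>\<and>(s) / (s * \<zeta>(1 + s))\<close> for \<open>0 < Re s < 1\<close>. If \<open>\<psi>\<close> lies in \<open>L\<^sup>p\<close>, the
  left-hand side is holomorphic for \<open>1/p - 1 < Re s < 1\<close> by Hoelder's inequality near \<open>0\<close>, and the
  identity persists there; as \<open>\<phi>\<^sup>\<and>\<close> does not vanish for \<open>-1/2 < Re s < 0\<close>, neither does \<open>\<zeta>(1 + s)\<close>.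
  Conversely the Riemann hypothesis gives \<open>g(x) = O(x powr -a)\<close> for every \<open>a < 1/2\<close>, which bounds \<open>\<psi>\<close>
  near \<open>0\<close>, while \<open>\<psi>(x) = O(x powr -2)\<close> always. If \<open>\<psi>\<close> were in \<open>L\<^sup>2\<close>, the transform at distance \<open>r\<close>
  from the line \<open>Re s = -1/2\<close> would be \<open>O(r powr -1/2)\<close>, which is too small for the pole of
  \<open>1 / \<zeta>(1 + s)\<close> at a zero on that line. Such a zero exists: otherwise \<open>\<zeta>\<close> would grow subpolynomially
  in the critical strip, which the functional equation forbids.
\<close>

section \<open>The Moebius function and Dirichlet series\<close>

text \<open>\<open>riemann_zeta\<close> is a choice, so nothing is known about it until a
  continuation to all of \<open>- {1}\<close> is exhibited: the second-order Euler-Maclaurin formula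
  reaches \<open>Re s > -1\<close>, and the right-hand side of the functional equation covers the
  rest. The functional equation itself comes from one positive integral, that of
  \<open>frac x * (1 - frac x) * x powr (a - 2)\<close> over the half-line, computed once piece by
  piece and once through a Fourier series.

  One growth estimate serves twice: a zero-free half-plane makes \<zeta> and 1/\<zeta> subpolynomial
  at large height. Under the Riemann hypothesis it yields the decay of \<open>g\<close>; applied to
  a hypothetical strip without zeros it yields the contradiction that produces a zero.

  The sharp Perron integral converges only conditionally. As \<open>g\<close> is constant on [N, N +
  1), averaging over that interval recovers \<open>g N\<close> from an integrand with an extra
  factor of size 1/|w|.

  For the \<open>L\<^sup>2\<close> statement any zero in the strip serves: a finite norm already
  keeps zeros out of \<open>Re s > 1/2\<close>, so by reflection the zero lies on the critical
  line.\<close>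

lemma moebius_mu_prime_mult:
  assumes "prime p" "\<not> p dvd d"
  shows "moebius_mu (p * d) = - moebius_mu d"
proof (cases "squarefree d")
  case True
  have "coprime p d" using assms by (simp add: prime_imp_coprime)
  then have "squarefree (p * d)"
    using True squarefree_prime[OF assms(1)] by (simp add: squarefree_mult_coprime)
  moreover have "d \<noteq> 0" using assms by (cases "d = 0") auto
  then have "prime_factors (p * d) = insert p (prime_factors d)"
    using assms by (auto simp: prime_factors_product prime_prime_factors)
  moreover have "p \<notin> prime_factors d" using assms by (auto simp: in_prime_factors_iff)
  ultimately show ?thesis using True by (simp add: moebius_mu_def)
next
  case False
  then show ?thesis by (auto simp: moebius_mu_def dest: squarefree_multD)
qed

lemma moebius_mu_sq_dvd: "prime p \<Longrightarrow> p dvd e \<Longrightarrow> moebius_mu (p * e) = 0"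
  by (auto simp: moebius_mu_def power2_eq_square dest: squarefreeD[of _ p])

text \<open>Fix a prime \<open>p\<close> with \<open>n = p * m\<close>. The divisors prime to
  \<open>p\<close> form \<open>A\<close>; among the multiples \<open>p * e\<close> those with
  \<open>p dvd e\<close> contribute 0, and the remaining \<open>e\<close> run through
  \<open>A\<close> again with the opposite sign.\<close>

lemma sum_moebius_mu_divisors:
  assumes "n > 0"
  shows "(\<Sum>d | d dvd n. moebius_mu d) = (if n = 1 then 1 else 0)"
proof (cases "n = 1")
  case True
  then show ?thesis by (simp add: moebius_mu_def)
next
  case False
  then obtain p where p: "prime p" "p dvd n" using prime_factor_nat by blast
  then obtain m where n: "n = p * m" by blast
  have fin: "finite {d. d dvd n}" using assms by simp
  define A where "A = {d. d dvd n \<and> \<not> p dvd d}"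
  have "(\<Sum>d | d dvd n. moebius_mu d) = sum moebius_mu A + sum moebius_mu {d. d dvd n \<and> p dvd d}"
    using fin unfolding A_def
    by (subst sum.union_disjoint[symmetric]) (auto intro!: sum.cong intro: finite_subset[OF _ fin])
  also have "{d. d dvd n \<and> p dvd d} = (*) p ` {e. e dvd m}"
    using p by (auto simp: n)
  also have "sum moebius_mu \<dots> = (\<Sum>e | e dvd m. moebius_mu (p * e))"
    using p by (subst sum.reindex) (auto simp: inj_on_def prime_gt_0_nat)
  also have "\<dots> = (\<Sum>e | e dvd m \<and> \<not> p dvd e. moebius_mu (p * e))"
    using assms n p by (intro sum.mono_neutral_right) (auto simp: moebius_mu_sq_dvd)
  also have "{e. e dvd m \<and> \<not> p dvd e} = A"
  proof -
    have "x dvd m" if "x dvd p * m" "\<not> p dvd x" for x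
      using that p prime_imp_coprime[of p x] coprime_dvd_mult_right_iff[of x p m]
      by (simp add: coprime_commute)
    then show ?thesis unfolding A_def n by auto
  qed
  also have "(\<Sum>e\<in>A. moebius_mu (p * e)) = - sum moebius_mu A"
    using p by (simp add: moebius_mu_prime_mult A_def sum_negf)
  finally show ?thesis using False by simp
qed

lemma abs_moebius_mu_le: "\<bar>moebius_mu n\<bar> \<le> 1"
  by (simp add: moebius_mu_def)

lemma norm_moebius_mu_le: "norm (of_int (moebius_mu n) :: complex) \<le> 1"
proof -
  have "norm (of_int (moebius_mu n) :: complex) = of_int \<bar>moebius_mu n\<bar>" by simp
  also have "\<dots> \<le> 1" using abs_moebius_mu_le[of n] by linarith
  finally show ?thesis .
qed

section \<open>Absolutely convergent Dirichlet series and their products\<close>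

lemma dirichlet_product_sums:
  fixes f g :: "nat \<Rightarrow> complex"
  assumes f: "summable (\<lambda>n. norm (f (Suc n)))" and g: "summable (\<lambda>n. norm (g (Suc n)))"
  shows "(\<lambda>n. \<Sum>d | d dvd Suc n. f d * g (Suc n div d)) sums
           ((\<Sum>n. f (Suc n)) * (\<Sum>n. g (Suc n)))"
proof -
  have range: "range Suc = {0<..}"
    by (auto simp: image_iff gr0_conv_Suc)
  have pos: "(h has_sum (\<Sum>n. h (Suc n))) {0<..}" "(\<lambda>n. norm (h n)) summable_on {0<..}"
    if "summable (\<lambda>n. norm (h (Suc n)))" for h :: "nat \<Rightarrow> complex"
  proof -
    have "((\<lambda>n. h (Suc n)) has_sum (\<Sum>n. h (Suc n))) UNIV"
      using norm_summable_imp_has_sum[OF that] summable_sums[OF summable_norm_cancel[OF that]] by blast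
    then show "(h has_sum (\<Sum>n. h (Suc n))) {0<..}"
      using has_sum_reindex[of Suc UNIV h] by (simp add: range o_def)
    have "(\<lambda>n. norm (h (Suc n))) summable_on UNIV"
      using that by (simp add: summable_on_UNIV_nonneg_real_iff)
    then show "(\<lambda>n. norm (h n)) summable_on {0<..}"
      using summable_on_reindex[of Suc UNIV "\<lambda>n. norm (h n)"] by (simp add: range o_def)
  qed
  have abs: "(\<lambda>(a,b). norm (f a * g b)) summable_on {0<..} \<times> {0<..}"
    unfolding case_prod_unfold
    by (subst Infinite_Sum.abs_summable_on_Sigma_iff) 
       (simp add: norm_mult infsum_cmult_right' abs_mult infsum_nonneg summable_on_cmult_right[OF pos(2)[OF g]]
          summable_on_cmult_left[OF pos(2)[OF f]])
  then have sm: "(\<lambda>(a,b). f a * g b) summable_on {0<..} \<times> {0<..}"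
    by - (rule abs_summable_summable, simp add: case_prod_unfold)
  have eq: "infsum (\<lambda>(a,b). f a * g b) ({0<..} \<times> {0<..}) = (\<Sum>n. f (Suc n)) * (\<Sum>n. g (Suc n))"
  proof -
    have "infsum (\<lambda>(a,b). f a * g b) ({0<..} \<times> {0<..}) = (\<Sum>\<^sub>\<infinity>a\<in>{0<..}. \<Sum>\<^sub>\<infinity>b\<in>{0<..}. f a * g b)"
      using sm by (intro infsum_Sigma'_banach[symmetric]) auto
    also have "\<dots> = (\<Sum>\<^sub>\<infinity>a\<in>{0<..}. f a * (\<Sum>n. g (Suc n)))"
      using infsumI[OF pos(1)[OF g]] pos(1)[OF g]
      by (intro infsum_cong) (subst infsum_cmult_right, auto simp: has_sum_imp_summable)
    also have "\<dots> = (\<Sum>n. f (Suc n)) * (\<Sum>n. g (Suc n))"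
      using infsumI[OF pos(1)[OF f]] pos(1)[OF f]
      by (subst infsum_cmult_left) (auto simp: has_sum_imp_summable)
    finally show ?thesis .
  qed
  \<comment> \<open>\<open>S\<close> indexes the same double family by the product:
    \<open>(a, b)\<close> corresponds to \<open>(a * b, a)\<close>. Unconditional summability then
    allows summing first over the finite fibres \<open>d dvd n\<close>.\<close>
  define S where "S = (SIGMA n:{0<..}. {d. d dvd (n::nat)})"
  have hs: "((\<lambda>(a,b). f a * g b) has_sum ((\<Sum>n. f (Suc n)) * (\<Sum>n. g (Suc n)))) ({0<..} \<times> {0<..})"
    using sm eq by (simp add: has_sum_iff)
  have "((\<lambda>(n,d). f d * g (n div d)) has_sum ((\<Sum>n. f (Suc n)) * (\<Sum>n. g (Suc n)))) S"
    using hs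
    by (subst has_sum_reindex_bij_witness[of _ "\<lambda>(a,b). (a * b, a)" "\<lambda>(n,d). (d, n div d)" _ "\<lambda>(a,b). f a * g b"
          , where S = S and T = "{0<..} \<times> {0<..}"])
       (auto simp: S_def intro: Nat.gr0I)
  moreover have "((\<lambda>d. case (n, d) of (n, d) \<Rightarrow> f d * g (n div d)) has_sum
      (\<Sum>d | d dvd n. f d * g (n div d))) {d. d dvd n}" if "n \<in> {0<..}" for n
    using that by (simp add: has_sum_finite)
  ultimately have "((\<lambda>n. \<Sum>d | d dvd n. f d * g (n div d)) has_sum ((\<Sum>n. f (Suc n)) * (\<Sum>n. g (Suc n)))) {0<..}"
    unfolding S_def by (rule has_sum_SigmaD)
  then have "((\<lambda>n. \<Sum>d | d dvd Suc n. f d * g (Suc n div d)) has_sum ((\<Sum>n. f (Suc n)) * (\<Sum>n. g (Suc n)))) UNIV"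
    using has_sum_reindex[of Suc UNIV "\<lambda>n. \<Sum>d | d dvd n. f d * g (n div d)"] by (simp add: range o_def)
  then show ?thesis by (rule has_sum_imp_sums)
qed

definition dirichlet :: "(nat \<Rightarrow> complex) \<Rightarrow> complex \<Rightarrow> complex" where
  "dirichlet a s = (\<Sum>n. a (Suc n) / of_nat (Suc n) powr s)"

lemma norm_of_nat_powr: "norm (of_nat (Suc n) powr s :: complex) = real (Suc n) powr Re s"
  using norm_powr_real_powr[of "of_nat (Suc n)" s] by (simp del: of_nat_Suc)

lemma summable_Suc_powr: "\<sigma> > 1 \<Longrightarrow> summable (\<lambda>n. real (Suc n) powr - \<sigma>)"
  using summable_real_powr_iff[of "-\<sigma>"] summable_Suc_iff[of "\<lambda>n. real n powr - \<sigma>"] by simp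

lemma summable_ln_powr:
  assumes "\<sigma> > 1"
  shows "summable (\<lambda>n. (1 + ln (real (Suc n))) * real (Suc n) powr - \<sigma>)"
proof (rule summable_comparison_test_ev)
  \<comment> \<open>Half of the room \<open>\<sigma> - 1\<close> absorbs the logarithm, the other
    half keeps the exponent above 1.\<close>
  define e where "e = (\<sigma> - 1) / 2"
  show "summable (\<lambda>n. real (Suc n) powr - (\<sigma> - e))"
    using assms by (intro summable_Suc_powr) (simp add: e_def field_simps)
  have "e > 0" using assms by (simp add: e_def)
  then have "eventually (\<lambda>n. 1 + ln (real (Suc n)) \<le> real (Suc n) powr e) sequentially"
    by real_asymp
  then show "eventually (\<lambda>n. norm ((1 + ln (real (Suc n))) * real (Suc n) powr - \<sigma>) \<le> real (Suc n) powr - (\<sigma> - e)) sequentially"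
  proof eventually_elim
    case (elim n)
    have "norm ((1 + ln (real (Suc n))) * real (Suc n) powr - \<sigma>) = (1 + ln (real (Suc n))) * real (Suc n) powr - \<sigma>"
      by (simp add: abs_mult)
    also have "\<dots> \<le> real (Suc n) powr e * real (Suc n) powr - \<sigma>"
      using elim by (intro mult_right_mono) auto
    finally show ?case by (simp add: powr_add[symmetric] algebra_simps)
  qed
qed

text \<open>The growth hypothesis covers both bounded coefficients and \<open>ln\<close>, \<open>mangoldt\<close>.\<close>

lemma dirichlet_summable:
  assumes "\<And>n. n > 0 \<Longrightarrow> norm (a n) \<le> 1 + ln (real n)" "Re s > 1"
  shows "summable (\<lambda>n. norm (a (Suc n) / of_nat (Suc n) powr s))"
proof (rule summable_comparison_test)
  show "summable (\<lambda>n. (1 + ln (real (Suc n))) * real (Suc n) powr - Re s)"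
    by (rule summable_ln_powr) fact
  have "norm (norm (a (Suc n) / of_nat (Suc n) powr s)) \<le> (1 + ln (real (Suc n))) * real (Suc n) powr - Re s" for n
    using mult_right_mono[OF assms(1)[of "Suc n"], of "inverse (real (Suc n) powr Re s)"]
    by (simp add: norm_divide norm_of_nat_powr powr_minus divide_inverse norm_mult norm_inverse del: of_nat_Suc)
  then show "\<exists>N. \<forall>n\<ge>N. norm (norm (a (Suc n) / of_nat (Suc n) powr s)) \<le> (1 + ln (real (Suc n))) * real (Suc n) powr - Re s"
    by blast
qed

lemma dirichlet_mult:
  assumes "\<And>n. n > 0 \<Longrightarrow> norm (a n) \<le> 1 + ln (real n)" "\<And>n. n > 0 \<Longrightarrow> norm (b n) \<le> 1 + ln (real n)" "Re s > 1"
  shows "dirichlet a s * dirichlet b s = dirichlet (\<lambda>n. \<Sum>d | d dvd n. a d * b (n div d)) s"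
proof -
  have "(\<lambda>n. \<Sum>d | d dvd Suc n. (a d / of_nat d powr s) * (b (Suc n div d) / of_nat (Suc n div d) powr s)) sums
           (dirichlet a s * dirichlet b s)"
    unfolding dirichlet_def
    using dirichlet_product_sums[of "\<lambda>n. a n / of_nat n powr s" "\<lambda>n. b n / of_nat n powr s"]
      dirichlet_summable[OF assms(1,3)] dirichlet_summable[OF assms(2,3)] by simp
  moreover have "(\<Sum>d | d dvd Suc n. (a d / of_nat d powr s) * (b (Suc n div d) / of_nat (Suc n div d) powr s)) =
     (\<Sum>d | d dvd Suc n. a d * b (Suc n div d)) / of_nat (Suc n) powr s" for n
    unfolding sum_divide_distrib
  proof (intro sum.cong refl)
    fix d assume "d \<in> {d. d dvd Suc n}"
    then obtain e where e: "Suc n = d * e" by auto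
    then have "d > 0" "e > 0" by (auto intro: Nat.gr0I)
    have "(of_nat (Suc n) :: complex) powr s = of_nat d powr s * of_nat e powr s"
      unfolding e of_nat_mult
      using powr_times_real[of "of_nat d" "of_nat e" s] by simp
    then show "a d / of_nat d powr s * (b (Suc n div d) / of_nat (Suc n div d) powr s) =
         a d * b (Suc n div d) / of_nat (Suc n) powr s"
      using e \<open>d > 0\<close> by simp
  qed
  ultimately show ?thesis unfolding dirichlet_def by (simp add: sums_iff)
qed

lemma dirichlet_has_field_derivative:
  assumes a: "\<And>n. n > 0 \<Longrightarrow> norm (a n) \<le> 1" and s: "Re s > 1"
  shows "(dirichlet a has_field_derivative - dirichlet (\<lambda>n. a n * ln (real n)) s) (at s)"
proof -
  define f where "f = (\<lambda>n s. a (Suc n) / of_nat (Suc n) powr s)"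
  define f' where "f' = (\<lambda>n s. - (a (Suc n) * ln (real (Suc n)) / of_nat (Suc n) powr s))"
  have "\<exists>D D'. \<forall>x\<in>{s. Re s > 1}. ((\<lambda>n. f n x) sums D x) \<and> ((\<lambda>n. f' n x) sums D' x) \<and> (D has_field_derivative D' x) (at x)"
  proof (rule series_and_derivative_comparison_complex)
    show "open {s. Re s > 1}" by (rule open_halfspace_Re_gt)
    show "(f n has_field_derivative f' n x) (at x)" for n x
    proof -
      have [simp]: "1 + complex_of_nat n \<noteq> 0"
        using of_nat_neq_0[of n, where 'a=complex] by (simp del: of_nat_neq_0)
      have [simp]: "Ln (1 + complex_of_nat n) = of_real (ln (1 + real n))"
        using Ln_of_real[of "1 + real n"] by simp
      show ?thesis
        unfolding f_def f'_def
        by (auto intro!: derivative_eq_intros simp: powr_def field_simps exp_minus)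
    qed
    fix x :: complex assume x: "x \<in> {s. Re s > 1}"
    \<comment> \<open>Half the distance to the line \<open>Re s = 1\<close>: on
      \<open>ball x d\<close> all terms are dominated by powers with exponent
      \<open>Re x - d\<close>, which still exceeds 1.\<close>
    define d where "d = (Re x - 1) / 2"
    define h where "h = (\<lambda>n. of_real (real (Suc n) powr - (Re x - d)) :: complex)"
    have "summable h" unfolding h_def 
      by (subst summable_of_real_iff, rule summable_Suc_powr) (use x in \<open>simp add: d_def field_simps\<close>)
    moreover have "d > 0" using x by (simp add: d_def)
    moreover have "norm (f n y) \<le> norm (h n)" if "y \<in> ball x d" for n y
    proof -
      have "\<bar>Re (y - x)\<bar> < d" using that abs_Re_le_cmod[of "y - x"] by (auto simp: dist_norm norm_minus_commute)
      then have "real (Suc n) powr - Re y \<le> real (Suc n) powr - (Re x - d)"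
        by (intro powr_mono) auto
      then have "norm (a (Suc n)) * real (Suc n) powr - Re y \<le> 1 * real (Suc n) powr - (Re x - d)"
        using a[of "Suc n"] by (intro mult_mono) auto
      then show ?thesis
        by (simp add: f_def h_def norm_mult norm_inverse norm_of_nat_powr powr_minus divide_inverse del: of_nat_Suc)
    qed
    ultimately show "\<exists>d (h :: nat \<Rightarrow> complex). 0 < d \<and> summable h \<and> range h \<subseteq> \<real>\<^sub>\<ge>\<^sub>0 \<and>
        (\<forall>\<^sub>F n in sequentially. \<forall>y\<in>ball x d \<inter> {s. Re s > 1}. norm (f n y) \<le> norm (h n))"
      by (intro exI[of _ d] exI[of _ h]) (auto simp: h_def)
  qed
  then obtain D D' where D: "\<And>x. Re x > 1 \<Longrightarrow> (\<lambda>n. f n x) sums D x"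
    "\<And>x. Re x > 1 \<Longrightarrow> (\<lambda>n. f' n x) sums D' x" "\<And>x. Re x > 1 \<Longrightarrow> (D has_field_derivative D' x) (at x)"
    by auto
  have "D' s = - dirichlet (\<lambda>n. a n * ln (real n)) s"
  proof -
    have "(\<lambda>n. - (f' n s)) sums (- D' s)" by (intro sums_minus D s)
    then show ?thesis unfolding dirichlet_def f'_def by (simp add: sums_iff)
  qed
  then have "(D has_field_derivative - dirichlet (\<lambda>n. a n * ln (real n)) s) (at s)"
    using D(3)[OF s] by simp
  moreover have "dirichlet a x = D x" if "Re x > 1" for x
    using D(1)[OF that] unfolding dirichlet_def f_def by (simp add: sums_iff)
  ultimately show ?thesis
    using s by (subst DERIV_cong_ev[OF refl _ refl])
      (auto intro!: eventually_mono[OF eventually_nhds_in_open[OF open_halfspace_Re_gt[of 1]]])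
qed

abbreviation zeta_series :: "complex \<Rightarrow> complex" where
  "zeta_series \<equiv> dirichlet (\<lambda>_. 1)"

lemma dirichlet_moebius_times_zeta_series:
  assumes "Re s > 1"
  shows "dirichlet (\<lambda>n. of_int (moebius_mu n)) s * zeta_series s = 1"
proof -
  have 1: "norm (of_int (moebius_mu n) :: complex) \<le> 1 + ln (real n)" if "n > 0" for n
  proof -
    have "norm (of_int (moebius_mu n) :: complex) \<le> 1" by (rule norm_moebius_mu_le)
    then show ?thesis using that ln_ge_zero[of "real n"] by linarith
  qed
  have "dirichlet (\<lambda>n. of_int (moebius_mu n)) s * zeta_series s =
     dirichlet (\<lambda>n. \<Sum>d | d dvd n. of_int (moebius_mu d) * 1) s"
    using 1 assms by (intro dirichlet_mult) auto
  also have "\<dots> = (\<Sum>n. if n = 0 then 1 else 0)"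
    unfolding dirichlet_def
  proof (intro suminf_cong)
    fix n
    have "(\<Sum>d | d dvd Suc n. of_int (moebius_mu d) * 1 :: complex) = of_int (\<Sum>d | d dvd Suc n. moebius_mu d)"
      by simp
    also have "\<dots> = (if n = 0 then 1 else 0)"
      by (subst sum_moebius_mu_divisors) auto
    finally show "(\<Sum>d | d dvd Suc n. of_int (moebius_mu d) * 1 :: complex) / of_nat (Suc n) powr s = (if n = 0 then 1 else 0)"
      by simp
  qed
  also have "\<dots> = 1" by (subst suminf_finite[of "{0}"]) auto
  finally show ?thesis .
qed

lemma zeta_series_nonzero: "Re s > 1 \<Longrightarrow> zeta_series s \<noteq> 0"
  using dirichlet_moebius_times_zeta_series[of s] by auto

section \<open>The Fourier series of the second Bernoulli polynomial\<close>

text \<open>The factorisation of \<open>1 - exp(iu)\<close> into \<open>2 sin(u/2)\<close> and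
  \<open>exp(i(u - pi)/2)\<close> has a positive modulus and an argument in (-pi/2, pi/2), so it
  exhibits the principal logarithm. The value is minus the sawtooth with Fourier series sum of
  sin(nu)/n.\<close>

lemma Ln_one_minus_exp_ii:
  assumes "0 < u" "u < 2 * pi"
  shows "Im (Ln (1 - exp (\<i> * of_real u))) = (u - pi) / 2"
proof -
  have "1 - exp (\<i> * of_real u) = of_real (2 * sin (u / 2)) * exp (\<i> * of_real ((u - pi) / 2))"
  proof -
    have "cos u = 1 - 2 * (sin (u/2))\<^sup>2" "sin u = 2 * sin (u/2) * cos (u/2)"
      using cos_double_sin[of "u/2"] sin_double[of "u/2"] by simp_all
    moreover have "cos ((u - pi) / 2) = sin (u/2)" "sin ((u - pi) / 2) = - cos (u/2)"
      by (simp_all add: diff_divide_distrib cos_diff sin_diff)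
    ultimately show ?thesis
      by (simp add: complex_eq_iff Re_exp Im_exp power2_eq_square)
  qed
  moreover have "sin (u / 2) > 0" using assms by (intro sin_gt_zero) auto
  moreover have "Ln (exp (\<i> * of_real ((u - pi) / 2))) = \<i> * of_real ((u - pi) / 2)"
    using assms by (intro Ln_exp) (auto simp: field_simps)
  ultimately have "Ln (1 - exp (\<i> * of_real u)) = of_real (ln (2 * sin (u / 2))) + \<i> * of_real ((u - pi) / 2)"
    using Ln_times_of_real[of "2 * sin (u / 2)" "exp (\<i> * of_real ((u - pi) / 2))"]
      Ln_of_real[of "2 * sin (u / 2)"]
    by (simp only: mult_pos_pos zero_less_numeral exp_not_eq_zero not_False_eq_True simp_thms)
  then show ?thesis by simp
qed

text \<open>\<open>1 - z\<close> lies in the right half-plane. The bound is the constant majorant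
  for the passage to the unit circle below.\<close>

lemma Im_Ln_one_minus_bound:
  assumes "norm z < 1"
  shows "\<bar>Im (Ln (1 - z))\<bar> \<le> pi / 2"
proof -
  have "Re z < 1" using assms complex_Re_le_cmod[of z] by linarith
  then have "Re (1 - z) > 0" by simp
  then have "\<bar>Im (Ln (1 - z))\<bar> < pi / 2" by (subst Re_Ln_pos_lt) auto
  then show ?thesis by simp
qed

text \<open>\<open>D\<close> is the dilogarithm (its coefficient at \<open>n = 0\<close> is 0
  because division by zero is 0), so \<open>z * D' z = - Ln (1 - z)\<close>, and along the circle of
  radius \<open>r\<close> the function \<open>- Re (D (e u))\<close> is an antiderivative of the
  integrand. The radius \<open>r < 1\<close> is an Abel regularisation.\<close>

lemma has_integral_Abel_cos_series:
  assumes r: "0 < r" "r < 1" and y: "0 \<le> y"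
  shows "((\<lambda>u. - Im (Ln (1 - of_real r * exp (\<i> * of_real u)))) has_integral
            (\<Sum>n. r ^ n * (1 - cos (real n * y)) / (real n)\<^sup>2)) {0..y}"
proof -
  have "summable (\<lambda>n. (1 / (of_nat n)\<^sup>2) * of_real (1 ^ n) :: complex)"
  proof -
    have "summable (\<lambda>n. of_real (1 / (real n)\<^sup>2) :: complex)"
      using inverse_power_summable[of 2, where 'a = real]
      by (subst summable_of_real_iff) (simp add: field_simps)
    then show ?thesis by simp
  qed
  from power_series_and_derivative_0[OF this] obtain D D' where
    D: "\<And>z :: complex. norm z < 1 \<Longrightarrow> (\<lambda>n. 1 / (of_nat n)\<^sup>2 * z ^ n) sums D z"
    and D': "\<And>z :: complex. norm z < 1 \<Longrightarrow> (\<lambda>n. of_nat n * (1 / (of_nat n)\<^sup>2) * z ^ (n - 1)) sums D' z"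
    and der: "\<And>z :: complex. norm z < 1 \<Longrightarrow> (D has_field_derivative D' z) (at z)"
    by blast
  have zD': "z * D' z = - Ln (1 - z)" if "norm z < 1" for z
  proof -
    have "(\<lambda>n. z * (of_nat n * (1 / (of_nat n)\<^sup>2) * z ^ (n - 1))) sums (z * D' z)"
      by (intro sums_mult D' that)
    moreover have "z * (of_nat n * (1 / (of_nat n)\<^sup>2) * z ^ (n - 1)) = z ^ n / of_nat n" for n
    proof (cases "n = 0")
      case False
      then have "z * z ^ (n - 1) = z ^ n" by (simp add: power_eq_if)
      moreover have "of_nat n * (1 / (of_nat n)\<^sup>2) = (1 / of_nat n :: complex)"
        using False by (simp add: power2_eq_square)
      ultimately show ?thesis by (simp add: mult.left_commute)
    qed simp
    ultimately have "(\<lambda>n. z ^ n / of_nat n) sums (z * D' z)" by simp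
    moreover have "(\<lambda>n. - (((-1) ^ Suc n / of_nat n * (- z) ^ n))) sums (- Ln (1 - z))"
      using Ln_series[of "-z"] that by (intro sums_minus) simp
    moreover have "- (((-1) ^ Suc n / of_nat n * (- z) ^ n)) = z ^ n / of_nat n" for n
      by (simp add: power_mult_distrib[symmetric])
    ultimately show ?thesis by (metis (no_types, lifting) sums_cong sums_unique2)
  qed
  define e where "e = (\<lambda>u. of_real r * exp (\<i> * of_real u) :: complex)"
  have e: "norm (e u) < 1" for u using r by (simp add: e_def norm_mult)
  have "((\<lambda>u. - Re (D (e u))) has_vector_derivative - Im (Ln (1 - e u))) (at u within {0..y})" for u
  proof -
    have "(e has_vector_derivative \<i> * e u) (at u within {0..y})"
      unfolding e_def
      by (rule has_vector_derivative_real_field) (auto intro!: derivative_eq_intros)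
    from field_vector_diff_chain_within[OF this, of D "D' (e u)"]
    have "((D \<circ> e) has_vector_derivative \<i> * e u * D' (e u)) (at u within {0..y})"
      using der[OF e[of u]] by (simp add: has_field_derivative_at_within)
    moreover have "\<i> * e u * D' (e u) = - (\<i> * Ln (1 - e u))"
      using zD'[OF e[of u]] by (simp add: mult.assoc)
    ultimately have "((\<lambda>u. Re ((D \<circ> e) u)) has_vector_derivative Re (- (\<i> * Ln (1 - e u)))) (at u within {0..y})"
      by (intro bounded_linear.has_vector_derivative[OF bounded_linear_Re]) (simp add: o_def)
    from has_vector_derivative_minus[OF this] show ?thesis by (simp add: o_def)
  qed
  then have "((\<lambda>u. - Im (Ln (1 - e u))) has_integral (- Re (D (e y)) - (- Re (D (e 0))))) {0..y}"
    by (intro fundamental_theorem_of_calculus y)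
  moreover have "- Re (D (e y)) - (- Re (D (e 0))) = (\<Sum>n. r ^ n * (1 - cos (real n * y)) / (real n)\<^sup>2)"
  proof -
    have "(\<lambda>n. Re (1 / (of_nat n)\<^sup>2 * e 0 ^ n) - Re (1 / (of_nat n)\<^sup>2 * e y ^ n)) sums (Re (D (e 0)) - Re (D (e y)))"
      by (intro sums_diff sums_Re D e)
    moreover have "Re (1 / (of_nat n)\<^sup>2 * e u ^ n) = r ^ n * cos (real n * u) / (real n)\<^sup>2" for n u
    proof -
      have "e u ^ n = of_real (r ^ n) * exp (\<i> * of_real (real n * u))"
        unfolding e_def by (simp add: power_mult_distrib exp_of_nat_mult[symmetric] algebra_simps)
      then have "1 / (of_nat n)\<^sup>2 * e u ^ n = of_real (r ^ n / (real n)\<^sup>2) * exp (\<i> * of_real (real n * u))"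
        by simp
      then show ?thesis by (simp add: Re_exp del: of_real_divide of_real_power)
    qed
    ultimately have "(\<lambda>n. r ^ n * cos (real n * 0) / (real n)\<^sup>2 - r ^ n * cos (real n * y) / (real n)\<^sup>2) sums
        (Re (D (e 0)) - Re (D (e y)))" by (simp only: )
    then show ?thesis by (simp add: sums_iff diff_divide_distrib right_diff_distrib)
  qed
  ultimately show ?thesis by (simp add: e_def)
qed

text \<open>Let \<open>r\<close> tend to 1 in the Abel identity: dominated convergence handles the
  integral, Tannery's theorem the series.\<close>

lemma sums_one_minus_cos_over_square:
  assumes y: "0 \<le> y" "y < 2 * pi"
  shows "(\<lambda>n. (1 - cos (real n * y)) / (real n)\<^sup>2) sums (y * (2 * pi - y) / 4)"
proof -
  define r where "r = (\<lambda>k. 1 - 1 / real (k + 2))"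
  have r: "0 < r k" "r k < 1" for k by (auto simp: r_def)
  have r1: "r \<longlonglongrightarrow> 1" unfolding r_def by real_asymp
  define f where "f = (\<lambda>k u. - Im (Ln (1 - of_real (r k) * exp (\<i> * of_real u))))"
  define S where "S = (\<lambda>k. \<Sum>n. r k ^ n * (1 - cos (real n * y)) / (real n)\<^sup>2)"
  have int: "(f k has_integral S k) {0..y}" for k
    unfolding f_def S_def by (intro has_integral_Abel_cos_series r y)
  \<comment> \<open>At \<open>u = 0\<close> every \<open>f k\<close> is 0, so the limit there is 0
    and not \<open>pi / 2\<close>; the exceptional point is removed when \<open>L\<close> is
    integrated.\<close>
  define L where "L = (\<lambda>u::real. if u = 0 then 0 else (pi - u) / 2)"
  have "(\<lambda>k. integral {0..y} (f k)) \<longlonglongrightarrow> integral {0..y} L"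
  proof (rule dominated_convergence(2))
    show "f k integrable_on {0..y}" for k using int by blast
    show "(\<lambda>_. pi / 2) integrable_on {0..y}" by (intro integrable_const_ivl)
    show "norm (f k u) \<le> pi / 2" if "u \<in> {0..y}" for k u
      using Im_Ln_one_minus_bound[of "of_real (r k) * exp (\<i> * of_real u)"] r[of k]
      by (simp add: f_def norm_mult)
    show "(\<lambda>k. f k u) \<longlonglongrightarrow> L u" if "u \<in> {0..y}" for u
    proof (cases "u = 0")
      case True
      have "f k u = 0" for k
        using r[of k] Ln_of_real[of "1 - r k"] by (simp add: f_def True)
      then show ?thesis by (simp add: L_def True)
    next
      case False
      then have u: "0 < u" "u < 2 * pi" using that y by auto
      have "cos u \<noteq> 1"
      proof
        assume "cos u = 1"
        then have "sin (u / 2) = 0" using cos_double_sin[of "u/2"] by simp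
        moreover have "sin (u / 2) > 0" using u by (intro sin_gt_zero) auto
        ultimately show False by simp
      qed
      then have "cos u < 1" using cos_le_one[of u] by linarith
      then have "1 - 1 * exp (\<i> * of_real u) \<notin> \<real>\<^sub>\<le>\<^sub>0"
        by (auto simp: complex_nonpos_Reals_iff Re_exp)
      moreover have "(\<lambda>k. 1 - of_real (r k) * exp (\<i> * of_real u)) \<longlonglongrightarrow> 1 - of_real 1 * exp (\<i> * of_real u)"
        by (intro tendsto_intros r1)
      ultimately have "(\<lambda>k. f k u) \<longlonglongrightarrow> - Im (Ln (1 - of_real 1 * exp (\<i> * of_real u)))"
        unfolding f_def by (auto intro!: tendsto_intros)
      moreover have "L u = - ((u - pi) / 2)"
        using False by (simp only: L_def if_False minus_divide_left minus_diff_eq)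
      ultimately show ?thesis using Ln_one_minus_exp_ii[OF u] by (simp only: mult_1 of_real_1)
    qed
  qed
  moreover have "integral {0..y} (f k) = S k" for k using int by blast
  moreover have "integral {0..y} L = y * (2 * pi - y) / 4"
  proof -
    have "((\<lambda>u. (pi - u) / 2) has_integral ((pi * y / 2 - y\<^sup>2 / 4) - (pi * 0 / 2 - 0\<^sup>2 / 4))) {0..y}"
      by (intro fundamental_theorem_of_calculus y)
         (auto intro!: derivative_eq_intros simp: has_real_derivative_iff_has_vector_derivative[symmetric] field_simps)
    then have "(L has_integral ((pi * y / 2 - y\<^sup>2 / 4) - (pi * 0 / 2 - 0\<^sup>2 / 4))) {0..y}"
      by (rule has_integral_spike_finite[rotated 2, of _ _ _ "{0}"]) (auto simp: L_def)
    then show ?thesis by (simp add: integral_unique power2_eq_square field_simps)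
  qed
  ultimately have S_lim: "S \<longlonglongrightarrow> y * (2 * pi - y) / 4" by simp
  define M where "M = (\<lambda>n. 2 / (real n)\<^sup>2)"
  have M: "summable M" unfolding M_def
    using summable_mult[OF inverse_power_summable[of 2, where 'a = real], of 2] by (simp add: field_simps)
  have bd: "norm (c * (1 - cos (real n * y)) / (real n)\<^sup>2) \<le> M n" if "0 \<le> c" "c \<le> 1" for c n
  proof -
    have "\<bar>c * (1 - cos (real n * y))\<bar> \<le> 1 * 2"
      unfolding abs_mult using that abs_cos_le_one[of "real n * y"]
      by (intro mult_mono) (auto simp: abs_le_iff)
    then show ?thesis unfolding M_def by (simp add: divide_right_mono abs_mult)
  qed
  have "S \<longlonglongrightarrow> (\<Sum>n. 1 * (1 - cos (real n * y)) / (real n)\<^sup>2)"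
    unfolding S_def
  proof (rule tannerys_theorem[THEN conjunct2, THEN conjunct2])
    show "(\<lambda>k. r k ^ n * (1 - cos (real n * y)) / (real n)\<^sup>2) \<longlonglongrightarrow> 1 * (1 - cos (real n * y)) / (real n)\<^sup>2" for n
      using tendsto_mult[OF tendsto_power[OF r1, of n] tendsto_const[of "(1 - cos (real n * y)) / (real n)\<^sup>2"]]
      by simp
    show "\<forall>\<^sub>F (n, k) in sequentially \<times>\<^sub>F sequentially.
            norm (r k ^ n * (1 - cos (real n * y)) / (real n)\<^sup>2) \<le> M n"
    proof (intro always_eventually allI, clarify)
      fix n k
      show "norm (r k ^ n * (1 - cos (real n * y)) / (real n)\<^sup>2) \<le> M n"
        using r[of k] by (intro bd) (auto intro: power_le_one)
    qed
    show "summable M" by (fact M)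
  qed auto
  with S_lim have "(\<Sum>n. 1 * (1 - cos (real n * y)) / (real n)\<^sup>2) = y * (2 * pi - y) / 4"
    by (rule LIMSEQ_unique[rotated])
  moreover have "summable (\<lambda>n. 1 * (1 - cos (real n * y)) / (real n)\<^sup>2)"
    by (rule summable_comparison_test[OF _ M]) (use bd[of 1] in force)
  ultimately show ?thesis by (simp add: sums_iff)
qed

text \<open>Put \<open>y = 2 * pi * frac x\<close> and use the period of the cosine. With
  \<open>1 - cos\<close> every term is nonnegative, so the series can later be integrated term by
  term by monotone convergence.\<close>

lemma sums_frac_fourier:
  "(\<lambda>n. (1 - cos (2 * pi * real (Suc n) * x)) / (pi * real (Suc n))\<^sup>2) sums (frac x * (1 - frac x))"
proof -
  have "(\<lambda>n. (1 - cos (real n * (2 * pi * frac x))) / (real n)\<^sup>2 / pi\<^sup>2) sums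
        (2 * pi * frac x * (2 * pi - 2 * pi * frac x) / 4 / pi\<^sup>2)"
    using frac_lt_1[of x] by (intro sums_divide sums_one_minus_cos_over_square) auto
  moreover have "cos (real n * (2 * pi * frac x)) = cos (2 * pi * real n * x)" for n
  proof -
    have "2 * pi * real n * x = real n * (2 * pi * frac x) + of_int (int n * \<lfloor>x\<rfloor>) * (2 * pi)"
      by (simp add: frac_def algebra_simps)
    then show ?thesis
      using cos.plus_of_int[of "real n * (2 * pi * frac x)" "int n * \<lfloor>x\<rfloor>"] by (simp add: mult_ac)
  qed
  moreover have "2 * pi * frac x * (2 * pi - 2 * pi * frac x) / 4 / pi\<^sup>2 = frac x * (1 - frac x)"
    by (simp add: field_simps power2_eq_square)
  ultimately have "(\<lambda>n. (1 - cos (2 * pi * real n * x)) / (pi * real n)\<^sup>2) sums (frac x * (1 - frac x))"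
    by (simp add: power_mult_distrib divide_divide_eq_left mult.commute[of "pi\<^sup>2"])
  then show ?thesis by (subst sums_Suc_iff) simp
qed

section \<open>Mellin integrals of elementary functions\<close>

lemma ennreal_mult_eq_imp_eq_divide:
  assumes "c > 0" "ennreal c * X = ennreal y"
  shows "X = ennreal (y / c)"
proof -
  have "X = ennreal (1 / c) * ennreal c * X"
    using assms by (simp add: ennreal_mult'[symmetric])
  also have "\<dots> = ennreal (1 / c) * ennreal y" by (simp only: mult.assoc assms)
  also have "\<dots> = ennreal (y / c)" using assms by (simp add: ennreal_mult'[symmetric])
  finally show ?thesis .
qed

lemma nn_integral_Gamma_scaled:
  assumes c: "c > 0" and w: "w > 0"
  shows "(\<integral>\<^sup>+v\<in>{0<..}. ennreal (v powr (c - 1) * exp (- w * v)) \<partial>lborel) = ennreal (Gamma c * w powr - c)"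
proof -
  have "ennreal (Gamma c) = (\<integral>\<^sup>+t. ennreal (indicator {0..} t * t powr (c - 1) / exp t) \<partial>lborel)"
    by (rule Gamma_conv_nn_integral_real) fact
  also have "\<dots> = ennreal \<bar>w\<bar> * (\<integral>\<^sup>+t. ennreal (indicator {0..} (0 + w * t) * (0 + w * t) powr (c - 1) / exp (0 + w * t)) \<partial>lborel)"
    using w by (subst nn_integral_real_affine[where c = w and t = 0]) auto
  also have "(\<integral>\<^sup>+t. ennreal (indicator {0..} (0 + w * t) * (0 + w * t) powr (c - 1) / exp (0 + w * t)) \<partial>lborel) =
     (\<integral>\<^sup>+t. ennreal (w powr (c - 1)) * (ennreal (t powr (c - 1) * exp (- w * t)) * indicator {0<..} t) \<partial>lborel)"
  proof (intro nn_integral_cong)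
    fix t :: real
    show "ennreal (indicator {0..} (0 + w * t) * (0 + w * t) powr (c - 1) / exp (0 + w * t)) =
        ennreal (w powr (c - 1)) * (ennreal (t powr (c - 1) * exp (- w * t)) * indicator {0<..} t)"
      using w by (cases t "0::real" rule: linorder_cases)
        (auto simp: powr_mult ennreal_mult'[symmetric] exp_minus field_simps zero_le_mult_iff indicator_def)
  qed
  also have "\<dots> = ennreal (w powr (c - 1)) * (\<integral>\<^sup>+v\<in>{0<..}. ennreal (v powr (c - 1) * exp (- w * v)) \<partial>lborel)"
    by (intro nn_integral_cmult) auto
  finally have "ennreal (w powr - c) * ennreal (Gamma c) = ennreal (w powr - c) * (ennreal \<bar>w\<bar> * (ennreal (w powr (c - 1)) *
     (\<integral>\<^sup>+v\<in>{0<..}. ennreal (v powr (c - 1) * exp (- w * v)) \<partial>lborel)))"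
    by simp
  also have "\<dots> = ennreal (w powr - c * (w powr 1 * w powr (c - 1))) * (\<integral>\<^sup>+v\<in>{0<..}. ennreal (v powr (c - 1) * exp (- w * v)) \<partial>lborel)"
    using w by (simp add: ennreal_mult' mult.assoc)
  also have "w powr - c * (w powr 1 * w powr (c - 1)) = 1"
    using w by (simp only: powr_add[symmetric]) simp
  finally show ?thesis using w c by (simp add: ennreal_mult'[symmetric] mult.commute Gamma_real_pos less_imp_le)
qed

text \<open>This is the Beta integral B(c, 1 - c): write \<open>1 / (1 + v)\<close> as the integral
  of \<open>exp (- w * (1 + v))\<close> over \<open>w > 0\<close> and exchange the order; two Gamma
  integrals remain.\<close>

lemma nn_integral_powr_over_one_plus:
  assumes c: "0 < c" "c < 1"
  shows "(\<integral>\<^sup>+v\<in>{0<..}. ennreal (v powr (c - 1) / (1 + v)) \<partial>lborel) = ennreal (Gamma c * Gamma (1 - c))"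
proof -
  have "(\<integral>\<^sup>+v\<in>{0<..}. ennreal (v powr (c - 1) / (1 + v)) \<partial>lborel) =
    (\<integral>\<^sup>+v. (\<integral>\<^sup>+w. ennreal (v powr (c - 1) * exp (- w * (1 + v))) * indicator {0<..} w * indicator {0<..} v \<partial>lborel) \<partial>lborel)"
  proof (intro nn_integral_cong)
    fix v :: real
    show "ennreal (v powr (c - 1) / (1 + v)) * indicator {0<..} v =
      (\<integral>\<^sup>+w. ennreal (v powr (c - 1) * exp (- w * (1 + v))) * indicator {0<..} w * indicator {0<..} v \<partial>lborel)"
    proof (cases "v > 0")
      case True
      have "(\<integral>\<^sup>+w. ennreal (v powr (c - 1) * exp (- w * (1 + v))) * indicator {0<..} w * indicator {0<..} v \<partial>lborel) =
         (\<integral>\<^sup>+w. ennreal (v powr (c - 1)) * (ennreal (w powr (1 - 1) * exp (- (1 + v) * w)) * indicator {0<..} w) \<partial>lborel)"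
        using True by (intro nn_integral_cong) (auto simp: ennreal_mult'[symmetric] indicator_def algebra_simps)
      also have "\<dots> = ennreal (v powr (c - 1)) * ennreal (Gamma 1 * (1 + v) powr - 1)"
        using True nn_integral_Gamma_scaled[of 1 "1 + v"] by (subst nn_integral_cmult) auto
      also have "\<dots> = ennreal (v powr (c - 1) / (1 + v))"
        using True by (simp add: ennreal_mult'[symmetric] powr_minus divide_inverse)
      finally show ?thesis using True by simp
    qed simp
  qed
  also have "\<dots> = (\<integral>\<^sup>+w. (\<integral>\<^sup>+v. ennreal (v powr (c - 1) * exp (- w * (1 + v))) * indicator {0<..} w * indicator {0<..} v \<partial>lborel) \<partial>lborel)"
    by (rule lborel_pair.Fubini') measurable
  also have "\<dots> = (\<integral>\<^sup>+w. ennreal (Gamma c) * (ennreal (w powr ((1 - c) - 1) * exp (- 1 * w)) * indicator {0<..} w) \<partial>lborel)"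
  proof (intro nn_integral_cong)
    fix w :: real
    show "(\<integral>\<^sup>+v. ennreal (v powr (c - 1) * exp (- w * (1 + v))) * indicator {0<..} w * indicator {0<..} v \<partial>lborel) =
       ennreal (Gamma c) * (ennreal (w powr ((1 - c) - 1) * exp (- 1 * w)) * indicator {0<..} w)"
    proof (cases "w > 0")
      case True
      have "(\<integral>\<^sup>+v. ennreal (v powr (c - 1) * exp (- w * (1 + v))) * indicator {0<..} w * indicator {0<..} v \<partial>lborel) =
         (\<integral>\<^sup>+v. ennreal (exp (- w)) * (ennreal (v powr (c - 1) * exp (- w * v)) * indicator {0<..} v) \<partial>lborel)"
        using True by (intro nn_integral_cong)
          (auto simp: ennreal_mult'[symmetric] indicator_def algebra_simps exp_add exp_diff exp_minus divide_inverse)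
      also have "\<dots> = ennreal (exp (- w)) * ennreal (Gamma c * w powr - c)"
        using True nn_integral_Gamma_scaled[of c w] c by (subst nn_integral_cmult) auto
      finally show ?thesis using True c
        by (simp add: ennreal_mult'[symmetric] Gamma_real_pos less_imp_le mult_ac)
    qed simp
  qed
  also have "\<dots> = ennreal (Gamma c) * ennreal (Gamma (1 - c) * 1 powr - (1 - c))"
    using nn_integral_Gamma_scaled[of "1 - c" 1] c by (subst nn_integral_cmult) auto
  finally show ?thesis using c by (simp add: ennreal_mult'[symmetric] Gamma_real_pos less_imp_le)
qed

text \<open>Finiteness makes \<open>f\<close> absolutely integrable, which is the setting of the
  change of variables theorem; nonnegativity translates the result back to \<open>ennreal\<close>
  integrals.\<close>

lemma nn_integral_substitution_pos:
  fixes f :: "real \<Rightarrow> real" and h h' :: "real \<Rightarrow> real"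
  assumes f [measurable]: "f \<in> borel_measurable borel" and [measurable]: "h \<in> borel_measurable borel" "h' \<in> borel_measurable borel"
    and der: "\<And>x. x > 0 \<Longrightarrow> (h has_field_derivative h' x) (at x)"
    and bij: "bij_betw h {0<..} {0<..}" and nonneg: "\<And>x. x > 0 \<Longrightarrow> f x \<ge> 0"
    and fin: "(\<integral>\<^sup>+x\<in>{0<..}. ennreal (f x) \<partial>lborel) < \<infinity>"
  shows "(\<integral>\<^sup>+x\<in>{0<..}. ennreal (\<bar>h' x\<bar> * f (h x)) \<partial>lborel) = (\<integral>\<^sup>+x\<in>{0<..}. ennreal (f x) \<partial>lborel)"
proof -
  have img: "h ` {0<..} = {0<..}" and inj: "inj_on h {0<..}" using bij by (auto simp: bij_betw_def)
  have nn: "(\<integral>\<^sup>+x\<in>{0<..}. ennreal (g x) \<partial>lborel) = ennreal (integral {0<..} g)"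
    if "g absolutely_integrable_on {0<..}" "\<And>x. x > 0 \<Longrightarrow> g x \<ge> 0" for g :: "real \<Rightarrow> real"
  proof -
    have "(g has_integral integral {0<..} g) {0<..}"
      using that(1) set_lebesgue_integral_eq_integral(1) by blast
    then have "(\<integral>\<^sup>+x. ennreal (indicator {0<..} x * g x) \<partial>lborel) = ennreal (integral {0<..} g)"
      using that(2) by (intro nn_integral_has_integral_lebesgue) auto
    moreover have "(\<integral>\<^sup>+x. ennreal (indicator {0<..} x * g x) \<partial>lborel) = (\<integral>\<^sup>+x\<in>{0<..}. ennreal (g x) \<partial>lborel)"
      by (intro nn_integral_cong) (auto simp: indicator_def)
    ultimately show ?thesis by simp
  qed
  have fint: "f absolutely_integrable_on {0<..}"
  proof -
    have "set_integrable lborel {0<..} f"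
      unfolding set_integrable_def
    proof (rule integrableI_bounded)
      have "(\<integral>\<^sup>+x. ennreal (norm (indicator {0<..} x *\<^sub>R f x)) \<partial>lborel) = (\<integral>\<^sup>+x\<in>{0<..}. ennreal (f x) \<partial>lborel)"
        using nonneg by (intro nn_integral_cong) (auto simp: indicator_def)
      then show "(\<integral>\<^sup>+x. ennreal (norm (indicator {0<..} x *\<^sub>R f x)) \<partial>lborel) < \<infinity>" using fin by simp
    qed simp
    then show ?thesis by (simp add: set_integrable_def integrable_completion)
  qed
  have *: "(\<lambda>x. \<bar>h' x\<bar> * f (h x)) absolutely_integrable_on {0<..}"
     "integral {0<..} (\<lambda>x. \<bar>h' x\<bar> * f (h x)) = integral {0<..} f"
    using has_absolute_integral_change_of_variables_1'[of "{0<..}" h h' f "integral {0<..} f"] der inj fint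
    by (auto simp: img has_field_derivative_at_within)
  have hpos: "h x > 0" if "x > 0" for x using img that by auto
  show ?thesis
    using nonneg hpos fint * by (subst (1 2) nn) auto
qed

lemma Gamma_reflection_real: "Gamma c * Gamma (1 - c) = pi / sin (pi * c :: real)"
proof -
  have "complex_of_real (Gamma c * Gamma (1 - c)) = of_real (pi / sin (pi * c))"
    using Gamma_reflection_complex[of "of_real c"] Gamma_complex_of_real[of "1 - c"]
    by (simp add: Gamma_complex_of_real sin_of_real[symmetric])
  then show ?thesis by (simp only: of_real_eq_iff)
qed

lemma nn_integral_powr_over_one_plus_sq:
  assumes a: "0 < a" "a < 1"
  shows "(\<integral>\<^sup>+u\<in>{0<..}. ennreal (u powr - a / (1 + u\<^sup>2)) \<partial>lborel) = ennreal (pi / (2 * cos (pi * a / 2)))"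
proof -
  \<comment> \<open>Chosen so that \<open>1 + 2 * (c - 1) = - a\<close>, the exponent that remains
    after substituting \<open>v = u\<^sup>2\<close>.\<close>
  define c where "c = (1 - a) / 2"
  have c: "0 < c" "c < 1" using a by (auto simp: c_def)
  have "(\<integral>\<^sup>+u\<in>{0<..}. ennreal (\<bar>2 * u\<bar> * ((u\<^sup>2) powr (c - 1) / (1 + u\<^sup>2))) \<partial>lborel) =
        (\<integral>\<^sup>+v\<in>{0<..}. ennreal (v powr (c - 1) / (1 + v)) \<partial>lborel)"
  proof (rule nn_integral_substitution_pos)
    show "bij_betw (\<lambda>u::real. u\<^sup>2) {0<..} {0<..}"
      by (rule bij_betw_byWitness[where f' = sqrt]) auto
    show "(\<integral>\<^sup>+v\<in>{0<..}. ennreal (v powr (c - 1) / (1 + v)) \<partial>lborel) < \<infinity>"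
      using nn_integral_powr_over_one_plus[OF c] by simp
  qed (auto intro!: derivative_eq_intros)
  also have "\<dots> = ennreal (Gamma c * Gamma (1 - c))" by (rule nn_integral_powr_over_one_plus[OF c])
  also have "Gamma c * Gamma (1 - c) = pi / sin (pi * c)" by (rule Gamma_reflection_real)
  also have "sin (pi * c) = cos (pi * a / 2)"
    by (simp add: c_def sin_cos_eq field_simps)
  also have "(\<integral>\<^sup>+u\<in>{0<..}. ennreal (\<bar>2 * u\<bar> * ((u\<^sup>2) powr (c - 1) / (1 + u\<^sup>2))) \<partial>lborel) =
      (\<integral>\<^sup>+u. ennreal 2 * (ennreal (u powr - a / (1 + u\<^sup>2)) * indicator {0<..} u) \<partial>lborel)"
  proof (intro nn_integral_cong)
    fix u :: real
    have "u * (u\<^sup>2) powr (c - 1) = u powr - a" if "u > 0"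
    proof -
      have "u\<^sup>2 = u powr 2" using that by simp
      then have "(u\<^sup>2) powr (c - 1) = u powr (2 * (c - 1))" by (simp only: powr_powr)
      then have "u * (u\<^sup>2) powr (c - 1) = u powr 1 * u powr (2 * (c - 1))" using that by simp
      also have "\<dots> = u powr (1 + 2 * (c - 1))" by (simp only: powr_add)
      also have "1 + 2 * (c - 1) = - a" by (simp add: c_def field_simps)
      finally show ?thesis .
    qed
    then show "ennreal (\<bar>2 * u\<bar> * ((u\<^sup>2) powr (c - 1) / (1 + u\<^sup>2))) * indicator {0<..} u =
      ennreal 2 * (ennreal (u powr - a / (1 + u\<^sup>2)) * indicator {0<..} u)"
      by (auto simp: indicator_def ennreal_mult'[symmetric] abs_mult mult.assoc simp flip: ennreal_numeral)
  qed
  also have "\<dots> = ennreal 2 * (\<integral>\<^sup>+u\<in>{0<..}. ennreal (u powr - a / (1 + u\<^sup>2)) \<partial>lborel)"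
    by (intro nn_integral_cmult) auto
  finally have "(\<integral>\<^sup>+u\<in>{0<..}. ennreal (u powr - a / (1 + u\<^sup>2)) \<partial>lborel) = ennreal (pi / cos (pi * a / 2) / 2)"
    by (rule ennreal_mult_eq_imp_eq_divide[rotated]) auto
  then show ?thesis by (simp add: mult.commute)
qed

lemma nn_integral_one_minus_cos_exp:
  assumes u: "u > 0"
  shows "(\<integral>\<^sup>+y\<in>{0<..}. ennreal ((1 - cos y) * exp (- u * y)) \<partial>lborel) = ennreal (1 / (u * (1 + u\<^sup>2)))"
proof -
  \<comment> \<open>Antiderivatives of \<open>exp (- u * y)\<close> and of
    \<open>- cos y * exp (- u * y)\<close>, normalised to vanish at infinity.\<close>
  define G where "G = (\<lambda>y. - exp (- u * y) / u - exp (- u * y) * (sin y - u * cos y) / (1 + u\<^sup>2))"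
  have pos: "1 + u\<^sup>2 \<noteq> 0" using zero_le_power2[of u] by linarith
  have "(\<integral>\<^sup>+y. ennreal ((1 - cos y) * exp (- u * y)) * indicator {0..} y \<partial>lborel) = ennreal (0 - G 0)"
  proof (rule nn_integral_FTC_atLeast)
    fix y :: real assume "0 \<le> y"
    show "(G has_real_derivative (1 - cos y) * exp (- u * y)) (at y)"
    proof -
      have "(G has_real_derivative (exp (- u * y) -
          (exp (- u * y) * (cos y + u * sin y) - u * exp (- u * y) * (sin y - u * cos y)) / (1 + u\<^sup>2))) (at y)"
        unfolding G_def using u pos by (auto intro!: derivative_eq_intros)
      also have "exp (- u * y) * (cos y + u * sin y) - u * exp (- u * y) * (sin y - u * cos y) =
          cos y * exp (- u * y) * (1 + u\<^sup>2)"
        by (simp add: algebra_simps power2_eq_square)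
      also have "exp (- u * y) - cos y * exp (- u * y) * (1 + u\<^sup>2) / (1 + u\<^sup>2) = (1 - cos y) * exp (- u * y)"
        using pos by (simp add: left_diff_distrib)
      finally show ?thesis .
    qed
  next
    have "((\<lambda>y. exp (- u * y)) \<longlongrightarrow> 0) at_top" using u by real_asymp
    moreover have "((\<lambda>y. exp (- u * y) * (sin y - u * cos y)) \<longlongrightarrow> 0) at_top"
    proof (rule Lim_null_comparison)
      have "\<bar>sin y - u * cos y\<bar> \<le> 1 + u" for y
      proof -
        have "\<bar>u * cos y\<bar> \<le> u * 1" unfolding abs_mult using u by (intro mult_mono) auto
        then show ?thesis using abs_sin_le_one[of y] by linarith
      qed
      then show "\<forall>\<^sub>F y in at_top. norm (exp (- u * y) * (sin y - u * cos y)) \<le> exp (- u * y) * (1 + u)"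
        by (intro always_eventually) (auto simp: abs_mult)
      show "((\<lambda>y. exp (- u * y) * (1 + u)) \<longlongrightarrow> 0) at_top" using u by real_asymp
    qed
    ultimately have "(G \<longlongrightarrow> - 0 / u - 0 / (1 + u\<^sup>2)) at_top"
      unfolding G_def using u pos by (intro tendsto_intros) auto
    then show "(G \<longlongrightarrow> 0) at_top" by simp
  qed auto
  also have "0 - G 0 = 1 / (u * (1 + u\<^sup>2))"
    using u pos by (simp add: G_def field_simps power2_eq_square)
  also have "(\<integral>\<^sup>+y. ennreal ((1 - cos y) * exp (- u * y)) * indicator {0..} y \<partial>lborel) =
     (\<integral>\<^sup>+y. ennreal ((1 - cos y) * exp (- u * y)) * indicator {0<..} y \<partial>lborel)"
    by (intro nn_integral_cong) (auto simp: indicator_def)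
  finally show ?thesis .
qed

text \<open>Again an exchange of integrals: \<open>Gamma (2 - a) * y powr (a - 2)\<close> is the
  integral of \<open>u powr (1 - a) * exp (- u * y)\<close> over \<open>u > 0\<close>, and the inner
  integral over \<open>y\<close> is then elementary.\<close>

lemma nn_integral_one_minus_cos_powr:
  assumes a: "0 < a" "a < 1"
  shows "(\<integral>\<^sup>+y\<in>{0<..}. ennreal ((1 - cos y) * y powr (a - 2)) \<partial>lborel) =
           ennreal (pi / (2 * cos (pi * a / 2) * Gamma (2 - a)))"
proof -
  have G: "Gamma (2 - a) > 0" using a by (intro Gamma_real_pos) auto
  have "(\<integral>\<^sup>+y. ennreal (Gamma (2 - a)) * (ennreal ((1 - cos y) * y powr (a - 2)) * indicator {0<..} y) \<partial>lborel) =
    (\<integral>\<^sup>+y. (\<integral>\<^sup>+u. ennreal ((1 - cos y) * (u powr (1 - a) * exp (- u * y))) * indicator {0<..} u * indicator {0<..} y \<partial>lborel) \<partial>lborel)"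
  proof (intro nn_integral_cong)
    fix y :: real
    show "ennreal (Gamma (2 - a)) * (ennreal ((1 - cos y) * y powr (a - 2)) * indicator {0<..} y) =
       (\<integral>\<^sup>+u. ennreal ((1 - cos y) * (u powr (1 - a) * exp (- u * y))) * indicator {0<..} u * indicator {0<..} y \<partial>lborel)"
    proof (cases "y > 0")
      case True
      have "(\<integral>\<^sup>+u. ennreal ((1 - cos y) * (u powr (1 - a) * exp (- u * y))) * indicator {0<..} u * indicator {0<..} y \<partial>lborel) =
         (\<integral>\<^sup>+u. ennreal (1 - cos y) * (ennreal (u powr ((2 - a) - 1) * exp (- y * u)) * indicator {0<..} u) \<partial>lborel)"
        using True by (intro nn_integral_cong) (auto simp: ennreal_mult'[symmetric] indicator_def algebra_simps)
      also have "\<dots> = ennreal (1 - cos y) * ennreal (Gamma (2 - a) * y powr - (2 - a))"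
        using True nn_integral_Gamma_scaled[of "2 - a" y] a by (subst nn_integral_cmult) auto
      finally show ?thesis using True G by (simp add: ennreal_mult'[symmetric] mult_ac)
    qed simp
  qed
  also have "\<dots> = (\<integral>\<^sup>+u. (\<integral>\<^sup>+y. ennreal ((1 - cos y) * (u powr (1 - a) * exp (- u * y))) * indicator {0<..} u * indicator {0<..} y \<partial>lborel) \<partial>lborel)"
    by (rule lborel_pair.Fubini') measurable
  also have "\<dots> = (\<integral>\<^sup>+u\<in>{0<..}. ennreal (u powr - a / (1 + u\<^sup>2)) \<partial>lborel)"
  proof (intro nn_integral_cong)
    fix u :: real
    show "(\<integral>\<^sup>+y. ennreal ((1 - cos y) * (u powr (1 - a) * exp (- u * y))) * indicator {0<..} u * indicator {0<..} y \<partial>lborel) =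
      ennreal (u powr - a / (1 + u\<^sup>2)) * indicator {0<..} u"
    proof (cases "u > 0")
      case True
      have "(\<integral>\<^sup>+y. ennreal ((1 - cos y) * (u powr (1 - a) * exp (- u * y))) * indicator {0<..} u * indicator {0<..} y \<partial>lborel) =
        (\<integral>\<^sup>+y. ennreal (u powr (1 - a)) * (ennreal ((1 - cos y) * exp (- u * y)) * indicator {0<..} y) \<partial>lborel)"
        using True by (intro nn_integral_cong) (auto simp: ennreal_mult'[symmetric] indicator_def mult_ac)
      also have "\<dots> = ennreal (u powr (1 - a)) * ennreal (1 / (u * (1 + u\<^sup>2)))"
        using nn_integral_one_minus_cos_exp[OF True] by (subst nn_integral_cmult) auto
      also have "\<dots> = ennreal (u powr (1 - a) / u / (1 + u\<^sup>2))"
        using True by (simp add: ennreal_mult'[symmetric])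
      also have "u powr (1 - a) / u = u powr - a"
        using True by (simp add: powr_diff powr_minus divide_inverse)
      finally show ?thesis using True by simp
    qed simp
  qed
  also have "\<dots> = ennreal (pi / (2 * cos (pi * a / 2)))" by (rule nn_integral_powr_over_one_plus_sq[OF a])
  also have "(\<integral>\<^sup>+y. ennreal (Gamma (2 - a)) * (ennreal ((1 - cos y) * y powr (a - 2)) * indicator {0<..} y) \<partial>lborel) =
     ennreal (Gamma (2 - a)) * (\<integral>\<^sup>+y\<in>{0<..}. ennreal ((1 - cos y) * y powr (a - 2)) \<partial>lborel)"
    by (intro nn_integral_cmult) auto
  finally have "(\<integral>\<^sup>+y\<in>{0<..}. ennreal ((1 - cos y) * y powr (a - 2)) \<partial>lborel) =
     ennreal (pi / (2 * cos (pi * a / 2)) / Gamma (2 - a))"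
    by (rule ennreal_mult_eq_imp_eq_divide[rotated]) (rule G)
  then show ?thesis by simp
qed

section \<open>The zeta function: continuation and functional equation\<close>

text \<open>The error of the trapezoidal rule for \<open>x powr -s\<close> on \<open>[m, m + 1]\<close>.\<close>

definition em_term :: "real \<Rightarrow> complex \<Rightarrow> complex" where
  "em_term m s = (of_real (m + 1) powr (1 - s) - of_real m powr (1 - s)) / (1 - s)
      - (of_real m powr - s + of_real (m + 1) powr - s) / 2"

text \<open>Two integrations by parts, packed into the antiderivative \<open>P\<close>. The
  quadratic kernel \<open>(x - m) * (x - m - 1)\<close> vanishes at both ends, so the boundary terms
  leave the integral of \<open>x powr - s\<close> minus its trapezoidal value.\<close>

lemma em_term_has_integral:
  assumes m: "m > 0" and s: "s \<noteq> 1"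
  shows "((\<lambda>x. s * (s + 1) / 2 * of_real ((x - m) * (x - m - 1)) * of_real x powr (- s - 2)) has_integral
            em_term m s) {m..m+1}"
proof -
  define P where "P = (\<lambda>w. w powr (1 - s) / (1 - s) - (w - of_real m - 1/2) * w powr - s
      + (w - of_real m) * (w - of_real m - 1) / 2 * (- s * w powr (- s - 1)))"
  define F where "F = (\<lambda>x::real. s * (s + 1) / 2 * of_real ((x - m) * (x - m - 1)) * of_real x powr (- s - 2))"
  have der: "((\<lambda>x. P (of_real x)) has_vector_derivative F x) (at x within {m..m+1})" if "x \<in> {m..m+1}" for x
  proof (rule has_vector_derivative_real_field)
    define w where "w = complex_of_real x"
    have "w \<notin> \<real>\<^sub>\<le>\<^sub>0" using that m by (auto simp: w_def complex_nonpos_Reals_iff)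
    note powr = has_field_derivative_powr[OF this]
    have d: "((\<lambda>w. w powr (1 - s)) has_field_derivative (1 - s) * w powr - s) (at w)"
         "((\<lambda>w. w powr - s) has_field_derivative - s * w powr (- s - 1)) (at w)"
         "((\<lambda>w. w powr (- s - 1)) has_field_derivative (- s - 1) * w powr (- s - 2)) (at w)"
      using powr[of "1 - s"] powr[of "- s"] powr[of "- s - 1"] by (simp_all add: diff_diff_eq)
    have h: "((\<lambda>w. (w - of_real m) * (w - of_real m - 1) / 2) has_field_derivative (w - of_real m - 1/2)) (at w)"
      by (auto intro!: derivative_eq_intros simp: field_simps)
    have l: "((\<lambda>w. w - of_real m - 1/2) has_field_derivative 1) (at w)"
      by (auto intro!: derivative_eq_intros)
    have "(P has_field_derivative ((1 - s) * w powr - s / (1 - s)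
        - (1 * w powr - s + - s * w powr (- s - 1) * (w - of_real m - 1/2))
        + ((w - of_real m - 1/2) * (- s * w powr (- s - 1)) +
           - s * ((- s - 1) * w powr (- s - 2)) * ((w - of_real m) * (w - of_real m - 1) / 2)))) (at w)"
      unfolding P_def
      by (intro DERIV_add DERIV_diff DERIV_mult DERIV_cdivide DERIV_cmult d h l)
    moreover have "(1 - s) * w powr - s / (1 - s) = w powr - s" using s by simp
    moreover have "w powr - s - (1 * w powr - s + - s * w powr (- s - 1) * (w - of_real m - 1/2))
        + ((w - of_real m - 1/2) * (- s * w powr (- s - 1)) +
           - s * ((- s - 1) * w powr (- s - 2)) * ((w - of_real m) * (w - of_real m - 1) / 2)) = F x"
      unfolding F_def w_def[symmetric] of_real_mult of_real_diff of_real_1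
      by algebra
    ultimately show "(P has_field_derivative F x) (at (of_real x))" by (simp only: w_def)
  qed
  have "(F has_integral (P (of_real (m + 1)) - P (of_real m))) {m..m+1}"
    by (intro fundamental_theorem_of_calculus der) auto
  moreover have "P (of_real (m + 1)) - P (of_real m) = em_term m s"
    by (simp add: P_def em_term_def diff_divide_distrib add_divide_distrib)
  ultimately show ?thesis by (simp add: F_def)
qed

lemma trapezoid_kernel_bound:
  assumes "x \<in> {m..m+1}"
  shows "\<bar>(x - m) * (x - m - 1)\<bar> \<le> 1 / (4::real)"
proof -
  have "0 \<le> (x - m - 1/2)\<^sup>2" by simp
  moreover have "(x - m) * (x - m - 1) = (x - m - 1/2)\<^sup>2 - 1/4"
    by (simp add: power2_eq_square algebra_simps)
  moreover have "(x - m) * (x - m - 1) \<le> 0" using assms by (intro mult_nonneg_nonpos) auto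
  ultimately show ?thesis by linarith
qed

lemma em_term_bound:
  assumes m: "m > 0" and s: "s \<noteq> 1" "Re s \<ge> -2"
  shows "norm (em_term m s) \<le> norm s * norm (s + 1) / 8 * m powr (- Re s - 2)"
proof -
  have "norm (em_term m s) \<le> (norm s * norm (s + 1) / 8 * m powr (- Re s - 2)) * measure lborel (cbox m (m + 1))"
  proof (rule has_integral_bound)
    show "((\<lambda>x. s * (s + 1) / 2 * of_real ((x - m) * (x - m - 1)) * of_real x powr (- s - 2)) has_integral
            em_term m s) (cbox m (m + 1))"
      using em_term_has_integral[OF m s(1)] by simp
    fix x assume "x \<in> cbox m (m + 1)"
    then have x: "x \<in> {m..m+1}" by simp
    have "norm (of_real x powr (- s - 2) :: complex) = x powr (- Re s - 2)"
      using x m norm_powr_real_powr[of "of_real x" "- s - 2"] by simp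
    then have "norm (s * (s + 1) / 2 * of_real ((x - m) * (x - m - 1)) * of_real x powr (- s - 2)) =
       norm s * norm (s + 1) / 2 * (\<bar>(x - m) * (x - m - 1)\<bar> * x powr (- Re s - 2))"
      by (simp only: norm_mult norm_divide norm_of_real) (simp add: abs_mult)
    also have "\<dots> \<le> norm s * norm (s + 1) / 2 * (1 / 4 * m powr (- Re s - 2))"
      using x m s trapezoid_kernel_bound[OF x] by (intro mult_left_mono mult_mono powr_mono2') auto
    finally show "norm (s * (s + 1) / 2 * of_real ((x - m) * (x - m - 1)) * of_real x powr (- s - 2)) \<le>
       norm s * norm (s + 1) / 8 * m powr (- Re s - 2)" by simp
  qed auto
  then show ?thesis by simp
qed

text \<open>The Euler-Maclaurin formula of second order. The errors are O(n powr (- Re s - 2)), so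
  the series converges for \<open>Re s > -1\<close>, far enough to the left to overlap with the
  half-plane \<open>Re s < 0\<close> of the reflected series.\<close>

definition zeta_ext :: "complex \<Rightarrow> complex" where
  "zeta_ext s = 1 / (s - 1) + 1 / 2 - (\<Sum>n. em_term (real (Suc n)) s)"

lemma em_term_norm_le:
  assumes "s \<noteq> 1" "Re s \<ge> \<sigma>" "\<sigma> > -1"
  shows "norm (em_term (real (Suc n)) s) \<le> norm s * norm (s + 1) / 8 * real (Suc n) powr - (\<sigma> + 2)"
proof -
  have "norm (em_term (real (Suc n)) s) \<le> norm s * norm (s + 1) / 8 * real (Suc n) powr (- Re s - 2)"
    using assms by (intro em_term_bound) auto
  also have "\<dots> \<le> norm s * norm (s + 1) / 8 * real (Suc n) powr - (\<sigma> + 2)"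
    using assms by (intro mult_left_mono powr_mono) auto
  finally show ?thesis .
qed

lemma summable_em_term:
  assumes "s \<noteq> 1" "Re s > -1"
  shows "summable (\<lambda>n. em_term (real (Suc n)) s)"
proof (rule summable_comparison_test)
  show "summable (\<lambda>n. norm s * norm (s + 1) / 8 * real (Suc n) powr - (Re s + 2))"
    using assms by (intro summable_mult summable_Suc_powr) auto
qed (use em_term_norm_le[of s "Re s"] assms in blast)

lemma suminf_em_term_bound:
  assumes "\<sigma> > -1"
  obtains C where "C \<ge> 0" "\<And>s. s \<noteq> 1 \<Longrightarrow> Re s \<ge> \<sigma> \<Longrightarrow> norm (\<Sum>n. em_term (real (Suc n)) s) \<le> C * (norm s * norm (s + 1))"
proof -
  define C where "C = (\<Sum>n. real (Suc n) powr - (\<sigma> + 2)) / 8"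
  have sm: "summable (\<lambda>n. real (Suc n) powr - (\<sigma> + 2))"
    using assms by (intro summable_Suc_powr) auto
  have "norm (\<Sum>n. em_term (real (Suc n)) s) \<le> C * (norm s * norm (s + 1))" if "s \<noteq> 1" "Re s \<ge> \<sigma>" for s
  proof -
    have "norm (\<Sum>n. em_term (real (Suc n)) s) \<le> (\<Sum>n. norm s * norm (s + 1) / 8 * real (Suc n) powr - (\<sigma> + 2))"
      by (intro norm_suminf_le summable_mult sm em_term_norm_le that assms)
    also have "\<dots> = C * (norm s * norm (s + 1))"
      using sm by (subst suminf_mult) (auto simp: C_def)
    finally show ?thesis .
  qed
  moreover have "C \<ge> 0" unfolding C_def using sm by (intro divide_nonneg_pos suminf_nonneg) auto
  ultimately show ?thesis using that by blast
qed

lemma em_term_holomorphic: "m > 0 \<Longrightarrow> em_term m holomorphic_on - {1}"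
  unfolding em_term_def[abs_def] by (intro holomorphic_intros) auto

lemma zeta_ext_holomorphic: "zeta_ext holomorphic_on {s. Re s > -1} - {1}"
proof -
  define S where "S = {s. Re s > -1} - {1 :: complex}"
  have S: "open S" unfolding S_def by (intro open_Diff open_halfspace_Re_gt) auto
  obtain E where E: "\<forall>x \<in> S. ((\<lambda>n. em_term (real (Suc n)) x) sums E x) \<and> E field_differentiable (at x)"
  proof (rule series_differentiable_comparison_complex[OF S])
    fix n and x :: complex assume "x \<in> S"
    then have "x \<in> - {1}" by (auto simp: S_def)
    then show "em_term (real (Suc n)) field_differentiable (at x)"
      using em_term_holomorphic[of "real (Suc n)"] open_Compl[of "{1::complex}"]
      by (intro holomorphic_on_imp_differentiable_at[where s = "- {1}"]) auto
  next
    fix x assume x: "x \<in> S"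
    \<comment> \<open>Half the distance to the line \<open>Re s = -1\<close>, so that the exponent
      \<open>Re x - d + 2\<close> of the majorant stays above 1.\<close>
    define d where "d = (Re x + 1) / 2"
    have d: "d > 0" using x by (simp add: d_def S_def)
    define h where "h = (\<lambda>n. of_real ((norm x + d) * (norm x + d + 1) / 8 * real (Suc n) powr - (Re x - d + 2)) :: complex)"
    have "summable h" unfolding h_def
      by (subst summable_of_real_iff, intro summable_mult summable_Suc_powr) (use x in \<open>simp add: d_def S_def field_simps\<close>)
    moreover have "norm (em_term (real (Suc n)) y) \<le> norm (h n)" if y: "y \<in> ball x d \<inter> S" for n y
    proof -
      have dist: "norm (y - x) < d" using y by (simp add: dist_norm norm_minus_commute)
      then have "Re x - d \<le> Re y" using abs_Re_le_cmod[of "y - x"] by auto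
      moreover have "Re x - d > -1" using x by (simp add: d_def S_def field_simps)
      ultimately have "norm (em_term (real (Suc n)) y) \<le> norm y * norm (y + 1) / 8 * real (Suc n) powr - (Re x - d + 2)"
        using y by (intro em_term_norm_le) (auto simp: S_def)
      also have "\<dots> \<le> (norm x + d) * (norm x + d + 1) / 8 * real (Suc n) powr - (Re x - d + 2)"
      proof -
        have "norm y \<le> norm x + d" using dist norm_triangle_sub[of y x] by linarith
        moreover have "norm (y + 1) \<le> norm x + d + 1" using calculation norm_triangle_ineq[of y 1] by simp
        ultimately show ?thesis using d by (intro mult_right_mono divide_right_mono mult_mono) auto
      qed
      finally show ?thesis using d unfolding h_def by (simp only: norm_of_real)
    qed
    moreover have "range h \<subseteq> \<real>\<^sub>\<ge>\<^sub>0" using d by (auto simp: h_def)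
    ultimately show "\<exists>d h. 0 < d \<and> summable h \<and> range h \<subseteq> \<real>\<^sub>\<ge>\<^sub>0 \<and>
       (\<forall>\<^sub>F n in sequentially. \<forall>y\<in>ball x d \<inter> S. norm (em_term (real (Suc n)) y) \<le> norm ((h :: nat \<Rightarrow> complex) n))"
      using d by (intro exI[of _ d] exI[of _ h] conjI always_eventually) auto
  qed blast
  have "(\<lambda>s. 1 / (s - 1) + 1 / 2 - E s) holomorphic_on S"
    using E by (intro holomorphic_intros) (auto simp: S_def holomorphic_on_def intro: field_differentiable_at_within)
  then show ?thesis
    unfolding S_def[symmetric]
    by (rule holomorphic_transform) (use E in \<open>auto simp: zeta_ext_def sums_iff\<close>)
qed

text \<open>For \<open>Re s > 1\<close> the two parts of \<open>em_term\<close> converge separately: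
  the power differences telescope, and the trapezoids sum to \<open>zeta_series s\<close> minus half
  of its first term.\<close>

lemma zeta_ext_eq_series:
  assumes s: "Re s > 1"
  shows "zeta_ext s = zeta_series s"
proof -
  define z where "z = (\<lambda>n. of_nat (Suc n) powr - s :: complex)"
  have s1: "s \<noteq> 1" using s by auto
  have "summable (\<lambda>n. norm (1 / of_nat (Suc n) powr s :: complex))"
    using s by (intro dirichlet_summable[of "\<lambda>_. 1"]) auto
  from summable_sums[OF summable_norm_cancel[OF this]] have zs: "z sums zeta_series s"
    unfolding dirichlet_def z_def powr_minus divide_inverse mult_1 .
  have z1: "(\<lambda>n. z (Suc n)) sums (zeta_series s - 1)"
    using zs sums_Suc_iff[of z "zeta_series s - 1"] by (simp add: z_def)
  define f where "f = (\<lambda>n. of_nat (Suc n) powr (1 - s) / (1 - s) :: complex)"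
  have "f \<longlonglongrightarrow> 0"
  proof (rule Lim_null_comparison)
    show "\<forall>\<^sub>F n in sequentially. norm (f n) \<le> real (Suc n) powr (1 - Re s) / norm (1 - s)"
      by (intro always_eventually) (auto simp: f_def norm_divide norm_of_nat_powr simp del: of_nat_Suc)
    define e where "e = Re s - 1"
    have "e > 0" using s by (simp add: e_def)
    then have "(\<lambda>n. real (Suc n) powr - e) \<longlonglongrightarrow> 0" by real_asymp
    then have "(\<lambda>n. real (Suc n) powr (1 - Re s)) \<longlonglongrightarrow> 0" by (simp add: e_def)
    then show "(\<lambda>n. real (Suc n) powr (1 - Re s) / norm (1 - s)) \<longlonglongrightarrow> 0"
      by (rule tendsto_divide_zero)
  qed
  then have "(\<lambda>n. f (Suc n) - f n) sums (0 - f 0)" by (rule telescope_sums)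
  then have "(\<lambda>n. (f (Suc n) - f n) - (z n + z (Suc n)) / 2) sums ((0 - f 0) - (zeta_series s + (zeta_series s - 1)) / 2)"
    using zs z1 by (rule sums_diff[OF _ sums_divide[OF sums_add]])
  moreover have "(f (Suc n) - f n) - (z n + z (Suc n)) / 2 = em_term (real (Suc n)) s" for n
    by (simp add: f_def z_def em_term_def diff_divide_distrib add_ac)
  ultimately have "(\<Sum>n. em_term (real (Suc n)) s) = (0 - f 0) - (zeta_series s + (zeta_series s - 1)) / 2"
    by (simp add: sums_iff)
  then show ?thesis using s1 by (simp add: zeta_ext_def f_def field_simps)
qed

text \<open>The error series stays bounded near 1, so after multiplication by \<open>s - 1\<close>
  only the explicit fraction survives in the limit.\<close>

lemma zeta_ext_pole: "((\<lambda>s. (s - 1) * zeta_ext s) \<longlongrightarrow> 1) (at 1)"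
proof -
  obtain C where C: "C \<ge> 0" "\<And>s. s \<noteq> 1 \<Longrightarrow> Re s \<ge> 0 \<Longrightarrow> norm (\<Sum>n. em_term (real (Suc n)) s) \<le> C * (norm s * norm (s + 1))"
    by (rule suminf_em_term_bound[of 0]) auto
  have "((\<lambda>s. (s - 1) * (\<Sum>n. em_term (real (Suc n)) s)) \<longlongrightarrow> 0) (at 1)"
  proof (rule Lim_null_comparison)
    have "eventually (\<lambda>s::complex. Re s > 0) (at 1)"
      using eventually_nhds_in_open[OF open_halfspace_Re_gt[of 0], of "1::complex"]
      by (simp add: eventually_nhds_conv_at)
    then show "\<forall>\<^sub>F s in at 1. norm ((s - 1) * (\<Sum>n. em_term (real (Suc n)) s)) \<le> norm (s - 1) * (C * (norm s * norm (s + 1)))"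
      using eventually_neq_at_within[of "1::complex" 1 UNIV]
      by eventually_elim (auto simp: norm_mult simp del: of_nat_Suc intro!: mult_left_mono C)
    have "((\<lambda>s::complex. norm (s - 1) * (C * (norm s * norm (s + 1)))) \<longlongrightarrow> norm (1 - 1 :: complex) * (C * (norm (1::complex) * norm (1 + 1 :: complex)))) (at 1)"
      by (intro tendsto_intros)
    then show "((\<lambda>s. norm (s - 1) * (C * (norm s * norm (s + 1 :: complex)))) \<longlongrightarrow> 0) (at 1)" by simp
  qed
  then have "((\<lambda>s. 1 + (s - 1) / 2 - (s - 1) * (\<Sum>n. em_term (real (Suc n)) s)) \<longlongrightarrow> 1 + (1 - 1) / 2 - 0) (at 1)"
    by (intro tendsto_intros) auto
  then have "((\<lambda>s. 1 + (s - 1) / 2 - (s - 1) * (\<Sum>n. em_term (real (Suc n)) s)) \<longlongrightarrow> 1) (at 1)" by simp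
  then show ?thesis
    by (rule Lim_transform_eventually)
       (auto simp: eventually_at_filter zeta_ext_def algebra_simps add_divide_distrib diff_divide_distrib
          intro!: always_eventually)
qed

section \<open>Values of zeta on the real interval (-1, 0)\<close>

lemma borel_measurable_frac [measurable]: "(frac :: real \<Rightarrow> real) \<in> borel_measurable borel"
  unfolding frac_def[abs_def] by measurable

lemma pos_notin_nonpos_Ints: "Re s > 0 \<Longrightarrow> s \<notin> \<int>\<^sub>\<le>\<^sub>0"
  by (auto elim!: nonpos_Ints_cases)

lemma nn_integral_pos_eq_suminf:
  fixes f :: "real \<Rightarrow> ennreal"
  assumes [measurable]: "f \<in> borel_measurable borel"
  shows "(\<integral>\<^sup>+x\<in>{0<..}. f x \<partial>lborel) = (\<Sum>m. \<integral>\<^sup>+x\<in>{real m<..real m + 1}. f x \<partial>lborel)"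
proof -
  have "(\<integral>\<^sup>+x\<in>{0<..}. f x \<partial>lborel) = (\<integral>\<^sup>+x. (\<Sum>m. f x * indicator {real m<..real m + 1} x) \<partial>lborel)"
  proof (intro nn_integral_cong)
    fix x :: real
    show "f x * indicator {0<..} x = (\<Sum>m. f x * indicator {real m<..real m + 1} x)"
    proof (cases "x > 0")
      case True
      have "disjoint_family (\<lambda>m. {real m<..real m + 1})"
        unfolding disjoint_family_on_def
      proof (intro ballI impI)
        fix m n :: nat assume "m \<noteq> n"
        then consider "real (m + 1) \<le> real n" | "real (n + 1) \<le> real m"
          unfolding of_nat_le_iff by linarith
        then show "{real m<..real m + 1} \<inter> {real n<..real n + 1} = {}"
          by cases auto
      qed
      moreover have "x \<in> {real (nat (\<lceil>x\<rceil> - 1))<..real (nat (\<lceil>x\<rceil> - 1)) + 1}"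
      proof -
        have "\<lceil>x\<rceil> \<ge> 1" using True by linarith
        then have "real (nat (\<lceil>x\<rceil> - 1)) = of_int \<lceil>x\<rceil> - 1" by simp
        then show ?thesis using ceiling_correct[of x] by auto
      qed
      ultimately have "(\<Sum>m. f x * indicator {real m<..real m + 1} x) = f x"
        by (rule suminf_cmult_indicator)
      then show ?thesis using True by simp
    next
      case False
      then have "indicator {real m<..real m + 1} x = (0 :: ennreal)" for m
        by (auto simp: indicator_def)
      then show ?thesis using False by simp
    qed
  qed
  also have "\<dots> = (\<Sum>m. \<integral>\<^sup>+x\<in>{real m<..real m + 1}. f x \<partial>lborel)"
    by (rule nn_integral_suminf) measurable
  finally show ?thesis .
qed

context
  fixes a :: real
  assumes a: "0 < a" "a < 1"
begin

text \<open>At \<open>s = - a\<close> the sign of \<open>s * (s + 1)\<close> cancels that of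
  \<open>x - m - 1\<close>, so the trapezoidal error is the integral of a nonnegative real
  function.\<close>

lemma em_term_real_has_integral:
  assumes m: "m > 0"
  shows "((\<lambda>x. a * (1 - a) / 2 * ((x - m) * (m + 1 - x) * x powr (a - 2))) has_integral Re (em_term m (of_real (- a)))) {m..m+1}"
    and "Im (em_term m (of_real (- a))) = 0"
proof -
  let ?f = "\<lambda>x. complex_of_real (- a) * (of_real (- a) + 1) / 2 * of_real ((x - m) * (x - m - 1)) *
              of_real x powr (- of_real (- a) - 2)"
  have "complex_of_real (- a) \<noteq> 1" using a by (simp add: complex_eq_iff)
  then have I: "(?f has_integral em_term m (of_real (- a))) {m..m+1}"
    using em_term_has_integral[OF m] by blast
  have f: "?f x = of_real (a * (1 - a) / 2 * ((x - m) * (m + 1 - x) * x powr (a - 2)))" if "x \<in> {m..m+1}" for x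
  proof -
    have "complex_of_real x powr (- of_real (- a) - 2) = of_real (x powr (a - 2))"
      using that m powr_of_real[of x "a - 2"] by simp
    then have "?f x = of_real ((- a) * (- a + 1) / 2 * ((x - m) * (x - m - 1)) * x powr (a - 2))" by simp
    also have "(- a) * (- a + 1) / 2 * ((x - m) * (x - m - 1)) * x powr (a - 2) =
        a * (1 - a) / 2 * ((x - m) * (m + 1 - x) * x powr (a - 2))"
    proof -
      have e: "x - m - 1 = - (m + 1 - x)" "- a + 1 = 1 - a" by simp_all
      show ?thesis
        by (simp only: e minus_divide_left[symmetric] mult_minus_left mult_minus_right minus_minus mult.assoc)
    qed
    finally show ?thesis .
  qed
  have "((\<lambda>x. Re (?f x)) has_integral Re (em_term m (of_real (- a)))) {m..m+1}"
    using has_integral_linear[OF I bounded_linear_Re] by (simp add: o_def)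
  then show "((\<lambda>x. a * (1 - a) / 2 * ((x - m) * (m + 1 - x) * x powr (a - 2))) has_integral Re (em_term m (of_real (- a)))) {m..m+1}"
    by (rule has_integral_eq[rotated]) (simp only: f Re_complex_of_real)
  have "((\<lambda>x. Im (?f x)) has_integral Im (em_term m (of_real (- a)))) {m..m+1}"
    using has_integral_linear[OF I bounded_linear_Im] by (simp add: o_def)
  then have "((\<lambda>x. 0) has_integral Im (em_term m (of_real (- a)))) {m..m+1}"
    by (rule has_integral_eq[rotated]) (simp only: f Im_complex_of_real)
  then show "Im (em_term m (of_real (- a))) = 0" by (metis has_integral_0 has_integral_unique)
qed

text \<open>The part over \<open>[m, m + 1]\<close> of the integral of
  \<open>a * (1 - a) / 2 * (frac x * (1 - frac x) * x powr (a - 2))\<close>. The first interval is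
  separate since \<open>em_term\<close> is integrated only for \<open>m > 0\<close>; its value is
  minus the explicit part \<open>1 / (s - 1) + 1 / 2\<close> of \<open>zeta_ext\<close> at
  \<open>s = - a\<close>, so that the pieces together give \<open>- zeta_ext (- a)\<close>.\<close>

definition B_piece :: "nat \<Rightarrow> real" where
  "B_piece m = (if m = 0 then (1 - a) / (2 * (1 + a)) else Re (em_term (real m) (of_real (- a))))"

lemma B_piece_has_integral:
  "((\<lambda>x. a * (1 - a) / 2 * ((x - real m) * (real m + 1 - x) * x powr (a - 2))) has_integral B_piece m) {real m..real m+1}"
proof (cases "m = 0")
  case True
  have "((\<lambda>x. x powr (a - 1) - x powr a) has_integral ((1 powr a / a - 1 powr (a + 1) / (a + 1)) - (0 powr a / a - 0 powr (a + 1) / (a + 1)))) {0..1}"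
  \<comment> \<open>\<open>x powr (a - 1)\<close> is unbounded at 0, hence the version that
    differentiates only in the interior.\<close>
  proof (rule fundamental_theorem_of_calculus_interior)
    show "continuous_on {0..1} (\<lambda>x. x powr a / a - x powr (a + 1) / (a + 1))"
      using a by (intro continuous_on_diff continuous_on_divide continuous_on_powr' continuous_intros) auto
    fix x :: real assume "x \<in> {0<..<1}"
    then show "((\<lambda>x. x powr a / a - x powr (a + 1) / (a + 1)) has_vector_derivative x powr (a - 1) - x powr a) (at x)"
      using a unfolding has_real_derivative_iff_has_vector_derivative[symmetric]
      by (auto intro!: derivative_eq_intros)
  qed auto
  then have "((\<lambda>x. a * (1 - a) / 2 * (x powr (a - 1) - x powr a)) has_integral a * (1 - a) / 2 *
      ((1 powr a / a - 1 powr (a + 1) / (a + 1)) - (0 powr a / a - 0 powr (a + 1) / (a + 1)))) {0..1}"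
    by (rule has_integral_mult_right)
  moreover have "a * (1 - a) / 2 * ((1 powr a / a - 1 powr (a + 1) / (a + 1)) - (0 powr a / a - 0 powr (a + 1) / (a + 1))) =
      (1 - a) / (2 * (1 + a))"
  proof -
    have "1 / a - 1 / (a + 1) = 1 / (a * (1 + a))" using a by (simp add: field_simps)
    then show ?thesis using a by simp
  qed
  moreover have "x powr (a - 1) - x powr a = x * (1 - x) * x powr (a - 2)" if "x \<in> {0..1}" for x
  proof (cases "x = 0")
    case False
    then have "x > 0" using that by auto
    then have "x powr (a - 1) = x powr 1 * x powr (a - 2)" "x powr a = x powr 2 * x powr (a - 2)"
      by (simp_all only: powr_add[symmetric]) simp_all
    then show ?thesis using \<open>x > 0\<close> by (simp add: algebra_simps power2_eq_square)
  qed auto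
  ultimately have "((\<lambda>x. a * (1 - a) / 2 * (x * (1 - x) * x powr (a - 2))) has_integral (1 - a) / (2 * (1 + a))) {0..1}"
    by (metis (no_types, lifting) has_integral_cong)
  then show ?thesis unfolding True by (simp add: B_piece_def)
next
  case False
  then show ?thesis using em_term_real_has_integral(1)[of "real m"] by (simp add: B_piece_def)
qed

lemma B_piece_nonneg: "B_piece m \<ge> 0"
  using a by (intro has_integral_nonneg[OF B_piece_has_integral[of m]]) auto

lemma nn_integral_frac_piece:
  "(\<integral>\<^sup>+x\<in>{real m<..real m + 1}. ennreal (a * (1 - a) / 2 * (frac x * (1 - frac x) * x powr (a - 2))) \<partial>lborel) = ennreal (B_piece m)"
proof -
  have "(\<integral>\<^sup>+x. ennreal (a * (1 - a) / 2 * ((x - real m) * (real m + 1 - x) * x powr (a - 2))) * indicator {real m..real m + 1} x \<partial>lborel) =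
     ennreal (B_piece m)"
    using a by (intro nn_integral_has_integral_lebesgue' B_piece_has_integral) auto
  also have "(\<integral>\<^sup>+x. ennreal (a * (1 - a) / 2 * ((x - real m) * (real m + 1 - x) * x powr (a - 2))) * indicator {real m..real m + 1} x \<partial>lborel) =
     (\<integral>\<^sup>+x\<in>{real m<..real m + 1}. ennreal (a * (1 - a) / 2 * (frac x * (1 - frac x) * x powr (a - 2))) \<partial>lborel)"
  proof (intro nn_integral_cong)
    fix x :: real
    have "frac x * (1 - frac x) = (x - real m) * (real m + 1 - x)" if "real m < x" "x \<le> real m + 1"
    proof (cases "x = real m + 1")
      case False
      then have "frac x = x - real m" using that by (intro frac_unique_iff[THEN iffD2]) auto
      then show ?thesis by simp
    qed (simp add: frac_eq_0_iff)
    then show "ennreal (a * (1 - a) / 2 * ((x - real m) * (real m + 1 - x) * x powr (a - 2))) * indicator {real m..real m + 1} x =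
      ennreal (a * (1 - a) / 2 * (frac x * (1 - frac x) * x powr (a - 2))) * indicator {real m<..real m + 1} x"
      by (cases "x = real m") (auto simp: indicator_def)
  qed
  finally show ?thesis .
qed

lemma B_piece_sums: "B_piece sums (- Re (zeta_ext (of_real (- a))))"
proof -
  have s: "complex_of_real (- a) \<noteq> 1" using a by (simp add: complex_eq_iff)
  have "(\<lambda>n. Re (em_term (real (Suc n)) (of_real (- a)))) sums Re (\<Sum>n. em_term (real (Suc n)) (of_real (- a)))"
    using a s by (intro sums_Re summable_sums summable_em_term) auto
  then have "(\<lambda>n. B_piece (Suc n)) sums Re (\<Sum>n. em_term (real (Suc n)) (of_real (- a)))"
    by (simp add: B_piece_def del: of_nat_Suc)
  then have "B_piece sums (Re (\<Sum>n. em_term (real (Suc n)) (of_real (- a))) + B_piece 0)"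
    by (rule sums_Suc)
  moreover have "Re (\<Sum>n. em_term (real (Suc n)) (of_real (- a))) + B_piece 0 = - Re (zeta_ext (of_real (- a)))"
  proof -
    have "1 / (complex_of_real (- a) - 1) + 1 / 2 = of_real (- B_piece 0)"
    proof -
      have "1 / (complex_of_real (- a) - 1) + 1 / 2 = of_real (1 / (- a - 1) + 1 / 2)" by simp
      also have "1 / (- a - 1) + 1 / 2 = - B_piece 0"
        using a by (simp add: B_piece_def field_simps)
      finally show ?thesis .
    qed
    then show ?thesis unfolding zeta_ext_def by simp
  qed
  ultimately show ?thesis by simp
qed

lemma Im_zeta_ext_real: "Im (zeta_ext (of_real (- a))) = 0"
proof -
  have s: "complex_of_real (- a) \<noteq> 1" using a by (simp add: complex_eq_iff)
  have "(\<lambda>n. Im (em_term (real (Suc n)) (of_real (- a)))) sums Im (\<Sum>n. em_term (real (Suc n)) (of_real (- a)))"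
    using a s by (intro sums_Im summable_sums summable_em_term) auto
  then have "Im (\<Sum>n. em_term (real (Suc n)) (of_real (- a))) = 0"
    using em_term_real_has_integral(2)[of "real (Suc n)" for n] by (simp add: sums_iff del: of_nat_Suc)
  moreover have "1 / (complex_of_real (- a) - 1) + 1 / 2 = of_real (1 / (- a - 1) + 1 / 2)" by simp
  ultimately show ?thesis unfolding zeta_ext_def by simp
qed

lemma nn_integral_frac_powr_zeta_ext:
  "(\<integral>\<^sup>+x\<in>{0<..}. ennreal (a * (1 - a) / 2 * (frac x * (1 - frac x) * x powr (a - 2))) \<partial>lborel) =
     ennreal (- Re (zeta_ext (of_real (- a))))"
  by (subst nn_integral_pos_eq_suminf, measurable)
     (simp only: nn_integral_frac_piece suminf_ennreal_eq[OF B_piece_nonneg B_piece_sums])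

lemma nn_integral_one_minus_cos_scaled:
  assumes k: "k > 0"
  shows "(\<integral>\<^sup>+x\<in>{0<..}. ennreal ((1 - cos (k * x)) * x powr (a - 2)) \<partial>lborel) =
     ennreal (k powr (1 - a) * (pi / (2 * cos (pi * a / 2) * Gamma (2 - a))))"
proof -
  have "ennreal (pi / (2 * cos (pi * a / 2) * Gamma (2 - a))) =
      ennreal \<bar>k\<bar> * (\<integral>\<^sup>+x. ennreal ((1 - cos (0 + k * x)) * (0 + k * x) powr (a - 2)) * indicator {0<..} (0 + k * x) \<partial>lborel)"
    using k nn_integral_one_minus_cos_powr[OF a] 
    by (subst nn_integral_real_affine[where c = k and t = 0, symmetric]) auto
  also have "(\<integral>\<^sup>+x. ennreal ((1 - cos (0 + k * x)) * (0 + k * x) powr (a - 2)) * indicator {0<..} (0 + k * x) \<partial>lborel) =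
      (\<integral>\<^sup>+x. ennreal (k powr (a - 2)) * (ennreal ((1 - cos (k * x)) * x powr (a - 2)) * indicator {0<..} x) \<partial>lborel)"
    using k by (intro nn_integral_cong) (auto simp: indicator_def powr_mult ennreal_mult'[symmetric] zero_less_mult_iff mult_ac)
  also have "\<dots> = ennreal (k powr (a - 2)) * (\<integral>\<^sup>+x\<in>{0<..}. ennreal ((1 - cos (k * x)) * x powr (a - 2)) \<partial>lborel)"
    by (intro nn_integral_cmult) auto
  finally have "ennreal (k powr (1 - a)) * ennreal (pi / (2 * cos (pi * a / 2) * Gamma (2 - a))) =
     ennreal (k powr (1 - a) * (k powr 1 * k powr (a - 2))) * (\<integral>\<^sup>+x\<in>{0<..}. ennreal ((1 - cos (k * x)) * x powr (a - 2)) \<partial>lborel)"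
    using k by (simp add: ennreal_mult' mult.assoc)
  also have "k powr (1 - a) * (k powr 1 * k powr (a - 2)) = 1"
    using k by (simp only: powr_add[symmetric]) simp
  finally show ?thesis by (simp add: ennreal_mult'[symmetric])
qed

text \<open>Each Fourier term is a scaled copy of one cosine integral. Scaling by
  \<open>2 * pi * n\<close> contributes \<open>n powr (1 - a)\<close>, and with the coefficient
  \<open>1 / n\<^sup>2\<close> this leaves \<open>n powr - (1 + a)\<close>, the series of zeta at
  \<open>1 + a\<close>.\<close>

lemma nn_integral_frac_powr_fourier:
  "(\<integral>\<^sup>+x\<in>{0<..}. ennreal (frac x * (1 - frac x) * x powr (a - 2)) \<partial>lborel) =
     ennreal (pi / (2 * cos (pi * a / 2) * Gamma (2 - a)) * ((2 * pi) powr (1 - a) / pi\<^sup>2) * (\<Sum>n. real (Suc n) powr - (1 + a)))"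
proof -
  define J where "J = pi / (2 * cos (pi * a / 2) * Gamma (2 - a))"
  have "cos (pi * a / 2) > 0" using a by (intro cos_gt_zero) auto
  then have J: "J \<ge> 0" unfolding J_def using a by (intro divide_nonneg_pos mult_pos_pos Gamma_real_pos) auto
  have "(\<integral>\<^sup>+x\<in>{0<..}. ennreal (frac x * (1 - frac x) * x powr (a - 2)) \<partial>lborel) =
     (\<integral>\<^sup>+x. (\<Sum>n. ennreal ((1 - cos (2 * pi * real (Suc n) * x)) / (pi * real (Suc n))\<^sup>2 * x powr (a - 2)) * indicator {0<..} x) \<partial>lborel)"
  proof (intro nn_integral_cong)
    fix x :: real
    have "(\<Sum>n. ennreal ((1 - cos (2 * pi * real (Suc n) * x)) / (pi * real (Suc n))\<^sup>2 * x powr (a - 2))) =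
       ennreal (frac x * (1 - frac x) * x powr (a - 2))"
      by (intro suminf_ennreal_eq sums_mult2 sums_frac_fourier) auto
    then show "ennreal (frac x * (1 - frac x) * x powr (a - 2)) * indicator {0<..} x =
      (\<Sum>n. ennreal ((1 - cos (2 * pi * real (Suc n) * x)) / (pi * real (Suc n))\<^sup>2 * x powr (a - 2)) * indicator {0<..} x)"
      by (simp add: indicator_def)
  qed
  also have "\<dots> = (\<Sum>n. \<integral>\<^sup>+x\<in>{0<..}. ennreal ((1 - cos (2 * pi * real (Suc n) * x)) / (pi * real (Suc n))\<^sup>2 * x powr (a - 2)) \<partial>lborel)"
    by (rule nn_integral_suminf) measurable
  also have "\<dots> = (\<Sum>n. ennreal (J * ((2 * pi) powr (1 - a) / pi\<^sup>2) * real (Suc n) powr - (1 + a)))"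
  proof (intro suminf_cong)
    fix n
    define N where "N = real (Suc n)"
    have N: "N > 0" by (simp add: N_def)
    have "(\<integral>\<^sup>+x\<in>{0<..}. ennreal ((1 - cos (2 * pi * N * x)) / (pi * N)\<^sup>2 * x powr (a - 2)) \<partial>lborel) =
      (\<integral>\<^sup>+x. ennreal (1 / (pi * N)\<^sup>2) * (ennreal ((1 - cos (2 * pi * N * x)) * x powr (a - 2)) * indicator {0<..} x) \<partial>lborel)"
      by (intro nn_integral_cong) (auto simp: indicator_def ennreal_mult'[symmetric])
    also have "\<dots> = ennreal (1 / (pi * N)\<^sup>2) * ennreal ((2 * pi * N) powr (1 - a) * J)"
      using N nn_integral_one_minus_cos_scaled[of "2 * pi * N"] by (subst nn_integral_cmult) (auto simp: J_def)
    also have "\<dots> = ennreal (1 / (pi * N)\<^sup>2 * ((2 * pi * N) powr (1 - a) * J))"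
      by (simp add: ennreal_mult'[symmetric])
    also have "1 / (pi * N)\<^sup>2 * ((2 * pi * N) powr (1 - a) * J) = J * ((2 * pi) powr (1 - a) / pi\<^sup>2) * N powr - (1 + a)"
    proof -
      have "N powr (1 - a) = N powr 2 * N powr - (1 + a)" by (simp add: powr_add[symmetric])
      then show ?thesis using N by (simp add: powr_mult power_mult_distrib field_simps)
    qed
    finally show "(\<integral>\<^sup>+x\<in>{0<..}. ennreal ((1 - cos (2 * pi * real (Suc n) * x)) / (pi * real (Suc n))\<^sup>2 * x powr (a - 2)) \<partial>lborel) =
      ennreal (J * ((2 * pi) powr (1 - a) / pi\<^sup>2) * real (Suc n) powr - (1 + a))" unfolding N_def .
  qed
  also have "\<dots> = ennreal (J * ((2 * pi) powr (1 - a) / pi\<^sup>2) * (\<Sum>n. real (Suc n) powr - (1 + a)))"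
    using a J by (intro suminf_ennreal_eq sums_mult summable_sums summable_Suc_powr) auto
  finally show ?thesis by (simp add: J_def)
qed

text \<open>Equating the two evaluations of the integral of
  \<open>frac x * (1 - frac x) * x powr (a - 2)\<close> gives the functional equation at real
  points.\<close>

lemma zeta_ext_neg_real:
  "zeta_ext (of_real (- a)) = of_real (- (2 powr - a * pi powr (- a - 1) * sin (pi * a / 2) * Gamma (1 + a) * (\<Sum>n. real (Suc n) powr - (1 + a))))"
proof -
  define J where "J = pi / (2 * cos (pi * a / 2) * Gamma (2 - a))"
  define Z where "Z = (\<Sum>n. real (Suc n) powr - (1 + a))"
  have cos: "cos (pi * a / 2) > 0" using a by (intro cos_gt_zero) auto
  then have J: "J \<ge> 0" unfolding J_def using a by (intro divide_nonneg_pos mult_pos_pos Gamma_real_pos) auto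
  have Z: "Z \<ge> 0" unfolding Z_def using a by (intro suminf_nonneg summable_Suc_powr) auto
  \<comment> \<open>The reflection formula for Gamma and the double-angle formula for the sine
    eliminate \<open>Gamma (2 - a)\<close> and the cosine from the constant.\<close>
  have aJ: "a * (1 - a) / 2 * J = Gamma (1 + a) * sin (pi * a / 2) / 2"
  proof -
    have G: "Gamma a > 0" "Gamma (1 - a) > 0" using a by auto
    have "1 - a \<notin> \<int>\<^sub>\<le>\<^sub>0" "a \<notin> \<int>\<^sub>\<le>\<^sub>0" using a by (auto elim!: nonpos_Ints_cases)
    note plus1 = this[THEN Gamma_plus1]
    have "Gamma (2 - a) = (1 - a) * Gamma (1 - a)"
      using plus1(1) by simp
    moreover have "Gamma (1 + a) = a * Gamma a"
      using plus1(2) by (simp add: add.commute)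
    moreover have "Gamma a * Gamma (1 - a) * sin (pi * a) = pi"
      using Gamma_reflection_real[of a] sin_gt_zero[of "pi * a"] a by (simp add: field_simps)
    moreover have "sin (pi * a) = 2 * sin (pi * a / 2) * cos (pi * a / 2)"
      using sin_double[of "pi * a / 2"] by simp
    ultimately have "Gamma a * Gamma (1 - a) * (2 * sin (pi * a / 2) * cos (pi * a / 2)) = pi" "J = pi / (2 * cos (pi * a / 2) * ((1 - a) * Gamma (1 - a)))"
      "Gamma (1 + a) = a * Gamma a" by (simp_all add: J_def)
    then have "J = Gamma a * Gamma (1 - a) * (2 * sin (pi * a / 2) * cos (pi * a / 2)) /
        (2 * cos (pi * a / 2) * ((1 - a) * Gamma (1 - a)))" by simp
    also have "\<dots> = Gamma a * sin (pi * a / 2) / (1 - a)"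
    proof -
      have "x * y * (2 * s * c) / (2 * c * (d * y)) = x * s / d" if "y > 0" "c > 0" for x y s c d :: real
        using that by simp
      then show ?thesis using G cos by blast
    qed
    finally have J_eq: "J = Gamma a * sin (pi * a / 2) / (1 - a)" .
    have "x * d / 2 * (y / d) = x * y / 2" if "d > 0" for x y d :: real using that by simp
    from this[of "1 - a"] show ?thesis
      unfolding J_eq \<open>Gamma (1 + a) = a * Gamma a\<close> using a by (simp only: mult.assoc diff_gt_0_iff_gt)
  qed
  have "ennreal (- Re (zeta_ext (of_real (- a)))) =
     (\<integral>\<^sup>+x. ennreal (a * (1 - a) / 2) * (ennreal (frac x * (1 - frac x) * x powr (a - 2)) * indicator {0<..} x) \<partial>lborel)"
    using a by (subst nn_integral_frac_powr_zeta_ext[symmetric], intro nn_integral_cong)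
       (auto simp: indicator_def ennreal_mult'[symmetric])
  also have "\<dots> = ennreal (a * (1 - a) / 2) * ennreal (J * ((2 * pi) powr (1 - a) / pi\<^sup>2) * Z)"
    using nn_integral_frac_powr_fourier by (subst nn_integral_cmult) (auto simp: J_def Z_def)
  also have "\<dots> = ennreal (a * (1 - a) / 2 * J * ((2 * pi) powr (1 - a) / pi\<^sup>2) * Z)"
    using a by (simp add: ennreal_mult'[symmetric] mult.assoc)
  finally have "- Re (zeta_ext (of_real (- a))) = a * (1 - a) / 2 * J * ((2 * pi) powr (1 - a) / pi\<^sup>2) * Z"
    using a J Z sums_le[OF B_piece_nonneg sums_zero B_piece_sums] 
    by (subst (asm) ennreal_inj) (auto simp: divide_nonneg_nonneg)
  also have "\<dots> = 2 powr - a * pi powr (- a - 1) * sin (pi * a / 2) * Gamma (1 + a) * Z"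
  proof -
    have "(2 * pi) powr (1 - a) = (2 powr 1 * 2 powr - a) * (pi powr 2 * pi powr (- a - 1))"
      by (simp only: powr_add[symmetric] powr_mult) simp
    then show ?thesis unfolding aJ by (simp add: field_simps)
  qed
  finally show ?thesis using Im_zeta_ext_real unfolding Z_def
    by (simp add: complex_eq_iff del: of_nat_Suc)
qed

end

section \<open>Functional equation and continuation to the punctured plane\<close>

definition zeta_chi :: "complex \<Rightarrow> complex" where
  "zeta_chi s = 2 powr s * of_real pi powr (s - 1) * sin (of_real pi * s / 2) * Gamma (1 - s)"

lemma zeta_chi_holomorphic: "zeta_chi holomorphic_on {s. Re s < 1}"
  unfolding zeta_chi_def[abs_def]
  by (intro holomorphic_intros) (auto intro!: pos_notin_nonpos_Ints)

lemma zeta_series_of_real: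
  assumes "r > 1"
  shows "zeta_series (of_real r) = of_real (\<Sum>n. real (Suc n) powr - r)"
proof -
  have "(\<lambda>n. complex_of_real (real (Suc n) powr - r)) sums of_real (\<Sum>n. real (Suc n) powr - r)"
    using assms by (intro sums_of_real summable_sums summable_Suc_powr)
  moreover have "complex_of_real (real (Suc n) powr - r) = 1 / of_nat (Suc n) powr of_real r" for n
  proof -
    have "complex_of_real (real (Suc n) powr - r) = of_real (real (Suc n)) powr (- of_real r)"
      using powr_of_real[of "real (Suc n)" "- r"] by (simp del: of_nat_Suc)
    then show ?thesis by (simp only: of_real_of_nat_eq powr_minus divide_inverse mult_1)
  qed
  ultimately show ?thesis unfolding dirichlet_def by (simp add: sums_iff)
qed

lemma zeta_series_holomorphic: "zeta_series holomorphic_on {s. Re s > 1}"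
  using dirichlet_has_field_derivative[of "\<lambda>_. 1"]
  by (intro holomorphic_onI) (auto intro: has_field_derivative_at_within simp: field_differentiable_def)

text \<open>Both sides are holomorphic in the strip and agree on the real segment (-1, 0), so the
  identity theorem applies, with \<open>-1/2\<close> as accumulation point.\<close>

lemma zeta_ext_reflect:
  assumes "-1 < Re s" "Re s < 0"
  shows "zeta_ext s = zeta_chi s * zeta_series (1 - s)"
proof -
  define S where "S = {s. -1 < Re s} \<inter> {s. Re s < 0}"
  have S: "open S" "connected S" unfolding S_def
    by (auto intro!: open_Int open_halfspace_Re_gt open_halfspace_Re_lt convex_connected convex_Int
        convex_halfspace_Re_gt convex_halfspace_Re_lt)
  define f where "f = (\<lambda>s. zeta_ext s - zeta_chi s * zeta_series (1 - s))"
  define U where "U = (\<lambda>a. complex_of_real (- a)) ` {0<..<1}"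
  have "f s = 0"
  proof (rule analytic_continuation[where S = S and f = f and U = U])
    have "zeta_series \<circ> (\<lambda>s. 1 - s) holomorphic_on S"
      by (rule holomorphic_on_compose_gen[OF _ zeta_series_holomorphic]) (auto simp: S_def intro!: holomorphic_intros)
    moreover have "zeta_ext holomorphic_on S"
      by (rule holomorphic_on_subset[OF zeta_ext_holomorphic]) (auto simp: S_def)
    moreover have "zeta_chi holomorphic_on S"
      by (rule holomorphic_on_subset[OF zeta_chi_holomorphic]) (auto simp: S_def)
    ultimately show "f holomorphic_on S" unfolding f_def o_def by (intro holomorphic_intros)
    show "U \<subseteq> S" by (auto simp: U_def S_def)
    show "- 1 / 2 \<in> S" by (auto simp: S_def)
    show "(- 1 / 2) islimpt U"
    proof (subst islimpt_approachable, intro allI impI)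
      fix e :: real assume e: "e > 0"
      define d where "d = min (e / 2) (1 / 4)"
      have "complex_of_real (- (1 / 2 + d)) \<in> U"
        unfolding U_def by (rule imageI) (use e in \<open>auto simp: d_def\<close>)
      moreover have "dist (complex_of_real (- (1 / 2 + d))) (- 1 / 2) = d"
        using e by (simp add: dist_norm d_def flip: norm_minus_cancel[of "_ - _"])
      ultimately show "\<exists>x'\<in>U. x' \<noteq> - 1 / 2 \<and> dist x' (- 1 / 2) < e"
        using e by (intro bexI[of _ "complex_of_real (- (1 / 2 + d))"]) (auto simp: d_def min_def)
    qed
    show "f z = 0" if "z \<in> U" for z
    proof -
      obtain a where a: "0 < a" "a < 1" "z = of_real (- a)" using \<open>z \<in> U\<close> by (auto simp: U_def)
      have "zeta_chi (of_real (- a)) = of_real (- (2 powr - a * pi powr (- a - 1) * sin (pi * a / 2) * Gamma (1 + a)))"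
      proof -
        have "(2 :: complex) powr of_real (- a) = of_real (2 powr - a)"
             "complex_of_real pi powr (of_real (- a) - 1) = of_real (pi powr (- a - 1))"
          using powr_of_real[of 2 "-a"] powr_of_real[of pi "-a-1"] by simp_all
        moreover have "sin (of_real pi * complex_of_real (- a) / 2) = of_real (- sin (pi * a / 2))"
          using sin_of_real[of "- (pi * a / 2)", where 'a = complex] by simp
        moreover have "Gamma (1 - complex_of_real (- a)) = of_real (Gamma (1 + a))"
          using Gamma_complex_of_real[of "1 + a"] by simp
        ultimately show ?thesis unfolding zeta_chi_def by simp
      qed
      moreover have "zeta_series (1 - of_real (- a)) = of_real (\<Sum>n. real (Suc n) powr - (1 + a))"
        using zeta_series_of_real[of "1 + a"] a by simp
      ultimately show ?thesis unfolding f_def a(3) zeta_ext_neg_real[OF a(1,2)] by simp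
    qed
  qed (use S assms in \<open>auto simp: S_def\<close>)
  then show ?thesis by (simp add: f_def)
qed

text \<open>The witness for the choice in \<open>riemann_zeta\<close>: the two formulas agree on the
  overlap \<open>-1 < Re s < 0\<close>, so they glue to a function holomorphic away from 1.\<close>

definition zeta_glued :: "complex \<Rightarrow> complex" where
  "zeta_glued s = (if Re s > -1 then zeta_ext s else zeta_chi s * zeta_series (1 - s))"

lemma zeta_glued_holomorphic: "zeta_glued holomorphic_on - {1}"
proof -
  have "zeta_glued holomorphic_on ({s. Re s > -1} - {1})"
    by (rule holomorphic_transform[OF zeta_ext_holomorphic]) (auto simp: zeta_glued_def)
  moreover have "zeta_glued holomorphic_on {s. Re s < 0}"
  proof -
    have "zeta_series \<circ> (\<lambda>s. 1 - s) holomorphic_on {s. Re s < 0}"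
      by (rule holomorphic_on_compose_gen[OF _ zeta_series_holomorphic]) (auto intro!: holomorphic_intros)
    moreover have "zeta_chi holomorphic_on {s. Re s < 0}"
      by (rule holomorphic_on_subset[OF zeta_chi_holomorphic]) auto
    ultimately have "(\<lambda>s. zeta_chi s * zeta_series (1 - s)) holomorphic_on {s. Re s < 0}"
      unfolding o_def by (intro holomorphic_intros)
    then show ?thesis
      by (rule holomorphic_transform) (auto simp: zeta_glued_def zeta_ext_reflect)
  qed
  ultimately have "zeta_glued holomorphic_on (({s. Re s > -1} - {1}) \<union> {s. Re s < 0})"
    by (intro holomorphic_on_Un open_Diff open_halfspace_Re_gt open_halfspace_Re_lt) auto
  then show ?thesis by (rule holomorphic_on_subset) auto
qed

lemma riemann_zeta_properties:
  "riemann_zeta holomorphic_on - {1} \<and> (\<forall>s. Re s > 1 \<longrightarrow> riemann_zeta s = (\<Sum>n. 1 / of_nat (Suc n) powr s))"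
proof -
  have "zeta_glued holomorphic_on - {1} \<and> (\<forall>s. Re s > 1 \<longrightarrow> zeta_glued s = (\<Sum>n. 1 / of_nat (Suc n) powr s))"
    using zeta_glued_holomorphic by (auto simp: zeta_glued_def zeta_ext_eq_series dirichlet_def)
  then show ?thesis
    unfolding riemann_zeta_def
    by (rule someI[where P = "\<lambda>f. f holomorphic_on - {1} \<and> (\<forall>s. Re s > 1 \<longrightarrow> f s = (\<Sum>n. 1 / of_nat (Suc n) powr s))"])
qed

lemma riemann_zeta_holomorphic: "riemann_zeta holomorphic_on - {1}"
  using riemann_zeta_properties by blast

lemma riemann_zeta_eq_series: "Re s > 1 \<Longrightarrow> riemann_zeta s = zeta_series s"
  using riemann_zeta_properties by (simp add: dirichlet_def)

lemma riemann_zeta_eq_ext: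
  assumes "Re s > -1" "s \<noteq> 1"
  shows "riemann_zeta s = zeta_ext s"
proof (rule analytic_continuation_open[of "{s. Re s > 1}" "{s. Re s > -1} - {1}" riemann_zeta zeta_ext])
  show "connected ({s. Re s > -1} - {1 :: complex})"
    by (rule connected_open_delete[OF open_halfspace_Re_gt convex_connected[OF convex_halfspace_Re_gt]]) simp
  have "(2 :: complex) \<in> {s. Re s > 1}" by simp
  then show "{s :: complex. Re s > 1} \<noteq> {}" by blast
  show "riemann_zeta holomorphic_on {s. Re s > -1} - {1}"
    by (rule holomorphic_on_subset[OF riemann_zeta_holomorphic]) auto
qed (use assms zeta_ext_holomorphic in
      \<open>auto simp: riemann_zeta_eq_series zeta_ext_eq_series intro: open_halfspace_Re_gt open_Diff\<close>)

text \<open>Known on the strip \<open>-1 < Re s < 0\<close>, it spreads by the identity theorem. The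
  point 0 is excluded because there the right-hand side involves \<open>riemann_zeta 1\<close>, a
  value that the definition leaves open.\<close>

lemma riemann_zeta_functional_equation:
  assumes "Re s < 1" "s \<noteq> 0"
  shows "riemann_zeta s = zeta_chi s * riemann_zeta (1 - s)"
proof (rule analytic_continuation_open[of "{s. -1 < Re s} \<inter> {s. Re s < 0}" "{s. Re s < 1} - {0}"
      riemann_zeta "\<lambda>s. zeta_chi s * riemann_zeta (1 - s)"])
  show "connected ({s. Re s < 1} - {0 :: complex})"
    by (rule connected_open_delete[OF open_halfspace_Re_lt convex_connected[OF convex_halfspace_Re_lt]]) simp
  show "{s. -1 < Re s} \<inter> {s. Re s < 0} \<noteq> {}"
  proof -
    have "- 1 / 2 \<in> {s. -1 < Re s} \<inter> {s. Re s < 0}" by simp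
    then show ?thesis by blast
  qed
  show "riemann_zeta holomorphic_on {s. Re s < 1} - {0}"
    by (rule holomorphic_on_subset[OF riemann_zeta_holomorphic]) auto
  have "riemann_zeta \<circ> (\<lambda>s. 1 - s) holomorphic_on {s. Re s < 1} - {0}"
    by (rule holomorphic_on_compose_gen[OF _ riemann_zeta_holomorphic]) (auto intro!: holomorphic_intros)
  moreover have "zeta_chi holomorphic_on {s. Re s < 1} - {0}"
    by (rule holomorphic_on_subset[OF zeta_chi_holomorphic]) auto
  ultimately show "(\<lambda>s. zeta_chi s * riemann_zeta (1 - s)) holomorphic_on {s. Re s < 1} - {0}"
    unfolding o_def by (intro holomorphic_intros)
  show "riemann_zeta z = zeta_chi z * riemann_zeta (1 - z)" if "z \<in> {s. -1 < Re s} \<inter> {s. Re s < 0}" for z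
  proof -
    have "z \<noteq> 1" using that by auto
    then show ?thesis
      using that zeta_ext_reflect[of z] riemann_zeta_eq_ext[of z] riemann_zeta_eq_series[of "1 - z"] by auto
  qed
qed (use assms in \<open>auto intro: open_halfspace_Re_gt open_halfspace_Re_lt open_Diff open_Int\<close>)

lemma riemann_zeta_pole: "((\<lambda>s. (s - 1) * riemann_zeta s) \<longlongrightarrow> 1) (at 1)"
proof (rule Lim_transform_eventually[OF zeta_ext_pole])
  have "eventually (\<lambda>s::complex. Re s > -1) (at 1)"
    using eventually_nhds_in_open[OF open_halfspace_Re_gt[of "-1"], of "1::complex"]
    by (simp add: eventually_nhds_conv_at)
  then show "\<forall>\<^sub>F s in at 1. (s - 1) * zeta_ext s = (s - 1) * riemann_zeta s"
    using eventually_neq_at_within[of "1::complex" 1 UNIV]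
    by eventually_elim (simp add: riemann_zeta_eq_ext)
qed

section \<open>Zero-free regions\<close>

lemma riemann_zeta_nonzero_of_Re_gt_1: "Re s > 1 \<Longrightarrow> riemann_zeta s \<noteq> 0"
  by (simp add: riemann_zeta_eq_series zeta_series_nonzero)

section \<open>Nonvanishing on the line Re s = 1\<close>

lemma mangoldt_le_ln: "n > 0 \<Longrightarrow> mangoldt n \<le> ln (real n)"
proof -
  assume n: "n > 0"
  have "mangoldt n \<le> (\<Sum>d | d dvd n. mangoldt d :: real)"
    using n by (intro member_le_sum mangoldt_nonneg) auto
  then show ?thesis using n mangoldt_sum[of n, where 'a = real] by simp
qed

lemma norm_mangoldt_le: "n > 0 \<Longrightarrow> norm (mangoldt n :: complex) \<le> 1 + ln (real n)"
  using mangoldt_le_ln[of n] by simp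

text \<open>The logarithmic derivative -\<zeta>'/\<zeta> is the Dirichlet series of
  \<open>mangoldt\<close>, here in product form: the values of \<open>mangoldt\<close> over the
  divisors of \<open>n\<close> add up to \<open>ln n\<close>.\<close>

lemma zeta_series_has_field_derivative:
  assumes "Re s > 1"
  shows "(zeta_series has_field_derivative - (dirichlet mangoldt s * zeta_series s)) (at s)"
proof -
  have "dirichlet mangoldt s * zeta_series s = dirichlet (\<lambda>n. \<Sum>d | d dvd n. mangoldt d * 1) s"
    using assms by (intro dirichlet_mult norm_mangoldt_le) auto
  also have "\<dots> = dirichlet (\<lambda>n. 1 * of_real (ln (real n))) s"
    unfolding dirichlet_def by (simp add: mangoldt_sum del: of_nat_Suc)
  finally show ?thesis
    using dirichlet_has_field_derivative[of "\<lambda>_. 1" s] assms by simp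
qed

text \<open>Half the logarithm of \<open>Re\<^sup>2 + Im\<^sup>2\<close> is single-valued, so the
  derivative comes from the real and imaginary parts and no branch of the complex logarithm has to
  be followed along the line.\<close>

lemma has_real_derivative_ln_norm:
  fixes f :: "real \<Rightarrow> complex"
  assumes f: "(f has_vector_derivative D) (at x)" and nz: "f x \<noteq> 0"
  shows "((\<lambda>x. ln (norm (f x))) has_real_derivative Re (D / f x)) (at x)"
proof -
  have R: "((\<lambda>x. Re (f x)) has_real_derivative Re D) (at x)" and I: "((\<lambda>x. Im (f x)) has_real_derivative Im D) (at x)"
    using bounded_linear.has_vector_derivative[OF bounded_linear_Re f]
      bounded_linear.has_vector_derivative[OF bounded_linear_Im f]
    by (simp_all add: has_real_derivative_iff_has_vector_derivative)
  have pos: "(Re (f x))\<^sup>2 + (Im (f x))\<^sup>2 > 0"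
    using nz by (simp add: complex_neq_0)
  have "((\<lambda>x. ln ((Re (f x))\<^sup>2 + (Im (f x))\<^sup>2) / 2) has_real_derivative
      (Re D * Re (f x) + Im D * Im (f x)) / ((Re (f x))\<^sup>2 + (Im (f x))\<^sup>2)) (at x)"
  proof -
    have "((\<lambda>x. ln ((u x)\<^sup>2 + (v x)\<^sup>2) / 2) has_real_derivative (u' * u x + v' * v x) / ((u x)\<^sup>2 + (v x)\<^sup>2)) (at x)"
      if "(u has_real_derivative u') (at x)" "(v has_real_derivative v') (at x)" "(u x)\<^sup>2 + (v x)\<^sup>2 > 0"
      for u v :: "real \<Rightarrow> real" and u' v'
    proof -
      have "((\<lambda>x. (u x)\<^sup>2 + (v x)\<^sup>2) has_real_derivative (2 * u x * u' + 2 * v x * v')) (at x)"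
        using that(1,2) by (auto intro!: derivative_eq_intros)
      from DERIV_cdivide[OF DERIV_chain2[OF DERIV_ln_divide[OF that(3)] this]]
      have "((\<lambda>x. ln ((u x)\<^sup>2 + (v x)\<^sup>2) / 2) has_real_derivative
          (1 / ((u x)\<^sup>2 + (v x)\<^sup>2) * (2 * u x * u' + 2 * v x * v')) / 2) (at x)" .
      moreover have "1 / k * (2 * p * p' + 2 * q * q') / 2 = (p' * p + q' * q) / k" for k p p' q q' :: real
        by (cases "k = 0") (auto simp: field_simps)
      ultimately show ?thesis by (simp only:)
    qed
    from this[OF R I pos] show ?thesis .
  qed
  moreover have "ln (norm (f x)) = ln ((Re (f x))\<^sup>2 + (Im (f x))\<^sup>2) / 2" for x
    by (cases "f x = 0") (auto simp: cmod_def ln_sqrt complex_neq_0[symmetric] complex_eq_iff)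
  ultimately show ?thesis by (simp only: Re_divide)
qed

lemma ln_norm_zeta_series_has_derivative:
  assumes x: "x > 1"
  shows "((\<lambda>x. ln (norm (zeta_series (Complex x t)))) has_real_derivative - Re (dirichlet mangoldt (Complex x t))) (at x)"
proof -
  have "((\<lambda>x. Complex x t) has_vector_derivative 1) (at x)"
    unfolding Complex_eq
    by (rule has_vector_derivative_real_field) (auto intro!: derivative_eq_intros)
  from field_vector_diff_chain_at[OF this zeta_series_has_field_derivative]
  have "(zeta_series \<circ> (\<lambda>x. Complex x t) has_vector_derivative
      - (dirichlet mangoldt (Complex x t) * zeta_series (Complex x t))) (at x)"
    using x by simp
  from has_real_derivative_ln_norm[OF this] show ?thesis
    using x zeta_series_nonzero[of "Complex x t"] by (simp add: o_def)
qed

lemma Re_dirichlet_mangoldt_sums: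
  assumes x: "x > 1"
  shows "(\<lambda>n. mangoldt (Suc n) * real (Suc n) powr - x * cos (t * ln (real (Suc n)))) sums
           Re (dirichlet mangoldt (Complex x t))"
proof -
  have "summable (\<lambda>n. norm (mangoldt (Suc n) / of_nat (Suc n) powr Complex x t :: complex))"
    using x by (intro dirichlet_summable norm_mangoldt_le) auto
  from sums_Re[OF summable_sums[OF summable_norm_cancel[OF this]]]
  have "(\<lambda>n. Re (mangoldt (Suc n) / of_nat (Suc n) powr Complex x t)) sums Re (dirichlet mangoldt (Complex x t))"
    by (simp only: dirichlet_def)
  moreover have "Re (mangoldt (Suc n) / of_nat (Suc n) powr Complex x t) =
      mangoldt (Suc n) * real (Suc n) powr - x * cos (t * ln (real (Suc n)))" for n
  proof -
    have "1 / (of_nat (Suc n) :: complex) powr Complex x t = exp (- (Complex x t * of_real (ln (real (Suc n)))))"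
      using Ln_of_nat[of "Suc n"] by (simp add: powr_def exp_minus divide_inverse del: of_nat_Suc)
    then have "Re (1 / (of_nat (Suc n) :: complex) powr Complex x t) = exp (- x * ln (real (Suc n))) * cos (t * ln (real (Suc n)))"
      by (simp add: Re_exp del: of_nat_Suc)
    also have "exp (- x * ln (real (Suc n))) = real (Suc n) powr - x"
      by (simp add: powr_def)
    finally have *: "Re (1 / (of_nat (Suc n) :: complex) powr Complex x t) = real (Suc n) powr - x * cos (t * ln (real (Suc n)))" .
    have "mangoldt (Suc n) / (of_nat (Suc n) :: complex) powr Complex x t =
        of_real (mangoldt (Suc n)) * (1 / (of_nat (Suc n)) powr Complex x t)" by simp
    also have "Re \<dots> = mangoldt (Suc n) * Re (1 / (of_nat (Suc n) :: complex) powr Complex x t)"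
      by (simp only: Re_complex_of_real Im_complex_of_real times_complex.sel mult_zero_left diff_zero)
    finally show ?thesis by (simp only: * mult.assoc)
  qed
  ultimately show ?thesis by (simp only:)
qed

text \<open>By \<open>3 + 4 cos \<theta> + cos 2\<theta> \<ge> 0\<close> the logarithm of the product decreases in \<open>x\<close>.\<close>

lemma zeta_three_four_one:
  assumes x: "1 < x" "x \<le> 2"
  shows "norm (zeta_series (Complex x 0)) ^ 3 * norm (zeta_series (Complex x t)) ^ 4 * norm (zeta_series (Complex x (2 * t))) \<ge>
         norm (zeta_series (Complex 2 0)) ^ 3 * norm (zeta_series (Complex 2 t)) ^ 4 * norm (zeta_series (Complex 2 (2 * t)))"
proof -
  define l where "l = (\<lambda>t x. ln (norm (zeta_series (Complex x t))))"
  define L where "L = (\<lambda>t x. Re (dirichlet mangoldt (Complex x t)))"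
  define Q where "Q = (\<lambda>x. 3 * l 0 x + 4 * l t x + l (2 * t) x)"
  have der: "(l t has_real_derivative - L t x) (at x)" if "x > 1" for t x
    unfolding l_def L_def using that by (rule ln_norm_zeta_series_has_derivative)
  have "Q 2 \<le> Q x"
  proof (rule DERIV_nonpos_imp_nonincreasing[OF x(2)])
    fix y assume y: "x \<le> y" "y \<le> 2"
    then have y1: "y > 1" using x by simp
    have "(\<lambda>n. 3 * (mangoldt (Suc n) * real (Suc n) powr - y * cos (0 * ln (real (Suc n))))
        + 4 * (mangoldt (Suc n) * real (Suc n) powr - y * cos (t * ln (real (Suc n))))
        + mangoldt (Suc n) * real (Suc n) powr - y * cos (2 * t * ln (real (Suc n)))) sums (3 * L 0 y + 4 * L t y + L (2 * t) y)"
      unfolding L_def by (intro sums_add sums_mult Re_dirichlet_mangoldt_sums y1)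
    moreover have "3 * (mangoldt (Suc n) * real (Suc n) powr - y * cos (0 * ln (real (Suc n))))
        + 4 * (mangoldt (Suc n) * real (Suc n) powr - y * cos (t * ln (real (Suc n))))
        + mangoldt (Suc n) * real (Suc n) powr - y * cos (2 * t * ln (real (Suc n))) \<ge> 0" for n
    proof -
      define c where "c = cos (t * ln (real (Suc n)))"
      have cos2: "cos (2 * t * ln (real (Suc n))) = 2 * c\<^sup>2 - 1"
        using cos_double_cos[of "t * ln (real (Suc n))"] by (simp add: c_def mult.assoc)
      have "3 * (mangoldt (Suc n) * real (Suc n) powr - y * cos (0 * ln (real (Suc n))))
        + 4 * (mangoldt (Suc n) * real (Suc n) powr - y * cos (t * ln (real (Suc n))))
        + mangoldt (Suc n) * real (Suc n) powr - y * cos (2 * t * ln (real (Suc n))) =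
          mangoldt (Suc n) * real (Suc n) powr - y * (2 * (1 + c)\<^sup>2)"
        unfolding cos2 c_def[symmetric] by (simp add: algebra_simps power2_eq_square del: of_nat_Suc)
      then show ?thesis using mangoldt_nonneg[of "Suc n"] by simp
    qed
    ultimately have "0 \<le> 3 * L 0 y + 4 * L t y + L (2 * t) y"
      by (metis (no_types, lifting) sums_le sums_zero)
    moreover have "(Q has_real_derivative (3 * - L 0 y + 4 * - L t y + - L (2 * t) y)) (at y)"
      unfolding Q_def by (intro DERIV_add DERIV_cmult der y1)
    ultimately show "\<exists>D. (Q has_real_derivative D) (at y) \<and> D \<le> 0"
      by (intro exI[of _ "3 * - L 0 y + 4 * - L t y + - L (2 * t) y"]) simp
  qed
  then have "exp (Q 2) \<le> exp (Q x)" by simp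
  moreover have "exp (Q y) = norm (zeta_series (Complex y 0)) ^ 3 * norm (zeta_series (Complex y t)) ^ 4 * norm (zeta_series (Complex y (2 * t)))"
    if "y > 1" for y
  proof -
    have "norm (zeta_series (Complex y t)) > 0" for t
      using zeta_series_nonzero[of "Complex y t"] that by simp
    then have "exp (l t y) = norm (zeta_series (Complex y t))" for t
      by (simp add: l_def)
    then show ?thesis unfolding Q_def by (simp add: exp_add exp_of_nat_mult[of 3, simplified] exp_of_nat_mult[of 4, simplified])
  qed
  ultimately show ?thesis using x by simp
qed

lemma riemann_zeta_isCont: "s \<noteq> 1 \<Longrightarrow> isCont riemann_zeta s"
  using riemann_zeta_holomorphic holomorphic_on_imp_continuous_on[of riemann_zeta "- {1}"]
  by (auto simp: continuous_on_eq_continuous_at open_Compl)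

text \<open>At a zero \<open>1 + i t\<close> the fourth power in \<open>zeta_three_four_one\<close>
  would be O((x - 1)^4) as \<open>x\<close> decreases to 1, which beats the pole of order 3 of the
  first factor; the product would tend to 0, against its positive lower bound. The assumption
  \<open>t \<noteq> 0\<close> also keeps \<open>1 + 2 i t\<close> away from the pole.\<close>

lemma riemann_zeta_nonzero_on_line_1:
  assumes t: "t \<noteq> 0"
  shows "riemann_zeta (Complex 1 t) \<noteq> 0"
proof
  assume zero: "riemann_zeta (Complex 1 t) = 0"
  have ne: "Complex 1 t \<noteq> 1" "Complex 1 (2 * t) \<noteq> 1" using t by (auto simp: complex_eq_iff)
  define D where "D = deriv riemann_zeta (Complex 1 t)"
  have line: "filterlim (\<lambda>x. Complex x t) (at (Complex 1 t)) (at_right 1)" for t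
  proof -
    have "((\<lambda>x. Complex x t) \<longlongrightarrow> Complex 1 t) (at_right 1)"
      by (intro tendsto_Complex tendsto_intros)
    then show ?thesis
      by (rule filterlim_atI) (auto simp: eventually_at_filter)
  qed
  have "(riemann_zeta has_field_derivative D) (at (Complex 1 t))"
    unfolding D_def using ne
    by (intro holomorphic_derivI[OF riemann_zeta_holomorphic]) (auto simp: open_Compl)
  then have "((\<lambda>s. riemann_zeta s / (s - Complex 1 t)) \<longlongrightarrow> D) (at (Complex 1 t))"
    using zero by (simp add: has_field_derivative_iff)
  from tendsto_norm[OF filterlim_compose[OF this line]]
  have l2: "((\<lambda>x. norm (riemann_zeta (Complex x t) / (Complex x t - Complex 1 t))) \<longlongrightarrow> norm D) (at_right 1)" .
  have "Complex 1 0 = 1" by (simp add: complex_eq_iff)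
  then have "filterlim (\<lambda>x. Complex x 0) (at 1) (at_right 1)" using line[of 0] by simp
  from tendsto_norm[OF filterlim_compose[OF riemann_zeta_pole this]]
  have l1: "((\<lambda>x. norm ((Complex x 0 - 1) * riemann_zeta (Complex x 0))) \<longlongrightarrow> norm (1::complex)) (at_right 1)" .
  have l3: "((\<lambda>x. norm (riemann_zeta (Complex x (2 * t)))) \<longlongrightarrow> norm (riemann_zeta (Complex 1 (2 * t)))) (at_right 1)"
    by (intro tendsto_norm isCont_tendsto_compose[OF riemann_zeta_isCont[OF ne(2)]] tendsto_Complex tendsto_intros)
  have l4: "((\<lambda>x. x - 1) \<longlongrightarrow> 1 - (1::real)) (at_right 1)" by (intro tendsto_intros)
  have lim: "((\<lambda>x. norm ((Complex x 0 - 1) * riemann_zeta (Complex x 0)) ^ 3 *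
      norm (riemann_zeta (Complex x t) / (Complex x t - Complex 1 t)) ^ 4 *
      norm (riemann_zeta (Complex x (2 * t))) * (x - 1)) \<longlongrightarrow>
      norm (1::complex) ^ 3 * norm D ^ 4 * norm (riemann_zeta (Complex 1 (2 * t))) * (1 - 1)) (at_right 1)"
    by (intro tendsto_intros l1 l2 l3 l4)
  define c where "c = norm (zeta_series (Complex 2 0)) ^ 3 * norm (zeta_series (Complex 2 t)) ^ 4 * norm (zeta_series (Complex 2 (2 * t)))"
  have c: "c > 0" unfolding c_def using zeta_series_nonzero[of "Complex 2 t" for t] by simp
  have "eventually (\<lambda>x. x \<in> {1<..<2}) (at_right (1::real))" by (rule eventually_at_right_real) simp
  then have "eventually (\<lambda>x. c \<le> norm ((Complex x 0 - 1) * riemann_zeta (Complex x 0)) ^ 3 *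
      norm (riemann_zeta (Complex x t) / (Complex x t - Complex 1 t)) ^ 4 *
      norm (riemann_zeta (Complex x (2 * t))) * (x - 1)) (at_right 1)"
  proof eventually_elim
    case (elim x)
    define y where "y = x - 1"
    have y: "y > 0" using elim by (simp add: y_def)
    have e: "Complex x 0 - 1 = of_real y" "Complex x t - Complex 1 t = of_real y"
      by (simp_all add: complex_eq_iff y_def)
    have "c \<le> norm (zeta_series (Complex x 0)) ^ 3 * norm (zeta_series (Complex x t)) ^ 4 * norm (zeta_series (Complex x (2 * t)))"
      using elim unfolding c_def by (intro zeta_three_four_one) auto
    also have "\<dots> = norm (riemann_zeta (Complex x 0)) ^ 3 * norm (riemann_zeta (Complex x t)) ^ 4 * norm (riemann_zeta (Complex x (2 * t)))"
      using elim by (simp add: riemann_zeta_eq_series)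
    also have "\<dots> = norm ((Complex x 0 - 1) * riemann_zeta (Complex x 0)) ^ 3 *
      norm (riemann_zeta (Complex x t) / (Complex x t - Complex 1 t)) ^ 4 *
      norm (riemann_zeta (Complex x (2 * t))) * y"
      unfolding e norm_mult norm_divide norm_of_real power_mult_distrib power_divide
      using y by (simp add: field_simps power3_eq_cube power4_eq_xxxx)
    finally show ?case by (simp add: y_def)
  qed
  from tendsto_lowerbound[OF lim this] c show False by simp
qed

lemma riemann_zeta_nonzero_of_Re_ge_1:
  assumes "Re s \<ge> 1" "s \<noteq> 1"
  shows "riemann_zeta s \<noteq> 0"
proof (cases "Re s = 1")
  case True
  then have "s = Complex 1 (Im s)" "Im s \<noteq> 0" using assms by (auto simp: complex_eq_iff)
  then show ?thesis using riemann_zeta_nonzero_on_line_1 by metis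
qed (use assms riemann_zeta_nonzero_of_Re_gt_1 in auto)

section \<open>Reflection of zeros and bounds in vertical strips\<close>

lemma zeta_chi_nonzero:
  assumes "Re s < 1" "Im s \<noteq> 0"
  shows "zeta_chi s \<noteq> 0"
proof -
  have "sin (of_real pi * s / 2) \<noteq> 0"
  proof
    assume "sin (of_real pi * s / 2) = 0"
    then obtain n :: int where "of_real pi * s / 2 = of_real (of_int n * pi)"
      unfolding sin_eq_0 by blast
    then have "Im (of_real pi * s / 2) = 0" by simp
    then show False using assms by simp
  qed
  moreover have "Gamma (1 - s) \<noteq> 0"
    using assms by (simp add: Gamma_eq_zero_iff pos_notin_nonpos_Ints)
  ultimately show ?thesis by (simp add: zeta_chi_def)
qed

lemma riemann_zeta_zero_reflect:
  assumes "0 < Re s" "Re s < 1" "riemann_zeta s = 0"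
  shows "riemann_zeta (1 - s) = 0"
  using riemann_zeta_functional_equation[of "1 - s"] assms by (cases "s = 1") auto

text \<open>The factor \<open>norm s * norm (s + 1)\<close> in the error bound gives quadratic
  growth. The range of \<open>s\<close> is chosen to contain the discs of radius at most 7/2 about
  \<open>3 + i t\<close> with \<open>\<bar>t\<bar> \<ge> 5\<close> that are used later.\<close>

lemma riemann_zeta_growth:
  obtains A where "A \<ge> 1"
    "\<And>s. Re s \<ge> - 1/2 \<Longrightarrow> Re s \<le> 7 \<Longrightarrow> \<bar>Im s\<bar> \<ge> 1 \<Longrightarrow> norm (riemann_zeta s) \<le> A * \<bar>Im s\<bar>\<^sup>2"
proof -
  obtain C where C: "C \<ge> 0" "\<And>s. s \<noteq> 1 \<Longrightarrow> Re s \<ge> - 1/2 \<Longrightarrow> norm (\<Sum>n. em_term (real (Suc n)) s) \<le> C * (norm s * norm (s + 1))"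
    by (rule suminf_em_term_bound[of "- 1/2"]) auto
  define A where "A = 3 / 2 + C * 72"
  have "norm (riemann_zeta s) \<le> A * \<bar>Im s\<bar>\<^sup>2" if s: "Re s \<ge> - 1/2" "Re s \<le> 7" "\<bar>Im s\<bar> \<ge> 1" for s
  proof -
    have s1: "s \<noteq> 1" using s by auto
    have T: "\<bar>Im s\<bar>\<^sup>2 \<ge> 1" using s power_mono[of 1 "\<bar>Im s\<bar>" 2] by simp
    have n1: "norm s \<le> 8 * \<bar>Im s\<bar>" using cmod_le[of s] s by linarith
    have n2: "norm (s + 1) \<le> 9 * \<bar>Im s\<bar>" using cmod_le[of "s + 1"] s by auto
    have "norm (1 / (s - 1)) \<le> 1"
      using abs_Im_le_cmod[of "s - 1"] s s1 by (simp add: norm_divide divide_simps)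
    then have "norm (1 / (s - 1) + 1 / 2) \<le> 3 / 2"
      using norm_triangle_ineq[of "1 / (s - 1)" "1 / 2"] by simp
    moreover have "norm (\<Sum>n. em_term (real (Suc n)) s) \<le> C * (72 * \<bar>Im s\<bar>\<^sup>2)"
    proof -
      have "norm s * norm (s + 1) \<le> (8 * \<bar>Im s\<bar>) * (9 * \<bar>Im s\<bar>)"
        by (intro mult_mono n1 n2) auto
      then have "C * (norm s * norm (s + 1)) \<le> C * (72 * \<bar>Im s\<bar>\<^sup>2)"
        using C by (intro mult_left_mono) (auto simp: power2_eq_square)
      then show ?thesis using C(2)[of s] s1 s by linarith
    qed
    ultimately have "norm (zeta_ext s) \<le> 3 / 2 + C * (72 * \<bar>Im s\<bar>\<^sup>2)"
      unfolding zeta_ext_def by (smt (verit) norm_triangle_ineq4)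
    also have "\<dots> \<le> 3 / 2 * \<bar>Im s\<bar>\<^sup>2 + C * (72 * \<bar>Im s\<bar>\<^sup>2)" using T by simp
    finally show ?thesis using riemann_zeta_eq_ext[of s] s s1 by (simp add: A_def algebra_simps)
  qed
  moreover have "A \<ge> 1" using C by (simp add: A_def)
  ultimately show ?thesis using that by blast
qed

text \<open>\<open>B\<close> is the value \<zeta>(2). For \<open>Re s \<ge> 2\<close> it bounds
  every Dirichlet series with coefficients of modulus at most 1, hence \<zeta> as well as its
  reciprocal, the Moebius series.\<close>

lemma zeta_series_two_sided_bound:
  obtains B where "B \<ge> 1" "\<And>s. Re s \<ge> 2 \<Longrightarrow> norm (zeta_series s) \<le> B" "\<And>s. Re s \<ge> 2 \<Longrightarrow> 1 / B \<le> norm (zeta_series s)"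
proof -
  define B where "B = (\<Sum>n. real (Suc n) powr - 2)"
  have sm: "summable (\<lambda>n. real (Suc n) powr - 2)" by (rule summable_Suc_powr) simp
  have B1: "B \<ge> 1"
    using sum_le_suminf[OF sm, of "{0}"] by (simp add: B_def)
  have bound: "norm (dirichlet a s) \<le> B" if "Re s \<ge> 2" "\<And>n. norm (a n) \<le> 1" for a s
  proof -
    have "norm (dirichlet a s) \<le> (\<Sum>n. real (Suc n) powr - 2)"
      unfolding dirichlet_def
    proof (rule norm_suminf_le[OF _ sm])
      fix n
      have "norm (a (Suc n) / of_nat (Suc n) powr s) = norm (a (Suc n)) * real (Suc n) powr - Re s"
        by (simp add: norm_mult norm_inverse norm_of_nat_powr powr_minus divide_inverse del: of_nat_Suc)
      also have "\<dots> \<le> 1 * real (Suc n) powr - 2"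
        using that by (intro mult_mono powr_mono) auto
      finally show "norm (a (Suc n) / of_nat (Suc n) powr s) \<le> real (Suc n) powr - 2" by simp
    qed
    then show ?thesis by (simp add: B_def)
  qed
  have "1 / B \<le> norm (zeta_series s)" if s: "Re s \<ge> 2" for s
  proof -
    have "norm (of_int (moebius_mu n) :: complex) \<le> 1" for n by (rule norm_moebius_mu_le)
    then have "norm (dirichlet (\<lambda>n. of_int (moebius_mu n)) s) \<le> B" by (intro bound s)
    then have "norm (dirichlet (\<lambda>n. of_int (moebius_mu n)) s) * norm (zeta_series s) \<le> B * norm (zeta_series s)"
      by (intro mult_right_mono) auto
    moreover have "norm (dirichlet (\<lambda>n. of_int (moebius_mu n)) s) * norm (zeta_series s) = 1"
      using dirichlet_moebius_times_zeta_series[of s] s by (simp flip: norm_mult)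
    ultimately show ?thesis using B1 by (simp add: field_simps)
  qed
  then show ?thesis using that[of B] B1 bound[of _ "\<lambda>_. 1"] by simp
qed

section \<open>Subpolynomial growth in zero-free half-planes\<close>

text \<open>\<open>Re f < M\<close> makes \<open>f\<close> closer to 0 than to \<open>2 * M\<close>,
  so the quotient of \<open>f\<close> by \<open>2 * M - f\<close> maps into the unit disc, and the
  Schwarz lemma applies after rescaling.\<close>

lemma Borel_Caratheodory:
  assumes f: "f holomorphic_on ball z0 R" and f0: "f z0 = 0" and M: "M > 0"
    and Re: "\<And>z. z \<in> ball z0 R \<Longrightarrow> Re (f z) < M" and r: "0 < r" "r < R" and z: "z \<in> cball z0 r"
  shows "norm (f z) \<le> 2 * M * r / (R - r)"
proof -
  have R: "R > 0" using r by simp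
  define h where "h = (\<lambda>w. z0 + of_real R * w)"
  have h: "h w \<in> ball z0 R" if "norm w < 1" for w
    using that R by (simp add: h_def dist_norm norm_mult)
  define G where "G = (\<lambda>w. f (h w) / (of_real (2 * M) - f (h w)))"
  have ne: "of_real (2 * M) - f (h w) \<noteq> 0" if "norm w < 1" for w
  proof
    assume "of_real (2 * M) - f (h w) = 0"
    then have "Re (f (h w)) = 2 * M" by (simp add: complex_eq_iff)
    then show False using Re[OF h[OF that]] M by simp
  qed
  define w where "w = (z - z0) / of_real R"
  have nw: "norm w \<le> r / R" using z R by (simp add: w_def norm_divide dist_norm norm_minus_commute divide_right_mono)
  also have "r / R < 1" using r by simp
  finally have w1: "norm w < 1" .
  have hw: "h w = z" using R by (simp add: h_def w_def)
  have "norm (G w) \<le> norm w"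
  proof (rule Schwarz_Lemma)
    have "f \<circ> h holomorphic_on ball 0 1"
      by (rule holomorphic_on_compose_gen[OF _ f]) (use h in \<open>auto simp: h_def intro!: holomorphic_intros\<close>)
    then have "(\<lambda>w. f (h w)) holomorphic_on ball 0 1" by (simp add: o_def)
    then show "G holomorphic_on ball 0 1"
      unfolding G_def using ne by (intro holomorphic_intros) auto
    show "G 0 = 0" by (simp add: G_def h_def f0)
    show "norm (G u) < 1" if u: "norm u < 1" for u
    proof -
      have "Re (f (h u)) < M" using Re h u by blast
      then have "0 < 4 * M * (M - Re (f (h u)))" using M by simp
      then have "(norm (f (h u)))\<^sup>2 < (norm (of_real (2 * M) - f (h u)))\<^sup>2"
        unfolding cmod_power2 by (simp add: power2_eq_square algebra_simps)
      then have "norm (f (h u)) < norm (of_real (2 * M) - f (h u))"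
        by (rule power2_less_imp_less) auto
      then show ?thesis unfolding G_def norm_divide by (subst divide_less_eq_1_pos) auto
    qed
  qed (fact w1)
  then have G: "norm (G w) \<le> r / R" using nw by linarith
  have "f z = G w * (of_real (2 * M) - f z)"
    using ne[OF w1] by (simp add: G_def hw)
  then have "norm (f z) = norm (G w) * norm (of_real (2 * M) - f z)" by (metis norm_mult)
  also have "\<dots> \<le> r / R * (2 * M + norm (f z))"
    using G M r R norm_triangle_ineq4[of "of_real (2 * M)" "f z"] by (intro mult_mono) auto
  finally have "R * norm (f z) \<le> r * (2 * M + norm (f z))" using R by (simp add: field_simps)
  then show ?thesis using r by (simp add: field_simps)
qed

lemma norm_Taylor_coeff_le:
  assumes "f holomorphic_on ball z0 R" "0 < r" "r < R" "\<And>z. z \<in> cball z0 r \<Longrightarrow> norm (f z) \<le> B"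
  shows "norm ((deriv ^^ k) f z0 / fact k) \<le> B / r ^ k"
proof -
  have "norm ((deriv ^^ k) f z0) \<le> fact k * B / r ^ k"
  proof (rule Cauchy_inequality)
    show "f holomorphic_on ball z0 r" using assms by (meson holomorphic_on_subset subset_ball less_imp_le)
    have "cball z0 r \<subseteq> ball z0 R" using assms by auto
    then show "continuous_on (cball z0 r) f"
      using assms(1) by (meson holomorphic_on_imp_continuous_on continuous_on_subset)
  qed (use assms in \<open>auto simp: dist_norm\<close>)
  then show ?thesis by (simp add: norm_divide field_simps)
qed

text \<open>Low-order Taylor coefficients are controlled by the bound on the unit disc, high-order ones by the
  one-sided bound \<open>M\<close> on the large disc. Cutting the series at an order depending only on \<open>\<epsilon>\<close> takes the
  place of the three-circles theorem.\<close>

lemma holomorphic_bound_by_Re_bound: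
  assumes \<rho>: "0 < \<rho>" "\<rho> < R" and R: "1 \<le> R" and \<epsilon>: "\<epsilon> > 0" and C0: "C0 \<ge> 0"
  obtains C where "\<And>f z0 M z. f holomorphic_on ball z0 R \<Longrightarrow> M \<ge> 0 \<Longrightarrow> (\<And>z. z \<in> ball z0 R \<Longrightarrow> Re (f z) \<le> M) \<Longrightarrow>
     (\<And>z. z \<in> ball z0 1 \<Longrightarrow> \<bar>Re (f z)\<bar> \<le> C0) \<Longrightarrow> norm (f z0) \<le> C0 \<Longrightarrow> z \<in> cball z0 \<rho> \<Longrightarrow> norm (f z) \<le> C + \<epsilon> * M"
proof -
  define r where "r = (\<rho> + R) / 2"
  have r: "\<rho> < r" "r < R" "0 < r" using \<rho> by (auto simp: r_def)
  define q where "q = \<rho> / r"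
  have q: "0 < q" "q < 1" using \<rho> r by (auto simp: q_def)
  \<comment> \<open>The factor in the Borel-Caratheodory bound from radius \<open>R\<close> to the
    intermediate radius \<open>r\<close>; the geometric ratio \<open>q\<close> of
    \<open>\<rho>\<close> to \<open>r\<close> then makes the tail from order \<open>K\<close> on
    small.\<close>
  define D where "D = 2 * r / (R - r)"
  have D: "D > 0" using r by (simp add: D_def)
  have "(\<lambda>K. D * (q ^ K / (1 - q))) \<longlonglongrightarrow> D * (0 / (1 - q))"
    using q by (intro tendsto_intros LIMSEQ_power_zero) auto
  then have "eventually (\<lambda>K. D * (q ^ K / (1 - q)) < \<epsilon>) sequentially"
    using \<epsilon> by (intro order_tendstoD) auto
  then obtain K where K: "D * (q ^ K / (1 - q)) < \<epsilon>" by (auto dest: eventually_happens)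
  \<comment> \<open>The Borel-Caratheodory bound at radius 1/2 inside the unit disc, where
    \<open>2 * C0 + 1\<close> strictly exceeds the real part of \<open>f - f z0\<close>.\<close>
  define B0 where "B0 = 2 * (2 * C0 + 1)"
  define C where "C = C0 + (\<Sum>k<K. B0 * (2 * \<rho>) ^ k) + \<epsilon> * (C0 + 1)"
  show ?thesis
  proof (rule that[of C])
    fix f :: "complex \<Rightarrow> complex" and z0 M z
    assume f: "f holomorphic_on ball z0 R" and M: "M \<ge> 0" and Re: "\<And>z. z \<in> ball z0 R \<Longrightarrow> Re (f z) \<le> M"
      and Re1: "\<And>z. z \<in> ball z0 1 \<Longrightarrow> \<bar>Re (f z)\<bar> \<le> C0" and f0: "norm (f z0) \<le> C0" and z: "z \<in> cball z0 \<rho>"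
    define F where "F = (\<lambda>z. f z - f z0)"
    have F: "F holomorphic_on ball z0 R" unfolding F_def by (intro holomorphic_intros f)
    have Re0: "\<bar>Re (f z0)\<bar> \<le> C0" using f0 abs_Re_le_cmod[of "f z0"] by linarith
    define B where "B = D * (M + C0 + 1)"
    have B: "norm (F w) \<le> B" if "w \<in> cball z0 r" for w
    proof -
      have "norm (F w) \<le> 2 * (M + C0 + 1) * r / (R - r)"
      proof (rule Borel_Caratheodory[OF F])
        fix z assume "z \<in> ball z0 R"
        from Re[OF this] Re0 show "Re (F z) < M + C0 + 1" by (simp add: F_def)
      qed (use M C0 r that in \<open>auto simp: F_def\<close>)
      also have "\<dots> = B" by (simp add: B_def D_def)
      finally show ?thesis .
    qed
    have B0: "norm (F w) \<le> B0" if "w \<in> cball z0 (1/2)" for w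
    proof -
      have "norm (F w) \<le> 2 * (2 * C0 + 1) * (1/2) / (1 - 1/2)"
      proof (rule Borel_Caratheodory[where f = F and z = w and R = 1 and ?z0.0 = z0])
        show "F holomorphic_on ball z0 1" using F R by (meson holomorphic_on_subset subset_ball)
        fix z assume "z \<in> ball z0 1"
        from Re1[OF this] Re0 show "Re (F z) < 2 * C0 + 1" by (simp add: F_def)
      qed (use C0 that in \<open>auto simp: F_def\<close>)
      then show ?thesis by (simp add: B0_def)
    qed
    define a where "a = (\<lambda>k. (deriv ^^ k) F z0 / fact k)"
    define w where "w = z - z0"
    have w: "norm w \<le> \<rho>" using z by (simp add: w_def dist_norm norm_minus_commute)
    have a1: "norm (a k * w ^ k) \<le> B0 * (2 * \<rho>) ^ k" for k
    proof -
      have "norm (a k) \<le> B0 / (1/2) ^ k"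
        unfolding a_def using R by (intro norm_Taylor_coeff_le[OF F _ _ B0]) auto
      then have "norm (a k) * norm w ^ k \<le> (B0 / (1/2) ^ k) * \<rho> ^ k"
        using w C0 by (intro mult_mono power_mono) (auto simp: B0_def)
      also have "\<dots> = B0 * (2 * \<rho>) ^ k" by (simp add: power_mult_distrib power_divide)
      finally show ?thesis by (simp add: norm_mult norm_power)
    qed
    have B_nonneg: "B \<ge> 0" unfolding B_def using D M C0 by simp
    have a2: "norm (a k * w ^ k) \<le> B * q ^ k" for k
    proof -
      have "norm (a k) \<le> B / r ^ k"
        unfolding a_def using r by (intro norm_Taylor_coeff_le[OF F _ _ B]) auto
      then have "norm (a k) * norm w ^ k \<le> (B / r ^ k) * \<rho> ^ k"
        using w r B_nonneg by (intro mult_mono power_mono) auto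
      also have "\<dots> = B * q ^ k" by (simp add: q_def power_divide)
      finally show ?thesis by (simp add: norm_mult norm_power)
    qed
    have "z \<in> ball z0 R" using z \<rho> by auto
    from holomorphic_power_series[OF F this] have sums: "(\<lambda>k. a k * w ^ k) sums F z"
      by (simp add: a_def w_def)
    then have "F z = (\<Sum>k. a (k + K) * w ^ (k + K)) + (\<Sum>k<K. a k * w ^ k)"
      using suminf_split_initial_segment[of "\<lambda>k. a k * w ^ k" K] by (simp add: sums_iff)
    then have "norm (F z) \<le> norm (\<Sum>k. a (k + K) * w ^ (k + K)) + norm (\<Sum>k<K. a k * w ^ k)"
      by (simp add: norm_triangle_ineq)
    also have "norm (\<Sum>k. a (k + K) * w ^ (k + K)) \<le> (\<Sum>k. B * q ^ K * q ^ k)"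
    proof (rule norm_suminf_le)
      show "norm (a (k + K) * w ^ (k + K)) \<le> B * q ^ K * q ^ k" for k
        using a2[of "k + K"] by (simp add: power_add mult_ac)
      show "summable (\<lambda>k. B * q ^ K * q ^ k)" using q by (intro summable_mult summable_geometric) auto
    qed
    also have "\<dots> = (M + C0 + 1) * (D * (q ^ K / (1 - q)))"
      using q by (subst suminf_mult) (auto simp: summable_geometric suminf_geometric B_def)
    also have "\<dots> \<le> (M + C0 + 1) * \<epsilon>"
      using K M C0 by (intro mult_left_mono) auto
    also have "norm (\<Sum>k<K. a k * w ^ k) \<le> (\<Sum>k<K. B0 * (2 * \<rho>) ^ k)"
      by (intro sum_norm_le a1)
    finally have "norm (F z) \<le> (M + C0 + 1) * \<epsilon> + (\<Sum>k<K. B0 * (2 * \<rho>) ^ k)" by simp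
    moreover have "norm (f z) \<le> norm (F z) + norm (f z0)"
      using norm_triangle_ineq[of "F z" "f z0"] by (simp add: F_def)
    ultimately show "norm (f z) \<le> C + \<epsilon> * M" using f0 by (simp add: C_def algebra_simps)
  qed
qed

text \<open>The preceding estimate is applied to a logarithm of \<zeta> on the disc about
  \<open>Complex 3 (Im s)\<close> that touches the line \<open>Re = \<alpha>\<close>. Polynomial
  growth bounds its real part there by \<open>2 * ln \<bar>Im s\<bar>\<close> plus a constant, and
  on the unit disc, where \<open>Re \<ge> 2\<close>, that real part is bounded. A bound on the
  modulus of the logarithm controls \<zeta> and 1/\<zeta> at once.\<close>

lemma riemann_zeta_subpolynomial:
  assumes \<alpha>: "- 1/2 \<le> \<alpha>" "\<alpha> \<le> 1/2" and nz: "\<And>s. \<alpha> < Re s \<Longrightarrow> \<bar>Im s\<bar> \<ge> 1 \<Longrightarrow> riemann_zeta s \<noteq> 0"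
    and \<sigma>: "\<alpha> < \<sigma>" "\<sigma> < 3" and \<epsilon>: "\<epsilon> > 0"
  obtains C where "C > 0"
    "\<And>s. \<sigma> \<le> Re s \<Longrightarrow> Re s \<le> 3 \<Longrightarrow> \<bar>Im s\<bar> \<ge> 5 \<Longrightarrow> norm (riemann_zeta s) \<le> C * \<bar>Im s\<bar> powr \<epsilon>"
    "\<And>s. \<sigma> \<le> Re s \<Longrightarrow> Re s \<le> 3 \<Longrightarrow> \<bar>Im s\<bar> \<ge> 5 \<Longrightarrow> norm (1 / riemann_zeta s) \<le> C * \<bar>Im s\<bar> powr \<epsilon>"
proof -
  obtain A where A: "A \<ge> 1"
    "\<And>s. Re s \<ge> - 1/2 \<Longrightarrow> Re s \<le> 7 \<Longrightarrow> \<bar>Im s\<bar> \<ge> 1 \<Longrightarrow> norm (riemann_zeta s) \<le> A * \<bar>Im s\<bar>\<^sup>2"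
    using riemann_zeta_growth by blast
  obtain B where B: "B \<ge> 1" "\<And>s. Re s \<ge> 2 \<Longrightarrow> norm (zeta_series s) \<le> B" "\<And>s. Re s \<ge> 2 \<Longrightarrow> 1 / B \<le> norm (zeta_series s)"
    using zeta_series_two_sided_bound by blast
  \<comment> \<open>\<open>ln B\<close> bounds the real part of the logarithm for
    \<open>Re \<ge> 2\<close>; \<open>pi\<close> bounds the imaginary part at the centre, where the
    logarithm is normalised to its principal value.\<close>
  define C0 where "C0 = ln B + pi"
  have lnB: "ln B \<ge> 0" using B by simp
  have C0: "C0 \<ge> 0" using lnB by (simp add: C0_def)
  have ln_bound: "\<bar>ln (norm (riemann_zeta s))\<bar> \<le> ln B" if "Re s \<ge> 2" for s
  proof -
    have z: "riemann_zeta s = zeta_series s" using that by (simp add: riemann_zeta_eq_series)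
    have pos: "norm (zeta_series s) > 0" using B that by (metis less_le_trans zero_less_divide_1_iff zero_less_one)
    have "ln (norm (zeta_series s)) \<le> ln B" using pos B that by (simp add: ln_le_cancel_iff)
    moreover have "ln (1 / B) \<le> ln (norm (zeta_series s))" using pos B that by (subst ln_le_cancel_iff) auto
    then have "- ln B \<le> ln (norm (zeta_series s))" using B by (simp add: ln_div)
    ultimately show ?thesis unfolding z by linarith
  qed
  define R where "R = 3 - \<alpha>"
  define \<rho> where "\<rho> = 3 - \<sigma>"
  \<comment> \<open>The parameter is \<open>\<epsilon> / 2\<close> because the bound
    \<open>M\<close> below contains \<open>2 * ln \<bar>Im s\<bar>\<close>.\<close>
  obtain C where C: "\<And>f z0 M z. f holomorphic_on ball z0 R \<Longrightarrow> M \<ge> 0 \<Longrightarrow> (\<And>z. z \<in> ball z0 R \<Longrightarrow> Re (f z) \<le> M) \<Longrightarrow>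
     (\<And>z. z \<in> ball z0 1 \<Longrightarrow> \<bar>Re (f z)\<bar> \<le> C0) \<Longrightarrow> norm (f z0) \<le> C0 \<Longrightarrow> z \<in> cball z0 \<rho> \<Longrightarrow> norm (f z) \<le> C + \<epsilon> / 2 * M"
    using holomorphic_bound_by_Re_bound[of \<rho> R "\<epsilon> / 2" C0] \<alpha> \<sigma> \<epsilon> C0 unfolding R_def \<rho>_def by force
  define C1 where "C1 = exp (C + \<epsilon> / 2 * (ln A + 2 * ln 2))"
  have main: "\<bar>ln (norm (riemann_zeta s))\<bar> \<le> C + \<epsilon> / 2 * (ln A + 2 * ln 2) + \<epsilon> * ln \<bar>Im s\<bar> \<and> riemann_zeta s \<noteq> 0"
    if s: "\<sigma> \<le> Re s" "Re s \<le> 3" "\<bar>Im s\<bar> \<ge> 5" for s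
  proof -
    define z0 where "z0 = Complex 3 (Im s)"
    \<comment> \<open>The radius is at most 7/2, so \<open>\<bar>Im s\<bar> \<ge> 5\<close> keeps
      the disc away from the real axis and hence from the pole.\<close>
    have ball: "\<alpha> < Re z \<and> Re z \<le> 7 \<and> \<bar>Im z\<bar> \<ge> 1 \<and> \<bar>Im z\<bar> \<le> 2 * \<bar>Im s\<bar>" if "z \<in> ball z0 R" for z
    proof -
      have "\<bar>Re z - 3\<bar> < R" "\<bar>Im z - Im s\<bar> < R"
        using that abs_Re_le_cmod[of "z0 - z"] abs_Im_le_cmod[of "z0 - z"] by (auto simp: z0_def dist_norm)
      then show ?thesis using \<alpha> s by (auto simp: R_def abs_if split: if_splits)
    qed
    have hol: "riemann_zeta holomorphic_on ball z0 R"
      by (rule holomorphic_on_subset[OF riemann_zeta_holomorphic]) (use ball in force)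
    have nz': "riemann_zeta z \<noteq> 0" if "z \<in> ball z0 R" for z using nz ball[OF that] by blast
    have z0: "z0 \<in> ball z0 R" using \<alpha> by (simp add: R_def)
    obtain l where l: "l holomorphic_on ball z0 R" "\<And>z. z \<in> ball z0 R \<Longrightarrow> exp (l z) = riemann_zeta z"
      using holomorphic_logarithm_exists[OF convex_ball open_ball hol nz' z0] by blast
    define f where "f = (\<lambda>z. l z - l z0 + Ln (riemann_zeta z0))"
    have f: "exp (f z) = riemann_zeta z" if "z \<in> ball z0 R" for z
      unfolding f_def exp_add exp_diff l(2)[OF that] l(2)[OF z0] using nz'[OF z0] by simp
    have Re_f: "Re (f z) = ln (norm (riemann_zeta z))" if "z \<in> ball z0 R" for z
      using f[OF that] by (metis norm_exp_eq_Re ln_exp)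
    define M where "M = ln A + 2 * ln 2 + 2 * ln \<bar>Im s\<bar>"
    have "norm (f s) \<le> C + \<epsilon> / 2 * M"
    proof (rule C[where f = f and z = s and M = M and ?z0.0 = z0])
      show "f holomorphic_on ball z0 R" unfolding f_def by (intro holomorphic_intros l)
      show "M \<ge> 0" unfolding M_def using A s by (intro add_nonneg_nonneg) auto
      show "Re (f z) \<le> M" if z: "z \<in> ball z0 R" for z
      proof -
        have "norm (riemann_zeta z) \<le> A * \<bar>Im z\<bar>\<^sup>2" using ball[OF z] \<alpha> by (intro A) auto
        also have "\<dots> \<le> A * (2 * \<bar>Im s\<bar>)\<^sup>2" using ball[OF z] A by (intro mult_left_mono power_mono) auto
        finally have "ln (norm (riemann_zeta z)) \<le> ln (A * (2 * \<bar>Im s\<bar>)\<^sup>2)"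
          using nz'[OF z] A s by (subst ln_le_cancel_iff) auto
        also have "\<dots> = M"
        proof -
          have "ln (A * (2 * T)\<^sup>2) = ln A + 2 * ln 2 + 2 * ln T" if "T > 0" for T
          proof -
            have "ln (A * (2 * T)\<^sup>2) = ln A + ln ((2 * T) ^ 2)"
              using that A ln_mult_pos[of A "(2 * T)\<^sup>2"] by simp
            also have "ln ((2 * T) ^ 2) = real 2 * ln (2 * T)" by (rule ln_realpow)
            also have "ln (2 * T) = ln 2 + ln T" using that ln_mult_pos[of 2 T] by simp
            finally show ?thesis by simp
          qed
          from this[of "\<bar>Im s\<bar>"] show ?thesis using s by (simp add: M_def)
        qed
        finally show ?thesis by (simp add: Re_f[OF z])
      qed
      show "\<bar>Re (f z)\<bar> \<le> C0" if z: "z \<in> ball z0 1" for z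
      proof -
        have "z \<in> ball z0 R" using z \<alpha> by (auto simp: R_def)
        moreover have "Re z \<ge> 2" using z abs_Re_le_cmod[of "z0 - z"] by (auto simp: z0_def dist_norm)
        ultimately show ?thesis using ln_bound[of z] by (simp add: Re_f C0_def) (use pi_gt_zero in linarith)
      qed
      have "norm (f z0) \<le> \<bar>Re (f z0)\<bar> + \<bar>Im (f z0)\<bar>" by (rule cmod_le)
      also have "\<bar>Re (f z0)\<bar> \<le> ln B" using ln_bound[of z0] by (simp add: Re_f[OF z0]) (simp add: z0_def)
      also have "\<bar>Im (f z0)\<bar> \<le> pi"
        using mpi_less_Im_Ln[OF nz'[OF z0]] Im_Ln_le_pi[OF nz'[OF z0]] by (simp add: f_def)
      finally show "norm (f z0) \<le> C0" by (simp add: C0_def)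
      have "z0 - s = of_real (3 - Re s)" by (simp add: z0_def complex_eq_iff)
      then show "s \<in> cball z0 \<rho>" using s by (simp add: \<rho>_def dist_norm del: of_real_diff)
    qed
    moreover have s_ball: "s \<in> ball z0 R"
    proof -
      have "z0 - s = of_real (3 - Re s)" by (simp add: z0_def complex_eq_iff)
      then show ?thesis using s \<sigma> by (simp add: R_def dist_norm del: of_real_diff)
    qed
    moreover have "\<bar>Re (f s)\<bar> \<le> norm (f s)" by (rule abs_Re_le_cmod)
    ultimately show ?thesis using nz'[OF s_ball] by (simp add: Re_f M_def algebra_simps)
  qed
  have pw: "exp (C + \<epsilon> / 2 * (ln A + 2 * ln 2) + \<epsilon> * ln \<bar>Im s\<bar>) = C1 * \<bar>Im s\<bar> powr \<epsilon>" if "\<bar>Im s\<bar> \<ge> 5" for s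
    using that by (auto simp: C1_def exp_add powr_def)
  show ?thesis
  proof (rule that[of C1])
    show "C1 > 0" by (simp add: C1_def)
    fix s assume s: "\<sigma> \<le> Re s" "Re s \<le> 3" "\<bar>Im s\<bar> \<ge> 5"
    have n: "norm (riemann_zeta s) > 0" using main[OF s] by simp
    have "exp (ln (norm (riemann_zeta s))) \<le> exp (C + \<epsilon> / 2 * (ln A + 2 * ln 2) + \<epsilon> * ln \<bar>Im s\<bar>)"
      using main[OF s] by (simp only: exp_le_cancel_iff) linarith
    then show "norm (riemann_zeta s) \<le> C1 * \<bar>Im s\<bar> powr \<epsilon>" using n by (simp only: pw[OF s(3)] exp_ln)
    have "exp (- ln (norm (riemann_zeta s))) \<le> exp (C + \<epsilon> / 2 * (ln A + 2 * ln 2) + \<epsilon> * ln \<bar>Im s\<bar>)"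
      using main[OF s] by (simp only: exp_le_cancel_iff) linarith
    moreover have "exp (- ln (norm (riemann_zeta s))) = norm (1 / riemann_zeta s)"
      using n by (simp add: exp_minus norm_inverse divide_inverse)
    ultimately show "norm (1 / riemann_zeta s) \<le> C1 * \<bar>Im s\<bar> powr \<epsilon>" by (simp only: pw[OF s(3)])
  qed
qed

section \<open>Existence of a zero in the critical strip\<close>

text \<open>On the imaginary axis the reflection formula gives the modulus of Gamma exactly: the
  square of |Gamma(1 - it)| is pi t / sinh(pi t). What remains is t / (2 pi) times tanh(pi t / 2),
  and the hyperbolic tangent is at least 1/2 for \<open>t \<ge> 1\<close>.\<close>

lemma norm_zeta_chi_imaginary_axis:
  assumes t: "t \<ge> 1"
  shows "(norm (zeta_chi (\<i> * of_real t)))\<^sup>2 \<ge> t / (4 * pi)"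
proof -
  define y where "y = pi * t / 2"
  have y: "y > 0" using t by (simp add: y_def)
  define S where "S = sin (of_real pi * (\<i> * of_real t) / 2)"
  define K where "K = cos (of_real pi * (\<i> * of_real t) / 2)"
  have arg: "of_real pi * (\<i> * of_real t) / 2 = \<i> * of_real y" by (simp add: y_def)
  have S_norm: "norm S = (exp y - exp (- y)) / 2"
  proof -
    have "S = \<i> * of_real ((exp y - exp (- y)) / 2)"
      unfolding S_def arg sin_exp_eq by (simp add: exp_of_real[symmetric] field_simps flip: exp_of_real)
    then have "norm S = \<bar>(exp y - exp (- y)) / 2\<bar>" by (simp only: norm_mult norm_ii norm_of_real mult_1)
    then show ?thesis using y by simp
  qed
  have K_norm: "norm K = (exp y + exp (- y)) / 2"
  proof -
    have "K = of_real ((exp y + exp (- y)) / 2)"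
      unfolding K_def arg cos_exp_eq by (simp add: field_simps flip: exp_of_real)
    then have "norm K = \<bar>(exp y + exp (- y)) / 2\<bar>" by (simp only: norm_of_real)
    then show ?thesis by (simp add: add_nonneg_nonneg)
  qed
  have S_pos: "norm S > 0" and K_pos: "norm K > 0" using y by (simp_all add: S_norm K_norm add_pos_pos)
  have SK: "norm S \<ge> norm K / 2"
  proof -
    have "y \<ge> 3 / 2" using t pi_gt3 mult_mono[of 3 pi 1 t] by (simp add: y_def)
    then have "2 * y \<ge> 2" by simp
    then have "exp (2 * y) \<ge> 3" using exp_ge_add_one_self[of "2 * y"] by linarith
    then have "exp y * exp y \<ge> 3" by (simp add: exp_add[symmetric])
    then have "exp y * exp y * exp (- y) \<ge> 3 * exp (- y)" by (intro mult_right_mono) auto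
    then have "exp y \<ge> 3 * exp (- y)" by (simp add: exp_minus field_simps)
    then show ?thesis by (simp add: S_norm K_norm)
  qed
  have Gam: "(norm (Gamma (1 - \<i> * of_real t)))\<^sup>2 = pi * t / (2 * norm S * norm K)"
  proof -
    have "cnj (Gamma (1 - \<i> * of_real t)) = Gamma (1 + \<i> * of_real t)" by (simp add: cnj_Gamma)
    then have "norm (Gamma (1 - \<i> * of_real t)) = norm (Gamma (1 + \<i> * of_real t))" by (metis complex_mod_cnj)
    then have "(norm (Gamma (1 - \<i> * of_real t)))\<^sup>2 = norm (Gamma (1 + \<i> * of_real t) * Gamma (1 - \<i> * of_real t))"
      by (simp add: norm_mult power2_eq_square)
    also have "Gamma (1 + \<i> * of_real t) = \<i> * of_real t * Gamma (\<i> * of_real t)"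
    proof -
      have "\<i> * of_real t \<notin> \<int>\<^sub>\<le>\<^sub>0" using t by (auto elim!: nonpos_Ints_cases simp: complex_eq_iff)
      then show ?thesis using Gamma_plus1[of "\<i> * of_real t"] by (simp add: add.commute)
    qed
    also have "\<i> * of_real t * Gamma (\<i> * of_real t) * Gamma (1 - \<i> * of_real t) =
        \<i> * of_real t * (of_real pi / sin (of_real pi * (\<i> * of_real t)))"
      using Gamma_reflection_complex[of "\<i> * of_real t"] by (simp add: mult.assoc)
    also have "sin (of_real pi * (\<i> * of_real t)) = 2 * S * K"
      using sin_double[of "of_real pi * (\<i> * of_real t) / 2"] by (simp add: S_def K_def)
    also have "norm (\<i> * of_real t * (of_real pi / (2 * S * K))) = pi * t / (2 * norm S * norm K)"
      using t by (simp add: norm_mult norm_divide)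
    finally show ?thesis .
  qed
  have "norm ((2 :: complex) powr (\<i> * of_real t)) = 1"
    using norm_powr_real_powr[of 2 "\<i> * of_real t"] by simp
  moreover have "norm (of_real pi powr (\<i> * of_real t - 1) :: complex) = 1 / pi"
    using norm_powr_real_powr[of "of_real pi" "\<i> * of_real t - 1"] by (simp add: powr_minus divide_inverse)
  ultimately have "(norm (zeta_chi (\<i> * of_real t)))\<^sup>2 = (1 / pi)\<^sup>2 * (norm S)\<^sup>2 * (norm (Gamma (1 - \<i> * of_real t)))\<^sup>2"
    unfolding zeta_chi_def S_def by (simp add: norm_mult power_mult_distrib power_divide)
  also have "\<dots> = t / (2 * pi) * (norm S / norm K)"
    unfolding Gam using S_pos K_pos by (simp add: power2_eq_square field_simps)
  also have "\<dots> \<ge> t / (2 * pi) * (1 / 2)"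
    using SK K_pos t by (intro mult_left_mono) (auto simp: field_simps)
  finally show ?thesis by simp
qed

text \<open>Without zeros in the strip, the functional equation carries nonvanishing over to
  \<open>Re s > - 1/2\<close> off the real axis, so the growth estimate covers the lines
  \<open>Re s = 0\<close> and \<open>Re s = 1\<close> together. But on the imaginary axis the ratio
  of \<open>\<zeta> s\<close> and \<open>\<zeta> (1 - s)\<close> is \<open>zeta_chi s\<close>, of
  order at least the square root of the height.\<close>

theorem riemann_zeta_has_nontrivial_zero:
  obtains s where "0 < Re s" "Re s < 1" "riemann_zeta s = 0"
proof (rule ccontr)
  assume "\<not> thesis"
  with that have strip: "riemann_zeta s \<noteq> 0" if "0 < Re s" "Re s < 1" for s using that by blast
  have right: "riemann_zeta s \<noteq> 0" if "0 < Re s" "Im s \<noteq> 0" for s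
  proof -
    have "s \<noteq> 1" using that by auto
    then show ?thesis
      using strip[of s] riemann_zeta_nonzero_of_Re_ge_1[of s] that by (cases "Re s < 1") auto
  qed
  have nz: "riemann_zeta s \<noteq> 0" if "- 1/2 < Re s" "\<bar>Im s\<bar> \<ge> 1" for s
  proof (cases "Re s > 0")
    case False
    have "s \<noteq> 0" "Im s \<noteq> 0" using that by auto
    then have "riemann_zeta s = zeta_chi s * riemann_zeta (1 - s)" using False by (intro riemann_zeta_functional_equation) auto
    moreover have "riemann_zeta (1 - s) \<noteq> 0" using \<open>Im s \<noteq> 0\<close> False by (intro right) auto
    ultimately show ?thesis using zeta_chi_nonzero[of s] \<open>Im s \<noteq> 0\<close> False by auto
  qed (use right that in auto)
  \<comment> \<open>With the exponent 1/8 for \<zeta> and for 1/\<zeta>, the square of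
    \<open>norm (zeta_chi s)\<close> is at most a constant times \<open>t powr (1/2)\<close>, which
    loses against linear growth.\<close>
  obtain C where C: "C > 0"
    "\<And>s. - 1/4 \<le> Re s \<Longrightarrow> Re s \<le> 3 \<Longrightarrow> \<bar>Im s\<bar> \<ge> 5 \<Longrightarrow> norm (riemann_zeta s) \<le> C * \<bar>Im s\<bar> powr (1/8)"
    "\<And>s. - 1/4 \<le> Re s \<Longrightarrow> Re s \<le> 3 \<Longrightarrow> \<bar>Im s\<bar> \<ge> 5 \<Longrightarrow> norm (1 / riemann_zeta s) \<le> C * \<bar>Im s\<bar> powr (1/8)"
    using riemann_zeta_subpolynomial[of "- 1/2" "- 1/4" "1/8"] nz by auto
  have "t / (4 * pi) \<le> C ^ 4 * t powr (1/2)" if t: "t \<ge> 5" for t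
  proof -
    define s where "s = \<i> * complex_of_real t"
    have s0: "s \<noteq> 0" using t by (simp add: s_def)
    have z1: "riemann_zeta (1 - s) \<noteq> 0" using t by (intro right) (auto simp: s_def)
    have "riemann_zeta s = zeta_chi s * riemann_zeta (1 - s)"
      using s0 by (intro riemann_zeta_functional_equation) (auto simp: s_def)
    then have "zeta_chi s = riemann_zeta s * (1 / riemann_zeta (1 - s))" using z1 by simp
    then have "norm (zeta_chi s) = norm (riemann_zeta s) * norm (1 / riemann_zeta (1 - s))" by (metis norm_mult)
    also have "\<dots> \<le> (C * t powr (1/8)) * (C * t powr (1/8))"
      using C(2)[of s] C(3)[of "1 - s"] t C(1) by (intro mult_mono) (auto simp: s_def)
    finally have "(norm (zeta_chi s))\<^sup>2 \<le> ((C * t powr (1/8)) * (C * t powr (1/8)))\<^sup>2"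
      by (rule power_mono) auto
    also have "\<dots> = C ^ 4 * (t powr (1/8)) ^ 4" by (simp add: power2_eq_square power4_eq_xxxx)
    also have "(t powr (1/8)) ^ 4 = t powr (1/2)" using t by (simp add: powr_power)
    finally show ?thesis using norm_zeta_chi_imaginary_axis[of t] t by (simp add: s_def)
  qed
  then have "eventually (\<lambda>t. t / (4 * pi) \<le> C ^ 4 * t powr (1/2)) at_top"
    by (auto simp: eventually_at_top_linorder)
  moreover have "eventually (\<lambda>t. t / (4 * pi) > C ^ 4 * t powr (1/2)) at_top"
    using C(1) by real_asymp
  ultimately have "eventually (\<lambda>t::real. False) at_top"
    by eventually_elim linarith
  then show False by simp
qed

section \<open>Littlewood's bound for the partial sums under the Riemann hypothesis\<close>

lemma norm_of_real_powr: "y > 0 \<Longrightarrow> norm (of_real y powr w :: complex) = y powr Re w"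
  using norm_powr_real_powr[of "of_real y" w] by simp

lemma norm_contour_integral_linepath_le:
  assumes "continuous_on (closed_segment a b) f" "\<And>z. z \<in> closed_segment a b \<Longrightarrow> norm (f z) \<le> B" "norm (b - a) \<le> l"
  shows "norm (contour_integral (linepath a b) f) \<le> B * l"
proof -
  have B: "B \<ge> 0" using assms(2)[of a] norm_ge_zero[of "f a"] by (auto simp del: norm_ge_zero)
  have "norm (contour_integral (linepath a b) f) \<le> B * norm (b - a)"
    using assms B by (intro contour_integral_bound_linepath contour_integrable_continuous_linepath)
  also have "\<dots> \<le> B * l" using B assms(3) by (rule mult_left_mono[rotated])
  finally show ?thesis .
qed

lemma rectpath_integral_sides:
  assumes "(f has_contour_integral i) (rectpath (Complex a c) (Complex b d))"
  shows "contour_integral (linepath (Complex a c) (Complex b c)) f +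
         contour_integral (linepath (Complex b c) (Complex b d)) f +
         contour_integral (linepath (Complex b d) (Complex a d)) f +
         contour_integral (linepath (Complex a d) (Complex a c)) f = i"
  using assms unfolding rectpath_def Let_def by (intro has_chain_integral_chain_integral4) simp

text \<open>The integral of \<open>u powr (w - 1)\<close> over \<open>[y0, y1]\<close>, extended
  continuously to \<open>w = 0\<close>. It replaces the numerator \<open>y powr w\<close> of
  Perron's integral by an integral against du/u and gains a factor of size 1/|w|.\<close>

definition pow_quot :: "real \<Rightarrow> real \<Rightarrow> complex \<Rightarrow> complex" where
  "pow_quot y0 y1 w = (if w = 0 then of_real (ln y1 - ln y0) else (of_real y1 powr w - of_real y0 powr w) / w)"

lemma pow_quot_holomorphic:
  assumes "y0 > 0" "y1 > 0"
  shows "pow_quot y0 y1 holomorphic_on S"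
proof -
  define G where "G = (\<lambda>w. complex_of_real y1 powr w - of_real y0 powr w)"
  have G: "G holomorphic_on UNIV" unfolding G_def using assms by (intro holomorphic_intros) auto
  have "(G has_field_derivative Ln (of_real y1) * of_real y1 powr 0 - Ln (of_real y0) * of_real y0 powr 0) (at 0)"
    unfolding G_def using assms by (intro DERIV_diff has_field_derivative_powr_right) auto
  then have dG: "deriv G 0 = of_real (ln y1 - ln y0)"
    using assms by (simp add: DERIV_imp_deriv Ln_of_real)
  have "(\<lambda>z. if z = 0 then deriv G 0 else G z / z - G 0 / (z - 0)) holomorphic_on UNIV"
    using G by (intro pole_theorem_open) auto
  moreover have "G z / z - G 0 / (z - 0) = (of_real y1 powr z - of_real y0 powr z) / z" for z
    using assms by (simp add: G_def)
  ultimately have "pow_quot y0 y1 holomorphic_on UNIV"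
    unfolding pow_quot_def[abs_def] dG by (simp only:)
  then show ?thesis by (rule holomorphic_on_subset) auto
qed

lemma norm_pow_quot_le:
  assumes "y0 > 0" "y1 > 0" "w \<noteq> 0"
  shows "norm (pow_quot y0 y1 w) \<le> (y0 powr Re w + y1 powr Re w) / norm w"
proof -
  have "norm (pow_quot y0 y1 w) = norm (of_real y1 powr w - of_real y0 powr w :: complex) / norm w"
    using assms by (simp add: pow_quot_def norm_divide)
  also have "norm (of_real y1 powr w - of_real y0 powr w :: complex) \<le> y0 powr Re w + y1 powr Re w"
    using norm_triangle_ineq4[of "of_real y1 powr w" "of_real y0 powr w :: complex"] assms
    by (simp add: norm_of_real_powr)
  finally show ?thesis by (simp add: divide_right_mono)
qed

text \<open>Close the contour to the left around the pole at 0 if \<open>y0 \<ge> 1\<close>, to the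
  right if \<open>y1 \<le> 1\<close>; on the chosen side the powers of \<open>y0\<close> and
  \<open>y1\<close> are at most \<open>y1\<close>. The three other sides have length at most
  \<open>2 * T\<close> and carry an integrand of size \<open>2 * y1 / T\<^sup>2\<close>, hence the
  constant 12. The disjunction in the hypotheses keeps the jump of Perron's step function at 1 out
  of the interior of \<open>[y0, y1]\<close>.\<close>

lemma perron_kernel:
  assumes y: "0 < y0" "y0 \<le> y1" "1 \<le> y0 \<or> y1 \<le> 1" and T: "T \<ge> 1"
  shows "norm (contour_integral (linepath (Complex 1 (- T)) (Complex 1 T)) (\<lambda>w. pow_quot y0 y1 w / w)
     - 2 * of_real pi * \<i> * (if 1 \<le> y0 then of_real (ln y1 - ln y0) else 0)) \<le> 12 * y1 / T"
proof -
  let ?h = "\<lambda>w. pow_quot y0 y1 w / w"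
  have cont: "continuous_on S ?h" if "0 \<notin> S" for S
    using that pow_quot_holomorphic[of y0 y1 S] y
    by (intro continuous_on_divide holomorphic_on_imp_continuous_on) auto
  have bound: "norm (?h w) \<le> 2 * y1 / T\<^sup>2" if "norm w \<ge> T" and p: "y0 powr Re w \<le> y1" "y1 powr Re w \<le> y1" for w
  proof -
    have w: "w \<noteq> 0" using that T by auto
    have "norm (?h w) \<le> (y0 powr Re w + y1 powr Re w) / norm w / norm w"
      unfolding norm_divide using norm_pow_quot_le[of y0 y1 w] y w by (intro divide_right_mono) auto
    also have "\<dots> = (y0 powr Re w + y1 powr Re w) / (norm w)\<^sup>2" by (simp add: power2_eq_square)
    also have "\<dots> \<le> (y1 + y1) / T\<^sup>2"
      using that T y by (intro frac_le add_mono power_mono) auto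
    finally show ?thesis by simp
  qed
  have tot: "2 * y1 / T\<^sup>2 * (2 * T) = 4 * y1 / T" using T by (simp add: power2_eq_square field_simps)
  show ?thesis
  proof (cases "1 \<le> y0")
    case True
    let ?R = "rectpath (Complex (- T) (- T)) (Complex 1 T)"
    have p: "y0 powr Re w \<le> y1" "y1 powr Re w \<le> y1" if "Re w \<le> 1" for w
      using powr_mono[of "Re w" 1 y0] powr_mono[of "Re w" 1 y1] that True y by auto
    have "0 \<notin> path_image ?R" using T by (subst path_image_rectpath) auto
    moreover have "0 \<in> box (Complex (- T) (- T)) (Complex 1 T)"
      using T by (simp add: in_box_complex_iff)
    ultimately have "((\<lambda>w. pow_quot y0 y1 w / (w - 0)) has_contour_integral
        (2 * pi * \<i> * winding_number ?R 0 * pow_quot y0 y1 0)) ?R"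
      using y by (intro Cauchy_integral_formula_convex_simple[of UNIV] pow_quot_holomorphic) auto
    then have R: "(?h has_contour_integral (2 * of_real pi * \<i> * of_real (ln y1 - ln y0))) ?R"
      using winding_number_rectpath[OF \<open>0 \<in> box _ _\<close>] by (simp add: pow_quot_def)
    have "norm (contour_integral (linepath (Complex (- T) (- T)) (Complex 1 (- T))) ?h) \<le> 2 * y1 / T\<^sup>2 * (2 * T)"
    proof (rule norm_contour_integral_linepath_le)
      show "continuous_on (closed_segment (Complex (- T) (- T)) (Complex 1 (- T))) ?h"
        using T by (intro cont) (auto simp: closed_segment_same_Im)
      fix w assume "w \<in> closed_segment (Complex (- T) (- T)) (Complex 1 (- T))"
      then have w: "Im w = - T" "Re w \<le> 1" using T by (auto simp: closed_segment_same_Im closed_segment_eq_real_ivl)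
      then show "norm (?h w) \<le> 2 * y1 / T\<^sup>2"
        using abs_Im_le_cmod[of w] T by (intro bound p) auto
    next
      have "Complex 1 (- T) - Complex (- T) (- T) = of_real (1 + T)" by (simp add: complex_eq_iff)
      then show "norm (Complex 1 (- T) - Complex (- T) (- T)) \<le> 2 * T" using T by (simp del: of_real_add)
    qed
    moreover have "norm (contour_integral (linepath (Complex 1 T) (Complex (- T) T)) ?h) \<le> 2 * y1 / T\<^sup>2 * (2 * T)"
    proof (rule norm_contour_integral_linepath_le)
      show "continuous_on (closed_segment (Complex 1 T) (Complex (- T) T)) ?h"
        using T by (intro cont) (auto simp: closed_segment_same_Im)
      fix w assume "w \<in> closed_segment (Complex 1 T) (Complex (- T) T)"
      then have w: "Im w = T" "Re w \<le> 1" using T by (auto simp: closed_segment_same_Im closed_segment_eq_real_ivl)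
      then show "norm (?h w) \<le> 2 * y1 / T\<^sup>2"
        using abs_Im_le_cmod[of w] T by (intro bound p) auto
    next
      have "Complex (- T) T - Complex 1 T = of_real (- 1 - T)" by (simp add: complex_eq_iff)
      then show "norm (Complex (- T) T - Complex 1 T) \<le> 2 * T" using T by (simp only: norm_of_real; simp)
    qed
    moreover have "norm (contour_integral (linepath (Complex (- T) T) (Complex (- T) (- T))) ?h) \<le> 2 * y1 / T\<^sup>2 * (2 * T)"
    proof (rule norm_contour_integral_linepath_le)
      show "continuous_on (closed_segment (Complex (- T) T) (Complex (- T) (- T))) ?h"
        using T by (intro cont) (auto simp: closed_segment_same_Re)
      fix w assume "w \<in> closed_segment (Complex (- T) T) (Complex (- T) (- T))"
      then have w: "Re w = - T" using T by (auto simp: closed_segment_same_Re)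
      then show "norm (?h w) \<le> 2 * y1 / T\<^sup>2"
        using abs_Re_le_cmod[of w] T by (intro bound p) auto
    next
      have "Complex (- T) (- T) - Complex (- T) T = \<i> * of_real (- 2 * T)" by (simp add: complex_eq_iff)
      then show "norm (Complex (- T) (- T) - Complex (- T) T) \<le> 2 * T" using T by (simp only: norm_mult norm_of_real norm_ii; simp)
    qed
    moreover define J where "J = contour_integral (linepath (Complex 1 (- T)) (Complex 1 T)) ?h"
    moreover have "J - 2 * of_real pi * \<i> * of_real (ln y1 - ln y0) =
        - (contour_integral (linepath (Complex (- T) (- T)) (Complex 1 (- T))) ?h +
           contour_integral (linepath (Complex 1 T) (Complex (- T) T)) ?h +
           contour_integral (linepath (Complex (- T) T) (Complex (- T) (- T))) ?h)"
      using rectpath_integral_sides[OF R] by (simp add: J_def algebra_simps)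
    ultimately show ?thesis
      unfolding tot using True norm_triangle_ineq norm_minus_cancel
      by (smt (verit) add_divide_distrib)
  next
    case False
    with y have y1: "y1 \<le> 1" by auto
    let ?R = "rectpath (Complex 1 (- T)) (Complex (1 + T) T)"
    have p: "y0 powr Re w \<le> y1" "y1 powr Re w \<le> y1" if "Re w \<ge> 1" for w
      using powr_mono'[of 1 "Re w" y0] powr_mono'[of 1 "Re w" y1] that False y y1 by auto
    have R: "(?h has_contour_integral 0) ?R"
    proof (rule Cauchy_theorem_convex_simple)
      show "?h holomorphic_on {w. Re w > 0}"
        using y by (intro holomorphic_intros pow_quot_holomorphic) auto
      show "path_image ?R \<subseteq> {w. Re w > 0}"
        using T by (subst path_image_rectpath) auto
    qed (auto intro: convex_halfspace_Re_gt)
    have "norm (contour_integral (linepath (Complex 1 (- T)) (Complex (1 + T) (- T))) ?h) \<le> 2 * y1 / T\<^sup>2 * (2 * T)"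
    proof (rule norm_contour_integral_linepath_le)
      show "continuous_on (closed_segment (Complex 1 (- T)) (Complex (1 + T) (- T))) ?h"
        using T by (intro cont) (auto simp: closed_segment_same_Im)
      fix w assume "w \<in> closed_segment (Complex 1 (- T)) (Complex (1 + T) (- T))"
      then have w: "Im w = - T" "Re w \<ge> 1" using T by (auto simp: closed_segment_same_Im closed_segment_eq_real_ivl)
      then show "norm (?h w) \<le> 2 * y1 / T\<^sup>2"
        using abs_Im_le_cmod[of w] T by (intro bound p) auto
    next
      have "Complex (1 + T) (- T) - Complex 1 (- T) = of_real T" by (simp add: complex_eq_iff)
      then show "norm (Complex (1 + T) (- T) - Complex 1 (- T)) \<le> 2 * T" using T by simp
    qed
    moreover have "norm (contour_integral (linepath (Complex (1 + T) T) (Complex 1 T)) ?h) \<le> 2 * y1 / T\<^sup>2 * (2 * T)"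
    proof (rule norm_contour_integral_linepath_le)
      show "continuous_on (closed_segment (Complex (1 + T) T) (Complex 1 T)) ?h"
        using T by (intro cont) (auto simp: closed_segment_same_Im)
      fix w assume "w \<in> closed_segment (Complex (1 + T) T) (Complex 1 T)"
      then have w: "Im w = T" "Re w \<ge> 1" using T by (auto simp: closed_segment_same_Im closed_segment_eq_real_ivl)
      then show "norm (?h w) \<le> 2 * y1 / T\<^sup>2"
        using abs_Im_le_cmod[of w] T by (intro bound p) auto
    next
      have "Complex 1 T - Complex (1 + T) T = of_real (- T)" by (simp add: complex_eq_iff)
      then show "norm (Complex 1 T - Complex (1 + T) T) \<le> 2 * T" using T by (simp only: norm_of_real; simp)
    qed
    moreover have "norm (contour_integral (linepath (Complex (1 + T) (- T)) (Complex (1 + T) T)) ?h) \<le> 2 * y1 / T\<^sup>2 * (2 * T)"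
    proof (rule norm_contour_integral_linepath_le)
      show "continuous_on (closed_segment (Complex (1 + T) (- T)) (Complex (1 + T) T)) ?h"
        using T by (intro cont) (auto simp: closed_segment_same_Re)
      fix w assume "w \<in> closed_segment (Complex (1 + T) (- T)) (Complex (1 + T) T)"
      then have w: "Re w = 1 + T" using T by (auto simp: closed_segment_same_Re)
      then show "norm (?h w) \<le> 2 * y1 / T\<^sup>2"
        using abs_Re_le_cmod[of w] T by (intro bound p) auto
    next
      have "Complex (1 + T) T - Complex (1 + T) (- T) = \<i> * of_real (2 * T)" by (simp add: complex_eq_iff)
      then show "norm (Complex (1 + T) T - Complex (1 + T) (- T)) \<le> 2 * T" using T by (simp only: norm_mult norm_of_real norm_ii; simp)
    qed
    moreover define J where "J = contour_integral (linepath (Complex 1 (- T)) (Complex 1 T)) ?h"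
    moreover have "contour_integral (linepath (Complex 1 T) (Complex 1 (- T))) ?h = - J"
    proof -
      have "continuous_on (closed_segment (Complex 1 T) (Complex 1 (- T))) ?h"
        using T by (intro cont) (auto simp: closed_segment_same_Re)
      then show ?thesis unfolding J_def by (rule contour_integral_reverse_linepath)
    qed
    then have "J = contour_integral (linepath (Complex 1 (- T)) (Complex (1 + T) (- T))) ?h +
           contour_integral (linepath (Complex (1 + T) T) (Complex 1 T)) ?h +
           contour_integral (linepath (Complex (1 + T) (- T)) (Complex (1 + T) T)) ?h"
      using rectpath_integral_sides[OF R] by (simp add: algebra_simps)
    ultimately show ?thesis
      unfolding tot using False norm_triangle_ineq
      by (smt (verit) add_divide_distrib mult_zero_right diff_zero)
  qed
qed

lemma g_of_nat_eq_sum: "complex_of_real (g (real N)) = (\<Sum>n<N. of_int (moebius_mu (Suc n)) / of_nat (Suc n))"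
proof -
  have "{n. 1 \<le> n \<and> real n \<le> real N} = Suc ` {..<N}" by (auto simp: image_iff gr0_conv_Suc Suc_le_eq)
  then have "g (real N) = (\<Sum>n<N. real_of_int (moebius_mu (Suc n)) / real (Suc n))"
    unfolding g_def by (simp add: sum.reindex)
  then show ?thesis by (simp del: of_nat_Suc)
qed

text \<open>Integrate Perron's formula against du/u over \<open>[N, N + 1]\<close>, where the
  partial sum keeps the value \<open>g N\<close>. No integer lies strictly between the end points,
  so each rescaled interval from \<open>N / n\<close> to \<open>(N + 1) / n\<close> meets the
  hypothesis of \<open>perron_kernel\<close>. The constant may depend on \<open>N\<close>, as
  \<open>T\<close> alone goes to infinity later.\<close>

lemma perron_g:
  assumes N: "N \<ge> 1"
  obtains K where "\<And>T. T \<ge> 1 \<Longrightarrow>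
    norm (contour_integral (linepath (Complex 1 (- T)) (Complex 1 T))
       (\<lambda>w. pow_quot (real N) (real N + 1) w / (w * riemann_zeta (1 + w)))
     - 2 * of_real pi * \<i> * of_real (ln (real N + 1) - ln (real N)) * of_real (g (real N))) \<le> K / T"
proof -
  define c where "c = (\<lambda>n. of_int (moebius_mu (Suc n)) / of_nat (Suc n) :: complex)"
  have c: "norm (c n) \<le> 1 / real (Suc n)" for n
  proof -
    have "norm (of_int (moebius_mu (Suc n)) :: complex) \<le> 1" by (rule norm_moebius_mu_le)
    then show ?thesis by (simp add: c_def norm_divide divide_right_mono del: of_nat_Suc)
  qed
  define y0 where "y0 = (\<lambda>n. real N / real (Suc n))"
  define y1 where "y1 = (\<lambda>n. (real N + 1) / real (Suc n))"
  have y: "0 < y0 n" "y0 n \<le> y1 n" "1 \<le> y0 n \<or> y1 n \<le> 1" for n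
  proof -
    show "0 < y0 n" "y0 n \<le> y1 n" using N by (auto simp: y0_def y1_def divide_right_mono)
    consider "Suc n \<le> N" | "N + 1 \<le> Suc n" by linarith
    then show "1 \<le> y0 n \<or> y1 n \<le> 1"
    proof cases
      case 1
      then have "real (Suc n) \<le> real N" by (rule of_nat_mono)
      then show ?thesis by (simp add: y0_def)
    next
      case 2
      then have "real (N + 1) \<le> real (Suc n)" by (rule of_nat_mono)
      then show ?thesis by (simp add: y1_def)
    qed
  qed
  have y0_iff: "1 \<le> y0 n \<longleftrightarrow> n < N" for n
    by (simp add: y0_def) (metis less_eq_Suc_le of_nat_Suc of_nat_le_iff add.commute)
  define f where "f = (\<lambda>n w. c n * (pow_quot (y0 n) (y1 n) w / w))"
  \<comment> \<open>Majorant on the line \<open>Re w = 1\<close>: one factor \<open>1 / n\<close>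
    comes from the coefficient and one from \<open>y1 n\<close>, so the series may be integrated
    term by term along the segment.\<close>
  define B where "B = (\<lambda>n. 2 * (real N + 1) * (1 / (real (Suc n))\<^sup>2))"
  have sq: "summable (\<lambda>n. 1 / (real (Suc n))\<^sup>2)"
    using inverse_power_summable[of 2, where 'a = real] by (subst summable_Suc_iff) (simp add: field_simps)
  have B: "summable B" unfolding B_def by (intro summable_mult sq)
  define L where "L = ln (real N + 1) - ln (real N)"
  define K where "K = (\<Sum>n. 12 * (real N + 1) * (1 / (real (Suc n))\<^sup>2))"
  show ?thesis
  proof (rule that[of K])
    fix T :: real assume T: "T \<ge> 1"
    let ?a = "Complex 1 (- T)" and ?b = "Complex 1 T"
    have seg: "Re w = 1" if "w \<in> closed_segment ?a ?b" for w
      using that T by (auto simp: closed_segment_same_Re)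
    have cont: "continuous_on (closed_segment ?a ?b) (\<lambda>w. pow_quot (y0 n) (y1 n) w / w)" for n
      using y[of n] seg by (intro continuous_on_divide continuous_on_id holomorphic_on_imp_continuous_on pow_quot_holomorphic)
         (auto dest!: seg)
    have ub: "norm (f n w) \<le> B n" if "w \<in> closed_segment ?a ?b" for n w
    proof -
      have w: "Re w = 1" "w \<noteq> 0" "norm w \<ge> 1" using seg[OF that] abs_Re_le_cmod[of w] by auto
      have "norm (pow_quot (y0 n) (y1 n) w) \<le> (y0 n powr Re w + y1 n powr Re w) / norm w"
        using y[of n] w by (intro norm_pow_quot_le) auto
      also have "\<dots> = (y0 n + y1 n) / norm w" using w y[of n] by simp
      also have "\<dots> \<le> (y1 n + y1 n) / 1" using w y[of n] by (intro frac_le add_mono) auto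
      finally have p: "norm (pow_quot (y0 n) (y1 n) w) \<le> 2 * y1 n" by simp
      have "norm (f n w) = norm (c n) * (norm (pow_quot (y0 n) (y1 n) w) / norm w)"
        by (simp add: f_def norm_mult norm_divide)
      also have "\<dots> \<le> (1 / real (Suc n)) * (2 * y1 n / 1)"
        using w p c[of n] y[of n] by (intro mult_mono frac_le) auto
      also have "\<dots> = B n" by (simp add: y1_def B_def power2_eq_square)
      finally show ?thesis .
    qed
    have contf: "continuous_on (closed_segment ?a ?b) (f n)" for n
      unfolding f_def by (intro continuous_on_mult continuous_on_const cont)
    define S where "S = (\<lambda>w. \<Sum>n. f n w)"
    have "uniform_limit (closed_segment ?a ?b) (\<lambda>m w. \<Sum>n<m. f n w) S sequentially"
      unfolding S_def by (rule Weierstrass_m_test[OF ub B])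
    then obtain J where J: "(S has_contour_integral J) (linepath ?a ?b)"
        "(\<lambda>n. contour_integral (linepath ?a ?b) (f n)) sums J"
      by (rule contour_integral_sums_linepath) (use contf in auto)
    have S: "S w = pow_quot (real N) (real N + 1) w / (w * riemann_zeta (1 + w))" if "w \<in> closed_segment ?a ?b" for w
    proof -
      have w: "Re w = 1" "w \<noteq> 0" using seg[OF that] by auto
      have fn: "f n w = (of_int (moebius_mu (Suc n)) / of_nat (Suc n) powr (1 + w)) * (pow_quot (real N) (real N + 1) w / w)" for n
      proof -
        have q: "of_real (t / real (Suc n)) powr w = of_real t powr w / of_nat (Suc n) powr w" if "t > 0" for t
        proof -
          have "complex_of_real t powr w = (of_real (t / real (Suc n)) * of_nat (Suc n)) powr w"
            by (simp del: of_nat_Suc)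
          also have "\<dots> = of_real (t / real (Suc n)) powr w * of_nat (Suc n) powr w"
            using that by (intro powr_times_real) auto
          finally show ?thesis by (simp del: of_nat_Suc)
        qed
        have "pow_quot (y0 n) (y1 n) w = pow_quot (real N) (real N + 1) w / of_nat (Suc n) powr w"
          unfolding pow_quot_def y0_def y1_def using w N q[of "real N"] q[of "real N + 1"]
          by (simp add: diff_divide_distrib mult.commute del: of_nat_Suc)
        moreover have "(of_nat (Suc n) :: complex) powr (1 + w) = of_nat (Suc n) * of_nat (Suc n) powr w"
          by (simp add: powr_add del: of_nat_Suc)
        ultimately show ?thesis by (simp add: f_def c_def del: of_nat_Suc)
      qed
      have mu: "norm (of_int (moebius_mu n) :: complex) \<le> 1 + ln (real n)" if "n > 0" for n
      proof -
        have "norm (of_int (moebius_mu n) :: complex) \<le> 1" by (rule norm_moebius_mu_le)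
        then show ?thesis using that ln_ge_zero[of "real n"] by linarith
      qed
      have "summable (\<lambda>n. norm (of_int (moebius_mu (Suc n)) / of_nat (Suc n) powr (1 + w) :: complex))"
        using w by (intro dirichlet_summable[of "\<lambda>n. of_int (moebius_mu n)"] mu) auto
      from summable_norm_cancel[OF this]
      have "S w = dirichlet (\<lambda>n. of_int (moebius_mu n)) (1 + w) * (pow_quot (real N) (real N + 1) w / w)"
        unfolding S_def fn dirichlet_def by (subst suminf_mult2) (auto simp: mult_ac)
      also have "dirichlet (\<lambda>n. of_int (moebius_mu n)) (1 + w) = 1 / riemann_zeta (1 + w)"
        using dirichlet_moebius_times_zeta_series[of "1 + w"] w riemann_zeta_eq_series[of "1 + w"]
          zeta_series_nonzero[of "1 + w"] by (simp add: field_simps)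
      finally show ?thesis by simp
    qed
    have J_eq: "contour_integral (linepath ?a ?b) (\<lambda>w. pow_quot (real N) (real N + 1) w / (w * riemann_zeta (1 + w))) = J"
      using contour_integral_unique[OF has_contour_integral_eq[OF J(1)]] S by simp
    have "(\<lambda>n. c n * (2 * of_real pi * \<i> * (if n < N then of_real L else 0))) sums
        (\<Sum>n<N. c n * (2 * of_real pi * \<i> * (if n < N then of_real L else 0)))"
      by (intro sums_finite) auto
    also have "(\<Sum>n<N. c n * (2 * of_real pi * \<i> * (if n < N then of_real L else 0))) =
        2 * of_real pi * \<i> * of_real L * of_real (g (real N))"
      unfolding g_of_nat_eq_sum c_def[symmetric] by (simp add: sum_distrib_left mult_ac)
    finally have "(\<lambda>n. contour_integral (linepath ?a ?b) (f n) - c n * (2 * of_real pi * \<i> * (if n < N then of_real L else 0))) sums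
       (J - 2 * of_real pi * \<i> * of_real L * of_real (g (real N)))"
      by (intro sums_diff J(2))
    then have "J - 2 * of_real pi * \<i> * of_real L * of_real (g (real N)) =
       (\<Sum>n. contour_integral (linepath ?a ?b) (f n) - c n * (2 * of_real pi * \<i> * (if n < N then of_real L else 0)))"
      by (simp add: sums_iff)
    also have "norm \<dots> \<le> (\<Sum>n. 12 * (real N + 1) * (1 / (real (Suc n))\<^sup>2) / T)"
    proof (rule norm_suminf_le)
      show "summable (\<lambda>n. 12 * (real N + 1) * (1 / (real (Suc n))\<^sup>2) / T)"
        by (intro summable_divide summable_mult sq)
      fix n
      have ci: "(\<lambda>w. pow_quot (y0 n) (y1 n) w / w) contour_integrable_on linepath ?a ?b"
        by (intro contour_integrable_continuous_linepath cont)
      have "contour_integral (linepath ?a ?b) (f n) = c n * contour_integral (linepath ?a ?b) (\<lambda>w. pow_quot (y0 n) (y1 n) w / w)"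
        unfolding f_def by (rule contour_integral_lmul[OF ci])
      moreover have "(if n < N then of_real L else 0) = (if 1 \<le> y0 n then complex_of_real (ln (y1 n) - ln (y0 n)) else 0)"
        using N by (simp add: y0_iff) (simp add: y0_def y1_def L_def ln_div)
      ultimately have "norm (contour_integral (linepath ?a ?b) (f n) - c n * (2 * of_real pi * \<i> * (if n < N then of_real L else 0))) =
        norm (c n) * norm (contour_integral (linepath ?a ?b) (\<lambda>w. pow_quot (y0 n) (y1 n) w / w) -
           2 * of_real pi * \<i> * (if 1 \<le> y0 n then complex_of_real (ln (y1 n) - ln (y0 n)) else 0))"
        by (simp only: norm_mult[symmetric] right_diff_distrib)
      also have "\<dots> \<le> (1 / real (Suc n)) * (12 * y1 n / T)"
        using y[of n] T by (intro mult_mono c perron_kernel) auto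
      also have "\<dots> = 12 * (real N + 1) * (1 / (real (Suc n))\<^sup>2) / T"
        by (simp add: y1_def power2_eq_square)
      finally show "norm (contour_integral (linepath ?a ?b) (f n) - c n * (2 * of_real pi * \<i> * (if n < N then of_real L else 0)))
         \<le> 12 * (real N + 1) * (1 / (real (Suc n))\<^sup>2) / T" .
    qed
    also have "\<dots> = K / T" unfolding K_def by (intro suminf_divide summable_mult sq)
    finally show "norm (contour_integral (linepath ?a ?b) (\<lambda>w. pow_quot (real N) (real N + 1) w / (w * riemann_zeta (1 + w)))
     - 2 * of_real pi * \<i> * of_real (ln (real N + 1) - ln (real N)) * of_real (g (real N))) \<le> K / T"
      unfolding J_eq L_def .
  qed
qed

text \<open>The denominator \<open>s * \<zeta>(1 + s)\<close> of the Mellin identity, with the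
  removable singularity filled by the residue 1. It is entire, and its zeros are those of \<zeta>
  shifted to the left by 1.\<close>

definition reg_zeta :: "complex \<Rightarrow> complex" where
  "reg_zeta w = (if w = 0 then 1 else w * riemann_zeta (1 + w))"

lemma reg_zeta_holomorphic: "reg_zeta holomorphic_on S"
proof -
  have "riemann_zeta \<circ> (\<lambda>w. 1 + w) holomorphic_on UNIV - {0}"
    by (rule holomorphic_on_compose_gen[OF _ riemann_zeta_holomorphic]) (auto intro!: holomorphic_intros)
  then have "(\<lambda>w. w * riemann_zeta (1 + w)) holomorphic_on UNIV - {0}"
    unfolding o_def by (intro holomorphic_intros)
  moreover have "((\<lambda>w. w * riemann_zeta (1 + w)) \<longlongrightarrow> 1) (at 0)"
    using LIM_offset_zero[OF riemann_zeta_pole] by simp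
  ultimately have "(\<lambda>w. if w = 0 then 1 else w * riemann_zeta (1 + w)) holomorphic_on UNIV"
    by (intro removable_singularity) auto
  then show ?thesis unfolding reg_zeta_def[abs_def] by (rule holomorphic_on_subset) auto
qed

section \<open>Contour shift under the Riemann hypothesis\<close>

lemma riemann_hypothesis_nonzero:
  assumes "riemann_hypothesis" "Re s > 1/2" "s \<noteq> 1"
  shows "riemann_zeta s \<noteq> 0"
proof (cases "Re s < 1")
  case True
  have "0 < Re s \<and> Re s < 1 \<and> riemann_zeta s = 0 \<longrightarrow> Re s = 1/2"
    using assms(1) unfolding riemann_hypothesis_def by blast
  then show ?thesis using True assms(2) by argo
qed (use assms riemann_zeta_nonzero_of_Re_ge_1[of s] in auto)

text \<open>Split at 5, the height from which the bound on 1/\<zeta> is available: the middle part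
  has length 10, and each tail contributes at most \<open>K / \<kappa>\<close>.\<close>

lemma norm_integral_symmetric_le:
  fixes F :: "real \<Rightarrow> complex"
  assumes cont: "continuous_on {- T..T} F" and T: "T \<ge> 5" and \<kappa>: "\<kappa> > 0" and K: "K \<ge> 0"
    and b1: "\<And>t. \<bar>t\<bar> \<le> 5 \<Longrightarrow> norm (F t) \<le> K"
    and b2: "\<And>t. \<bar>t\<bar> \<ge> 5 \<Longrightarrow> norm (F t) \<le> K * \<bar>t\<bar> powr (- 1 - \<kappa>)"
  shows "norm (integral {- T..T} F) \<le> K * (10 + 2 / \<kappa>)"
proof -
  have int: "F integrable_on {a..b}" if "- T \<le> a" "b \<le> T" for a b
    by (rule integrable_continuous_real, rule continuous_on_subset[OF cont]) (use that in auto)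
  have pw: "((\<lambda>t. K * t powr (- 1 - \<kappa>)) has_integral (- (K / \<kappa>) * T powr - \<kappa> - - (K / \<kappa>) * 5 powr - \<kappa>)) {5..T}"
  proof (rule fundamental_theorem_of_calculus[OF T])
    fix t :: real assume "t \<in> {5..T}"
    then have "t > 0" by simp
    then have "((\<lambda>t. t powr - \<kappa>) has_real_derivative - \<kappa> * t powr (- \<kappa> - 1)) (at t within {5..T})"
      by (auto intro!: derivative_eq_intros)
    from DERIV_cmult[OF this, of "- (K / \<kappa>)"]
    have "((\<lambda>t. - (K / \<kappa>) * t powr - \<kappa>) has_real_derivative - (K / \<kappa>) * (- \<kappa> * t powr (- \<kappa> - 1))) (at t within {5..T})" .
    moreover have "- (K / \<kappa>) * (- \<kappa> * t powr (- \<kappa> - 1)) = K * t powr (- 1 - \<kappa>)"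
    proof -
      have e: "- \<kappa> - 1 = - 1 - \<kappa>" by simp
      show ?thesis unfolding e using \<kappa> by simp
    qed
    ultimately show "((\<lambda>t. - (K / \<kappa>) * t powr - \<kappa>) has_vector_derivative K * t powr (- 1 - \<kappa>)) (at t within {5..T})"
      by (simp only: has_real_derivative_iff_has_vector_derivative)
  qed
  have "- (K / \<kappa>) * T powr - \<kappa> - - (K / \<kappa>) * 5 powr - \<kappa> \<le> K / \<kappa>"
  proof -
    have "(5::real) powr - \<kappa> \<le> 5 powr 0" using \<kappa> by (intro powr_mono) auto
    then have "(K / \<kappa>) * 5 powr - \<kappa> \<le> (K / \<kappa>) * 1" using K \<kappa> by (intro mult_left_mono) auto
    moreover have "(K / \<kappa>) * T powr - \<kappa> \<ge> 0" using K \<kappa> by simp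
    ultimately show ?thesis by linarith
  qed
  then have tail: "integral {5..T} (\<lambda>t. K * t powr (- 1 - \<kappa>)) \<le> K / \<kappa>"
    using integral_unique[OF pw] by simp
  have "norm (integral {5..T} F) \<le> integral {5..T} (\<lambda>t. K * t powr (- 1 - \<kappa>))"
  proof (rule integral_norm_bound_integral)
    fix t assume "t \<in> {5..T}"
    then show "norm (F t) \<le> K * t powr (- 1 - \<kappa>)" using b2[of t] by auto
  qed (use int pw T in auto)
  moreover have "norm (integral {- T..- 5} F) \<le> integral {5..T} (\<lambda>t. K * t powr (- 1 - \<kappa>))"
  proof -
    have eq: "integral {- T..- 5} F = integral {5..T} (\<lambda>t. F (- t))"
      using Henstock_Kurzweil_Integration.integral_reflect_real[of T 5 "\<lambda>t. F (- t)"] by simp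
    have "(\<lambda>t. F (- t)) integrable_on {5..T}"
      by (intro integrable_continuous_real continuous_on_compose2[OF cont] continuous_intros) (use T in auto)
    then show ?thesis unfolding eq
    proof (rule integral_norm_bound_integral)
      fix t assume "t \<in> {5..T}"
      then show "norm (F (- t)) \<le> K * t powr (- 1 - \<kappa>)" using b2[of "- t"] by auto
    qed (use pw in auto)
  qed
  moreover have "norm (integral {- 5..5} F) \<le> K * (5 - - 5)"
    by (intro integral_bound continuous_on_subset[OF cont] b1) (use T in auto)
  moreover have "integral {- T..T} F = integral {- T..- 5} F + (integral {- 5..5} F + integral {5..T} F)"
  proof -
    have "integral {- 5..5} F + integral {5..T} F = integral {- 5..T} F"
      using T by (intro Henstock_Kurzweil_Integration.integral_combine int) auto
    moreover have "integral {- T..- 5} F + integral {- 5..T} F = integral {- T..T} F"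
      using T by (intro Henstock_Kurzweil_Integration.integral_combine int) auto
    ultimately show ?thesis by simp
  qed
  ultimately have "norm (integral {- T..T} F) \<le> K / \<kappa> + (K * 10 + K / \<kappa>)"
    using norm_triangle_ineq[of "integral {- T..- 5} F" "integral {- 5..5} F + integral {5..T} F"]
      norm_triangle_ineq[of "integral {- 5..5} F" "integral {5..T} F"] tail by simp
  then show ?thesis by (simp add: algebra_simps)
qed

text \<open>Interpolates between the trivial bound and the mean value theorem.\<close>

lemma norm_pow_quot_interpolate:
  assumes N: "N \<ge> (1::real)" and c: "Re w = c" "c < 0" and d: "0 < d" "d < 1"
  shows "norm (pow_quot N (N + 1) w) \<le> 2 * norm w powr - d * N powr (c - 1 + d)"
proof -
  define X where "X = norm (of_real (N + 1) powr w - of_real N powr w :: complex)"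
  have w: "w \<noteq> 0" "norm w > 0" using c by auto
  have X1: "X \<le> norm w * N powr (c - 1)"
  proof -
    have "norm (of_real (N + 1) powr w - of_real N powr w :: complex) \<le> (norm w * N powr (c - 1)) * norm (complex_of_real (N + 1) - of_real N)"
    proof (rule field_differentiable_bound[where S = "closed_segment (of_real N) (of_real (N + 1))"])
      fix z :: complex assume "z \<in> closed_segment (of_real N) (of_real (N + 1))"
      then obtain x where x: "z = of_real x" "N \<le> x" "x \<le> N + 1"
        unfolding closed_segment_of_real by (auto simp: closed_segment_eq_real_ivl)
      then have "z \<notin> \<real>\<^sub>\<le>\<^sub>0" using N by auto
      then show "((\<lambda>z. z powr w) has_field_derivative w * z powr (w - 1)) (at z within closed_segment (of_real N) (of_real (N + 1)))"
        by (rule has_field_derivative_at_within[OF has_field_derivative_powr])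
      have "norm (w * z powr (w - 1)) = norm w * x powr (c - 1)"
        using x N c by (simp add: norm_mult norm_of_real_powr)
      also have "\<dots> \<le> norm w * N powr (c - 1)" using x N c by (intro mult_left_mono powr_mono2') auto
      finally show "norm (w * z powr (w - 1)) \<le> norm w * N powr (c - 1)" .
    qed auto
    then show ?thesis by (simp add: X_def)
  qed
  have X2: "X \<le> 2 * N powr c"
  proof -
    have "X \<le> (N + 1) powr c + N powr c"
      using norm_triangle_ineq4[of "of_real (N + 1) powr w" "of_real N powr w :: complex"] N c
      by (simp add: X_def norm_of_real_powr del: of_real_add)
    moreover have "(N + 1) powr c \<le> N powr c" using N c by (intro powr_mono2') auto
    ultimately show ?thesis by simp
  qed
  have X0: "X \<ge> 0" by (simp add: X_def)
  \<comment> \<open>The weights \<open>1 - d\<close> and \<open>d\<close> keep almost the full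
    saving of a factor \<open>N\<close> from the mean value bound, while after division by
    \<open>w\<close> a decay \<open>norm w powr - d\<close> is left for the integral along the
    line.\<close>
  have "X = X powr (1 - d) * X powr d" using X0 by (cases "X = 0") (auto simp: powr_add[symmetric])
  also have "\<dots> \<le> (norm w * N powr (c - 1)) powr (1 - d) * (2 * N powr c) powr d"
    using X0 X1 X2 d by (intro mult_mono powr_mono2) auto
  also have "\<dots> = norm w powr (1 - d) * 2 powr d * N powr ((c - 1) * (1 - d) + c * d)"
    using N w by (simp add: powr_mult powr_powr powr_add)
  also have "(c - 1) * (1 - d) + c * d = c - 1 + d" by (simp add: algebra_simps)
  also have "norm w powr (1 - d) * 2 powr d * N powr (c - 1 + d) \<le> norm w powr (1 - d) * 2 powr 1 * N powr (c - 1 + d)"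
    using d by (intro mult_right_mono mult_left_mono powr_mono) auto
  finally have "X / norm w \<le> norm w powr (1 - d) * 2 * N powr (c - 1 + d) / norm w"
    using w by (intro divide_right_mono) auto
  also have "norm w powr (1 - d) = norm w powr - d * norm w"
    using w powr_add[of "norm w" "- d" 1] by (simp add: algebra_simps)
  finally show ?thesis using w by (simp add: pow_quot_def X_def norm_divide mult_ac)
qed

lemma ln_Suc_diff_ge: "N \<ge> 1 \<Longrightarrow> ln (real N + 1) - ln (real N) \<ge> 1 / (2 * real N)"
proof -
  assume N: "N \<ge> 1"
  have "ln (real N / (real N + 1)) \<le> real N / (real N + 1) - 1" using N by (intro ln_le_minus_one) auto
  then have "ln (real N) - ln (real N + 1) \<le> - (1 / (real N + 1))" using N by (simp add: ln_div field_simps)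
  moreover have "1 / (real N + 1) \<ge> 1 / (2 * real N)" using N by (intro divide_left_mono) auto
  ultimately show ?thesis by linarith
qed

lemma riemann_hypothesis_g_nat_bound:
  assumes RH: riemann_hypothesis and a: "0 < a" "a < 1/2"
  obtains C where "\<And>N. N \<ge> 1 \<Longrightarrow> \<bar>g (real N)\<bar> \<le> C * real N powr - a"
proof -
  \<comment> \<open>With \<open>c = - 1/2 + d\<close> this solves
    \<open>c - 1 + d = - a - 1\<close>: the same \<open>d\<close> is the distance of the new line
    from \<open>Re w = - 1/2\<close> and the interpolation parameter of
    \<open>norm_pow_quot_interpolate\<close>.\<close>
  define d where "d = (1/2 - a) / 2"
  define c where "c = - 1/2 + d"
  have d: "0 < d" "d < 1/4" and c: "- 1/2 < c" "c < - 1/4" and cd: "c - 1 + d = - a - 1"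
    using a by (simp_all add: c_def d_def field_simps)
  have reg_nz: "reg_zeta w \<noteq> 0" if "Re w > - 1/2" for w
    using that riemann_hypothesis_nonzero[OF RH, of "1 + w"] by (auto simp: reg_zeta_def)
  have nz: "riemann_zeta s \<noteq> 0" if "1/2 < Re s" "\<bar>Im s\<bar> \<ge> 1" for s
    using riemann_hypothesis_nonzero[OF RH, of s] that by fastforce
  \<comment> \<open>The growth \<open>d / 2\<close> of 1/\<zeta> takes half of the decay
    \<open>norm w powr - d\<close> of \<open>pow_quot\<close>; with the factor
    \<open>1 / norm w\<close> from \<open>reg_zeta\<close> the integrand is O(|t| powr (-1 -
    d/2)).\<close>
  obtain C where C: "C > 0"
    "\<And>s. 1 + c \<le> Re s \<Longrightarrow> Re s \<le> 3 \<Longrightarrow> \<bar>Im s\<bar> \<ge> 5 \<Longrightarrow> norm (riemann_zeta s) \<le> C * \<bar>Im s\<bar> powr (d / 2)"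
    "\<And>s. 1 + c \<le> Re s \<Longrightarrow> Re s \<le> 3 \<Longrightarrow> \<bar>Im s\<bar> \<ge> 5 \<Longrightarrow> norm (1 / riemann_zeta s) \<le> C * \<bar>Im s\<bar> powr (d / 2)"
    by (rule riemann_zeta_subpolynomial[of "1/2" "1 + c" "d / 2"]) (use nz c d in auto)
  have reg_inv: "norm (1 / reg_zeta w) \<le> C * \<bar>Im w\<bar> powr (d / 2) / norm w"
    if "c \<le> Re w" "Re w \<le> 1" "\<bar>Im w\<bar> \<ge> 5" for w
  proof -
    have "w \<noteq> 0" using that by auto
    then have "norm (1 / reg_zeta w) = norm (1 / riemann_zeta (1 + w)) / norm w"
      by (simp add: reg_zeta_def norm_divide norm_mult)
    also have "\<dots> \<le> C * \<bar>Im (1 + w)\<bar> powr (d / 2) / norm w"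
      using that by (intro divide_right_mono C(3)) auto
    finally show ?thesis by simp
  qed
  \<comment> \<open>At low heights the growth estimate is silent, and compactness of the segment
    supplies the bound.\<close>
  obtain C3 where C3: "\<And>t. \<bar>t\<bar> \<le> 5 \<Longrightarrow> norm (1 / reg_zeta (Complex c t)) \<le> C3"
  proof -
    have "continuous_on {-5..5} (\<lambda>t. 1 / reg_zeta (Complex c t))"
      using c reg_nz
      by (intro continuous_on_divide continuous_on_const continuous_on_compose2[OF holomorphic_on_imp_continuous_on[OF reg_zeta_holomorphic[of UNIV]]]
           continuous_on_Complex continuous_on_id) auto
    then have "compact ((\<lambda>t. 1 / reg_zeta (Complex c t)) ` {-5..5})"
      by (rule compact_continuous_image) auto
    then obtain B where "\<And>z. z \<in> (\<lambda>t. 1 / reg_zeta (Complex c t)) ` {-5..5} \<Longrightarrow> norm z \<le> B"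
      using compact_imp_bounded bounded_iff by metis
    then show ?thesis using that[of B] by (auto simp: abs_le_iff)
  qed
  have C3_nonneg: "C3 \<ge> 0" using C3[of 0] norm_ge_zero[of "1 / reg_zeta (Complex c 0)"] by linarith
  define P where "P = (\<lambda>N w. pow_quot N (N + 1) w / reg_zeta w)"
  have P_hol: "P N holomorphic_on {w. Re w > - 1/2}" if "N \<ge> 1" for N
    unfolding P_def using that reg_nz by (intro holomorphic_intros pow_quot_holomorphic reg_zeta_holomorphic) auto
  have P_cont: "continuous_on S (P N)" if "N \<ge> 1" "S \<subseteq> {w. Re w > - 1/2}" for S N
    by (rule continuous_on_subset[OF holomorphic_on_imp_continuous_on[OF P_hol]]) (use that in auto)
  define C4 where "C4 = 2 * C + 2 * \<bar>c\<bar> powr - d * C3"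
  have C4: "C4 \<ge> 0" "2 * C \<le> C4" "2 * \<bar>c\<bar> powr - d * C3 \<le> C4"
    using C C3_nonneg by (auto simp: C4_def)
  have vert1: "norm (P N (Complex c t)) \<le> C4 * N powr (- a - 1)" if "N \<ge> 1" "\<bar>t\<bar> \<le> 5" for N t
  proof -
    have "norm (P N (Complex c t)) = norm (pow_quot N (N + 1) (Complex c t)) * norm (1 / reg_zeta (Complex c t))"
      by (simp add: P_def norm_divide)
    also have "\<dots> \<le> (2 * norm (Complex c t) powr - d * N powr (c - 1 + d)) * C3"
      using that c d by (intro mult_mono C3 norm_pow_quot_interpolate) auto
    also have "\<dots> \<le> (2 * \<bar>c\<bar> powr - d * N powr (c - 1 + d)) * C3"
      using abs_Re_le_cmod[of "Complex c t"] c d C3_nonneg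
      by (intro mult_right_mono mult_left_mono powr_mono2') auto
    also have "\<dots> = (2 * \<bar>c\<bar> powr - d * C3) * N powr (- a - 1)"
      unfolding cd by simp
    also have "\<dots> \<le> C4 * N powr (- a - 1)" by (intro mult_right_mono C4) auto
    finally show ?thesis .
  qed
  have vert2: "norm (P N (Complex c t)) \<le> C4 * N powr (- a - 1) * \<bar>t\<bar> powr (- 1 - d / 2)" if "N \<ge> 1" "\<bar>t\<bar> \<ge> 5" for N t
  proof -
    define w where "w = Complex c t"
    have w: "\<bar>t\<bar> \<le> norm w" "norm w > 0" using abs_Im_le_cmod[of w] that by (auto simp: w_def)
    have "norm (P N w) = norm (pow_quot N (N + 1) w) * norm (1 / reg_zeta w)"
      by (simp add: P_def norm_divide)
    also have "\<dots> \<le> (2 * norm w powr - d * N powr (c - 1 + d)) * (C * \<bar>Im w\<bar> powr (d / 2) / norm w)"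
      using that c d by (intro mult_mono reg_inv norm_pow_quot_interpolate) (auto simp: w_def)
    also have "\<dots> = (2 * C) * N powr (- a - 1) * \<bar>t\<bar> powr (d / 2) * (norm w powr - d / norm w)"
      unfolding cd by (simp add: w_def)
    also have "norm w powr - d / norm w = norm w powr (- 1 - d)"
    proof -
      have e: "- 1 - d = - d - 1" by simp
      show ?thesis unfolding e powr_diff using w by simp
    qed
    also have "(2 * C) * N powr (- a - 1) * \<bar>t\<bar> powr (d / 2) * norm w powr (- 1 - d) \<le>
        C4 * N powr (- a - 1) * \<bar>t\<bar> powr (d / 2) * \<bar>t\<bar> powr (- 1 - d)"
    proof (rule mult_mono)
      show "norm w powr (- 1 - d) \<le> \<bar>t\<bar> powr (- 1 - d)" using w that d by (intro powr_mono2') auto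
      show "2 * C * N powr (- a - 1) * \<bar>t\<bar> powr (d / 2) \<le> C4 * N powr (- a - 1) * \<bar>t\<bar> powr (d / 2)"
        by (intro mult_right_mono C4) auto
    qed (use C4 in auto)
    also have "\<dots> = C4 * N powr (- a - 1) * (\<bar>t\<bar> powr (d / 2) * \<bar>t\<bar> powr (- 1 - d))" by simp
    also have "\<bar>t\<bar> powr (d / 2) * \<bar>t\<bar> powr (- 1 - d) = \<bar>t\<bar> powr (- 1 - d / 2)"
    proof -
      have e: "- 1 - d / 2 = d / 2 + (- 1 - d)" by (simp add: field_simps)
      show ?thesis unfolding e powr_add ..
    qed
    finally show ?thesis by (simp add: w_def)
  qed
  \<comment> \<open>On the horizontal sides a bound that grows with \<open>N\<close> is harmless:
    the exponent of \<open>T\<close> is negative, so these sides vanish as \<open>T\<close> tends to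
    infinity with \<open>N\<close> fixed.\<close>
  have horiz: "norm (P N w) \<le> 2 * (N + 1) * C * T powr (d / 2 - 2)"
    if "N \<ge> 1" "c \<le> Re w" "Re w \<le> 1" "\<bar>Im w\<bar> = T" "T \<ge> 5" for N w T
  proof -
    have w: "T \<le> norm w" "w \<noteq> 0" "norm w > 0" using abs_Im_le_cmod[of w] that by auto
    have pw: "y powr Re w \<le> N + 1" if "1 \<le> y" "y \<le> N + 1" for y
      using powr_mono[of "Re w" 1 y] that \<open>Re w \<le> 1\<close> by auto
    have "norm (P N w) = norm (pow_quot N (N + 1) w) * norm (1 / reg_zeta w)"
      by (simp add: P_def norm_divide)
    also have "\<dots> \<le> ((N powr Re w + (N + 1) powr Re w) / norm w) * (C * \<bar>Im w\<bar> powr (d / 2) / norm w)"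
      using that w by (intro mult_mono reg_inv norm_pow_quot_le) auto
    also have "\<dots> \<le> (((N + 1) + (N + 1)) / T) * (C * T powr (d / 2) / T)"
      using that w C pw[of N] pw[of "N + 1"]
      by (intro mult_mono frac_le add_mono mult_nonneg_nonneg) auto
    also have "\<dots> = 2 * (N + 1) * C * (T powr (d / 2) / T powr 2)"
      using that by (simp add: power2_eq_square)
    finally show ?thesis by (simp add: powr_diff)
  qed
  define V where "V = 10 + 2 / (d / 2)"
  have V: "V \<ge> 0" using d by (simp add: V_def)
  have "\<bar>g (real N)\<bar> \<le> (C4 * V / pi) * real N powr - a" if N: "N \<ge> 1" for N
  proof -
    have N1: "real N \<ge> 1" using N by simp
    define L where "L = ln (real N + 1) - ln (real N)"
    have L: "L \<ge> 1 / (2 * real N)" using ln_Suc_diff_ge[OF N] by (simp add: L_def)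
    obtain K where K: "\<And>T. T \<ge> 1 \<Longrightarrow>
      norm (contour_integral (linepath (Complex 1 (- T)) (Complex 1 T))
         (\<lambda>w. pow_quot (real N) (real N + 1) w / (w * riemann_zeta (1 + w)))
       - 2 * of_real pi * \<i> * of_real L * of_real (g (real N))) \<le> K / T"
      using perron_g[OF N] unfolding L_def by blast
    have "2 * pi * L * \<bar>g (real N)\<bar> \<le> C4 * real N powr (- a - 1) * V + 2 * (2 * (real N + 1) * C * T powr (d / 2 - 2) * 2) + K / T"
      if T: "T \<ge> 5" for T
    proof -
      let ?P = "P (real N)"
      define I1 where "I1 = contour_integral (linepath (Complex c (- T)) (Complex 1 (- T))) ?P"
      define I2 where "I2 = contour_integral (linepath (Complex 1 (- T)) (Complex 1 T)) ?P"
      define I3 where "I3 = contour_integral (linepath (Complex 1 T) (Complex c T)) ?P"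
      define I4 where "I4 = contour_integral (linepath (Complex c (- T)) (Complex c T)) ?P"
      have "(?P has_contour_integral 0) (rectpath (Complex c (- T)) (Complex 1 T))"
      proof (rule Cauchy_theorem_convex_simple[OF P_hol[OF N1]])
        show "path_image (rectpath (Complex c (- T)) (Complex 1 T)) \<subseteq> {w. Re w > - 1/2}"
          using T c by (subst path_image_rectpath) auto
      qed (auto intro: convex_halfspace_Re_gt)
      note sides = rectpath_integral_sides[OF this]
      have "contour_integral (linepath (Complex c T) (Complex c (- T))) ?P = - I4"
        unfolding I4_def using c T
        by (intro contour_integral_reverse_linepath P_cont[OF N1]) (auto simp: closed_segment_same_Re)
      with sides have I2: "I2 = I4 - I1 - I3" by (simp add: I1_def I2_def I3_def algebra_simps)
      have n1: "norm I1 \<le> 2 * (real N + 1) * C * T powr (d / 2 - 2) * 2"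
        unfolding I1_def
      proof (rule norm_contour_integral_linepath_le)
        show "continuous_on (closed_segment (Complex c (- T)) (Complex 1 (- T))) ?P"
          using c by (intro P_cont[OF N1]) (auto simp: closed_segment_same_Im closed_segment_eq_real_ivl)
        fix w assume "w \<in> closed_segment (Complex c (- T)) (Complex 1 (- T))"
        then show "norm (?P w) \<le> 2 * (real N + 1) * C * T powr (d / 2 - 2)"
          using c T N1 by (intro horiz) (auto simp: closed_segment_same_Im closed_segment_eq_real_ivl)
      next
        have "Complex 1 (- T) - Complex c (- T) = of_real (1 - c)" by (simp add: complex_eq_iff)
        then show "norm (Complex 1 (- T) - Complex c (- T)) \<le> 2" using c by (simp only: norm_of_real; simp)
      qed
      have n3: "norm I3 \<le> 2 * (real N + 1) * C * T powr (d / 2 - 2) * 2"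
        unfolding I3_def
      proof (rule norm_contour_integral_linepath_le)
        show "continuous_on (closed_segment (Complex 1 T) (Complex c T)) ?P"
          using c by (intro P_cont[OF N1]) (auto simp: closed_segment_same_Im closed_segment_eq_real_ivl)
        fix w assume "w \<in> closed_segment (Complex 1 T) (Complex c T)"
        then show "norm (?P w) \<le> 2 * (real N + 1) * C * T powr (d / 2 - 2)"
          using c T N1 by (intro horiz) (auto simp: closed_segment_same_Im closed_segment_eq_real_ivl)
      next
        have "Complex c T - Complex 1 T = of_real (c - 1)" by (simp add: complex_eq_iff)
        then show "norm (Complex c T - Complex 1 T) \<le> 2" using c by (simp only: norm_of_real; simp)
      qed
      have n4: "norm I4 \<le> C4 * real N powr (- a - 1) * V"
      proof -
        have "I4 = \<i> * integral {- T..T} (\<lambda>t. ?P (Complex c t))"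
          unfolding I4_def using T by (intro contour_integral_linepath_same_Re) auto
        moreover have "norm (integral {- T..T} (\<lambda>t. ?P (Complex c t))) \<le> C4 * real N powr (- a - 1) * (10 + 2 / (d / 2))"
        proof (rule norm_integral_symmetric_le)
          show "continuous_on {- T..T} (\<lambda>t. ?P (Complex c t))"
            using c by (intro continuous_on_compose2[OF P_cont[OF N1, of "{w. Re w > - 1/2}"]] continuous_on_Complex
                continuous_on_const continuous_on_id) auto
        qed (use T d C4 vert1[OF N1] vert2[OF N1] in auto)
        ultimately show ?thesis by (simp add: norm_mult V_def)
      qed
      have "contour_integral (linepath (Complex 1 (- T)) (Complex 1 T))
         (\<lambda>w. pow_quot (real N) (real N + 1) w / (w * riemann_zeta (1 + w))) = I2"
        unfolding I2_def P_def
      proof (rule contour_integral_cong[OF refl])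
        fix w assume "w \<in> path_image (linepath (Complex 1 (- T)) (Complex 1 T))"
        then have "w \<noteq> 0" using T by (auto simp: closed_segment_same_Re)
        then show "pow_quot (real N) (real N + 1) w / (w * riemann_zeta (1 + w)) = pow_quot (real N) (real N + 1) w / reg_zeta w"
          by (simp add: reg_zeta_def)
      qed
      with K[of T] T have "norm (I2 - 2 * of_real pi * \<i> * of_real L * of_real (g (real N))) \<le> K / T" by simp
      moreover have "norm (2 * of_real pi * \<i> * of_real L * of_real (g (real N)) :: complex) = 2 * pi * L * \<bar>g (real N)\<bar>"
        using L N1 order.trans[OF _ L, of 0] by (simp add: norm_mult)
      ultimately have "2 * pi * L * \<bar>g (real N)\<bar> \<le> norm I2 + K / T"
        by (smt (verit) norm_triangle_sub norm_minus_commute)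
      moreover have "norm I2 \<le> norm I4 + norm I1 + norm I3"
        unfolding I2 using norm_triangle_ineq4[of "I4 - I1" I3] norm_triangle_ineq4[of I4 I1] by linarith
      ultimately show ?thesis using n1 n3 n4 by linarith
    qed
    then have ev: "eventually (\<lambda>T. 2 * pi * L * \<bar>g (real N)\<bar> \<le>
        C4 * real N powr (- a - 1) * V + 2 * (2 * (real N + 1) * C * T powr (d / 2 - 2) * 2) + K / T) at_top"
      by (auto simp: eventually_at_top_linorder)
    have "((\<lambda>T. T powr (d / 2 - 2)) \<longlongrightarrow> 0) at_top"
    proof -
      define e where "e = 2 - d / 2"
      have "e > 0" using d by (simp add: e_def)
      then have "((\<lambda>T. T powr - e) \<longlongrightarrow> 0) at_top" by real_asymp
      then show ?thesis by (simp add: e_def)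
    qed
    moreover have "((\<lambda>T. K / T) \<longlongrightarrow> 0) at_top" by real_asymp
    ultimately have "((\<lambda>T. C4 * real N powr (- a - 1) * V + 2 * (2 * (real N + 1) * C * T powr (d / 2 - 2) * 2) + K / T) \<longlongrightarrow>
       C4 * real N powr (- a - 1) * V + 2 * (2 * (real N + 1) * C * 0 * 2) + 0) at_top"
      by (intro tendsto_intros)
    from tendsto_lowerbound[OF this ev] have main: "2 * pi * L * \<bar>g (real N)\<bar> \<le> C4 * real N powr (- a - 1) * V" by simp
    have "pi / real N * \<bar>g (real N)\<bar> = 2 * pi * (1 / (2 * real N)) * \<bar>g (real N)\<bar>" by simp
    also have "\<dots> \<le> 2 * pi * L * \<bar>g (real N)\<bar>" using L by (intro mult_right_mono mult_left_mono) auto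
    also note main
    also have "real N powr (- a - 1) = real N powr - a / real N" using N1 by (simp add: powr_diff)
    finally show ?thesis using N1 by (simp add: field_simps)
  qed
  then show ?thesis using that by blast
qed

lemma g_eq_0: "x < 1 \<Longrightarrow> g x = 0"
proof -
  assume "x < 1"
  then have "{n. 1 \<le> n \<and> real n \<le> x} = {}" by auto
  then show ?thesis unfolding g_def by (metis sum.empty)
qed

lemma g_eq_floor: "x \<ge> 0 \<Longrightarrow> g x = g (real (nat \<lfloor>x\<rfloor>))"
proof -
  assume x: "x \<ge> 0"
  have "real n \<le> x \<longleftrightarrow> real n \<le> real (nat \<lfloor>x\<rfloor>)" for n
  proof -
    have "real n \<le> x \<longleftrightarrow> int n \<le> \<lfloor>x\<rfloor>" by (simp add: le_floor_iff)
    also have "\<dots> \<longleftrightarrow> n \<le> nat \<lfloor>x\<rfloor>" using x by linarith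
    finally show ?thesis by (simp only: of_nat_le_iff)
  qed
  then show ?thesis unfolding g_def by presburger
qed

lemma riemann_hypothesis_g_bound:
  assumes RH: riemann_hypothesis and a: "0 < a" "a < 1/2"
  obtains C where "C \<ge> 0" "\<And>x. x > 0 \<Longrightarrow> \<bar>g x\<bar> \<le> C * x powr - a"
proof -
  obtain C where C: "\<And>N. N \<ge> 1 \<Longrightarrow> \<bar>g (real N)\<bar> \<le> C * real N powr - a"
    using riemann_hypothesis_g_nat_bound[OF assms] by blast
  have "C \<ge> 0" using C[of 1] by (metis abs_ge_zero mult.right_neutral of_nat_1 order_refl order_trans powr_one_eq_one)
  \<comment> \<open>For \<open>x \<ge> 1\<close> the floor of \<open>x\<close> is at least
    \<open>x / 2\<close>, which costs \<open>2 powr a \<le> 2\<close>; below 1 the function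
    \<open>g\<close> vanishes.\<close>
  moreover have "\<bar>g x\<bar> \<le> (C * 2) * x powr - a" if x: "x > 0" for x
  proof (cases "x < 1")
    case True
    then show ?thesis using \<open>C \<ge> 0\<close> by (simp add: g_eq_0)
  next
    case False
    define N where "N = nat \<lfloor>x\<rfloor>"
    have rN: "real N = of_int \<lfloor>x\<rfloor>" using x by (simp add: N_def)
    have "(1::int) \<le> \<lfloor>x\<rfloor>" using False by (simp add: le_floor_iff)
    then have "(1::real) \<le> of_int \<lfloor>x\<rfloor>" by (simp only: of_int_1_le_iff)
    moreover have "x < of_int \<lfloor>x\<rfloor> + 1" by linarith
    ultimately have "real N \<ge> 1" "real N \<ge> x / 2" unfolding rN by linarith+
    then have N: "N \<ge> 1" "real N \<ge> x / 2" by simp_all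
    have "real N powr - a \<le> (x / 2) powr - a" using N x a by (intro powr_mono2') auto
    also have "(x / 2) powr - a = 2 powr a * x powr - a"
      using x by (simp add: powr_divide powr_minus field_simps)
    also have "\<dots> \<le> 2 powr 1 * x powr - a" using a by (intro mult_right_mono powr_mono) auto
    finally have "C * real N powr - a \<le> C * (2 * x powr - a)"
      using \<open>C \<ge> 0\<close> by (intro mult_left_mono) auto
    moreover have "\<bar>g x\<bar> \<le> C * real N powr - a"
      using C[OF N(1)] g_eq_floor[of x] x by (simp add: N_def)
    ultimately show ?thesis by simp
  qed
  ultimately show ?thesis using that[of "C * 2"] by simp
qed

section \<open>Mellin transforms on the half-line\<close>

lemma set_nn_integral_powr_0_c:
  assumes "b > -1" "c \<ge> 0"
  shows "(\<integral>\<^sup>+x\<in>{0..c}. ennreal (x powr b) \<partial>lborel) = ennreal (c powr (b + 1) / (b + 1))"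
  using nn_integral_has_integral_lebesgue'[OF _ has_integral_powr_from_0[OF assms]] by simp

lemma set_nn_integral_powr_1_inf:
  assumes "b < -1"
  shows "(\<integral>\<^sup>+x\<in>{1..}. ennreal (x powr b) \<partial>lborel) = ennreal (- 1 / (b + 1))"
  using nn_integral_has_integral_lebesgue'[OF _ has_integral_powr_to_inf[OF assms, of 1]] by simp

lemma set_integral_reciprocal_substitution:
  fixes f :: "real \<Rightarrow> complex"
  assumes f: "set_integrable lebesgue {0<..} f"
  shows "set_integrable lebesgue {0<..} (\<lambda>t. of_real (1 / t\<^sup>2) * f (1 / t))"
    and "(LINT t:{0<..}|lebesgue. of_real (1 / t\<^sup>2) * f (1 / t)) = (LINT x:{0<..}|lebesgue. f x)"
proof -
  have img: "(\<lambda>x::real. 1 / x) ` {0<..} = {0<..}"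
  proof
    show "{0<..} \<subseteq> (\<lambda>x::real. 1 / x) ` {0<..}"
    proof
      fix x :: real assume "x \<in> {0<..}"
      then show "x \<in> (\<lambda>x::real. 1 / x) ` {0<..}" by (intro image_eqI[of _ _ "1 / x"]) auto
    qed
  qed auto
  have inj: "inj_on (\<lambda>x::real. 1 / x) {0<..}" by (auto simp: inj_on_def)
  have der: "((\<lambda>x::real. 1 / x) has_field_derivative - 1 / x\<^sup>2) (at x within {0<..})" if "x \<in> {0<..}" for x
    using that by (auto intro!: derivative_eq_intros simp: power2_eq_square)
  have *: "set_integrable lebesgue {0<..} (\<lambda>x. 1 / x\<^sup>2 * h (1 / x)) \<and>
      (LINT x:{0<..}|lebesgue. 1 / x\<^sup>2 * h (1 / x)) = (LINT x:{0<..}|lebesgue. h x)"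
    if h: "set_integrable lebesgue {0<..} h" for h :: "real \<Rightarrow> real"
  proof -
    have "(\<lambda>x. \<bar>- 1 / x\<^sup>2\<bar> * h (1 / x)) absolutely_integrable_on {0<..} \<and>
       integral {0<..} (\<lambda>x. \<bar>- 1 / x\<^sup>2\<bar> * h (1 / x)) = integral {0<..} h"
      using has_absolute_integral_change_of_variables_1'[of "{0<..}" "\<lambda>x::real. 1 / x" "\<lambda>x. - 1 / x\<^sup>2" h "integral {0<..} h"]
        der inj h by (auto simp: img)
    then show ?thesis using h by (simp add: set_lebesgue_integral_eq_integral)
  qed
  have Re: "set_integrable lebesgue {0<..} (\<lambda>x. Re (f x))" and Im: "set_integrable lebesgue {0<..} (\<lambda>x. Im (f x))"
    using integrable_Re[OF f[unfolded set_integrable_def]] integrable_Im[OF f[unfolded set_integrable_def]]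
    by (simp_all add: set_integrable_def)
  have split: "of_real (1 / t\<^sup>2) * f (1 / t) = of_real (1 / t\<^sup>2 * Re (f (1 / t))) + \<i> * of_real (1 / t\<^sup>2 * Im (f (1 / t)))" for t
    by (simp add: complex_eq_iff)
  have of_real: "set_integrable lebesgue {0<..} (\<lambda>x. complex_of_real (h x))"
    if "set_integrable lebesgue {0<..} h" for h :: "real \<Rightarrow> real"
    using integrable_of_real[OF that[unfolded set_integrable_def], where 'a = complex]
    by (simp add: set_integrable_def scaleR_conv_of_real)
  have i: "set_integrable lebesgue {0<..} (\<lambda>t. complex_of_real (1 / t\<^sup>2 * Re (f (1 / t))))"
     "set_integrable lebesgue {0<..} (\<lambda>t. \<i> * complex_of_real (1 / t\<^sup>2 * Im (f (1 / t))))"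
    using of_real[OF *[OF Re, THEN conjunct1]]
      set_integrable_mult_right[OF of_real[OF *[OF Im, THEN conjunct1]], of \<i>] by auto
  show "set_integrable lebesgue {0<..} (\<lambda>t. of_real (1 / t\<^sup>2) * f (1 / t))"
    unfolding split using i by (intro set_integral_add) auto
  have "(LINT t:{0<..}|lebesgue. of_real (1 / t\<^sup>2) * f (1 / t)) =
     (LINT t:{0<..}|lebesgue. complex_of_real (1 / t\<^sup>2 * Re (f (1 / t)))) +
     (LINT t:{0<..}|lebesgue. \<i> * complex_of_real (1 / t\<^sup>2 * Im (f (1 / t))))"
    unfolding split using i by (intro set_integral_add) auto
  also have "\<dots> = of_real (LINT t:{0<..}|lebesgue. 1 / t\<^sup>2 * Re (f (1 / t))) +
      \<i> * of_real (LINT t:{0<..}|lebesgue. 1 / t\<^sup>2 * Im (f (1 / t)))"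
    by (simp only: set_integral_complex_of_real set_integral_mult_right)
  also have "\<dots> = of_real (LINT t:{0<..}|lebesgue. Re (f t)) + \<i> * of_real (LINT t:{0<..}|lebesgue. Im (f t))"
    using *[OF Re] *[OF Im] by simp
  also have "\<dots> = (LINT x:{0<..}|lebesgue. f x)"
    using integral_Re[OF f[unfolded set_integrable_def]] integral_Im[OF f[unfolded set_integrable_def]]
    by (simp add: complex_eq_iff set_lebesgue_integral_def)
  finally show "(LINT t:{0<..}|lebesgue. of_real (1 / t\<^sup>2) * f (1 / t)) = (LINT x:{0<..}|lebesgue. f x)" .
qed

text \<open>Lebesgue measurability does not pass well through compositions and product spaces; a
  Borel representative does, at the price of a null set.\<close>

lemma lebesgue_measurable_AE_eq_borel:
  fixes f :: "real \<Rightarrow> complex"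
  assumes "f \<in> borel_measurable lebesgue"
  obtains f' where "f' \<in> borel_measurable borel" "AE x in lborel. f x = f' x"
proof -
  have "(\<lambda>x. Re (f x)) \<in> borel_measurable (completion lborel)" "(\<lambda>x. Im (f x)) \<in> borel_measurable (completion lborel)"
    using assms by simp_all
  from this[THEN completion_ex_borel_measurable_real] obtain u v
    where u: "u \<in> borel_measurable lborel" "AE x in lborel. Re (f x) = u x"
     and v: "v \<in> borel_measurable lborel" "AE x in lborel. Im (f x) = v x"
    by blast
  have "AE x in lborel. f x = Complex (u x) (v x)"
    using u(2) v(2) by eventually_elim (simp add: complex_eq_iff)
  moreover have "(\<lambda>x. Complex (u x) (v x)) \<in> borel_measurable borel"
    using u(1) v(1) by (simp add: Complex_eq)
  ultimately show ?thesis using that by blast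
qed

text \<open>A majorant independent of \<open>h\<close> for differentiating a Mellin integral in
  \<open>s\<close>. The mean value bound produces \<open>exp (e * \<bar>ln x\<bar>)\<close> and a
  factor \<open>\<bar>ln x\<bar>\<close>, which is absorbed into a second such exponential; together
  they cost \<open>2 * e\<close> in the exponent.\<close>

lemma norm_powr_difference_quotient_le:
  assumes x: "x > 0" and e: "e > 0" and h: "h \<noteq> 0" "norm h \<le> e"
  shows "norm ((of_real x powr (s + h) - of_real x powr s) / h :: complex) \<le> (x powr (Re s + 2 * e) + x powr (Re s - 2 * e)) / e"
proof -
  define l where "l = ln x"
  have xs: "of_real x powr (s + h) - of_real x powr s = of_real x powr s * (exp (h * of_real l) - 1)"
    using x by (simp add: powr_def l_def Ln_of_real exp_add algebra_simps)
  have "norm (exp (h * of_real l) - exp 0) \<le> exp (norm h * \<bar>l\<bar>) * norm (h * of_real l - 0)"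
  proof (rule field_differentiable_bound[of "cball 0 (norm h * \<bar>l\<bar>)"])
    show "norm (exp z) \<le> exp (norm h * \<bar>l\<bar>)" if "z \<in> cball 0 (norm h * \<bar>l\<bar>)" for z :: complex
      using that complex_Re_le_cmod[of z] by simp
  qed (auto simp: norm_mult intro!: derivative_eq_intros)
  then have "norm (exp (h * of_real l) - 1) \<le> exp (norm h * \<bar>l\<bar>) * (norm h * \<bar>l\<bar>)" by (simp add: norm_mult)
  also have "\<dots> \<le> exp (e * \<bar>l\<bar>) * (norm h * (exp (e * \<bar>l\<bar>) / e))"
  proof (intro mult_mono)
    show "\<bar>l\<bar> \<le> exp (e * \<bar>l\<bar>) / e"
    proof -
      have "e * \<bar>l\<bar> \<le> exp (e * \<bar>l\<bar>)" using exp_ge_add_one_self[of "e * \<bar>l\<bar>"] by linarith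
      then show ?thesis using e by (simp add: pos_le_divide_eq mult.commute)
    qed
  qed (use e h in \<open>auto intro!: mult_right_mono\<close>)
  also have "\<dots> = norm h * (exp (2 * e * \<bar>l\<bar>) / e)" by (simp add: exp_add[symmetric])
  finally have "norm ((exp (h * of_real l) - 1) / h) \<le> exp (2 * e * \<bar>l\<bar>) / e"
    using h by (simp add: norm_divide field_simps)
  moreover have "exp (2 * e * \<bar>l\<bar>) \<le> x powr (2 * e) + x powr (- (2 * e))"
    using x by (cases "l \<ge> 0") (auto simp: powr_def l_def)
  ultimately have "norm ((exp (h * of_real l) - 1) / h) \<le> (x powr (2 * e) + x powr (- (2 * e))) / e"
    using e by (meson divide_right_mono less_imp_le order_trans)
  then have "x powr Re s * norm ((exp (h * of_real l) - 1) / h) \<le> x powr Re s * ((x powr (2 * e) + x powr (- (2 * e))) / e)"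
    by (intro mult_left_mono) auto
  moreover have "norm ((of_real x powr (s + h) - of_real x powr s) / h :: complex) = x powr Re s * norm ((exp (h * of_real l) - 1) / h)"
    unfolding xs using x by (simp add: norm_mult norm_divide norm_of_real_powr)
  moreover have "x powr Re s * ((x powr (2 * e) + x powr (- (2 * e))) / e) = (x powr (Re s + 2 * e) + x powr (Re s - 2 * e)) / e"
    by (simp add: powr_add[symmetric] distrib_left)
  ultimately show ?thesis by (simp only:)
qed

lemma set_integrable_powr_mult_iff:
  fixes f :: "real \<Rightarrow> complex"
  assumes [measurable]: "f \<in> borel_measurable borel"
  shows "set_integrable lborel {0<..} (\<lambda>x. of_real x powr s * f x) \<longleftrightarrow>
    set_integrable lborel {0<..} (\<lambda>x. x powr Re s * norm (f x))"
proof -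
  have "(\<lambda>x. indicator {0<..} x *\<^sub>R (of_real x powr s * f x)) \<in> borel_measurable lborel" by measurable
  then have "integrable lborel (\<lambda>x. indicator {0<..} x *\<^sub>R (of_real x powr s * f x)) \<longleftrightarrow>
      integrable lborel (\<lambda>x. norm (indicator {0<..} x *\<^sub>R (of_real x powr s * f x)))"
    by (simp only: integrable_norm_iff)
  also have "(\<lambda>x. norm (indicator {0<..} x *\<^sub>R (of_real x powr s * f x))) =
      (\<lambda>x. indicator {0<..} x *\<^sub>R (x powr Re s * norm (f x)))"
    by (rule ext) (auto simp: indicator_def norm_mult norm_of_real_powr)
  finally show ?thesis unfolding set_integrable_def .
qed

lemma mellin_integral_holomorphic:
  fixes f :: "real \<Rightarrow> complex"
  assumes f [measurable]: "f \<in> borel_measurable borel"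
    and int: "\<And>\<sigma>. \<alpha> < \<sigma> \<Longrightarrow> \<sigma> < \<beta> \<Longrightarrow> set_integrable lborel {0<..} (\<lambda>x. x powr \<sigma> * norm (f x))"
  shows "(\<lambda>s. LINT x:{0<..}|lborel. of_real x powr s * f x) holomorphic_on {s. \<alpha> < Re s \<and> Re s < \<beta>}"
proof (rule holomorphic_onI)
  fix s assume s: "s \<in> {s. \<alpha> < Re s \<and> Re s < \<beta>}"
  define M where "M = (\<lambda>s. LINT x:{0<..}|lborel. of_real x powr s * f x)"
  define M' where "M' = (LINT x:{0<..}|lborel. Ln (of_real x) * of_real x powr s * f x)"
  \<comment> \<open>A third of the distance to the boundary, so that \<open>Re s - 2 * e\<close> and
    \<open>Re s + 2 * e\<close> stay inside the strip.\<close>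
  define e where "e = min (Re s - \<alpha>) (\<beta> - Re s) / 3"
  have e: "e > 0" "\<alpha> < Re s - 2 * e" "Re s + 2 * e < \<beta>" using s by (auto simp: e_def min_def field_simps)
  have i: "set_integrable lborel {0<..} (\<lambda>x. of_real x powr s * f x)" if "\<alpha> < Re s" "Re s < \<beta>" for s
    using int[of "Re s"] that by (simp add: set_integrable_powr_mult_iff)
  define w where "w = (\<lambda>x. (x powr (Re s + 2 * e) * norm (f x) + x powr (Re s - 2 * e) * norm (f x)) / e)"
  have w: "set_integrable lborel {0<..} w"
    unfolding w_def using e by (intro set_integrable_divide set_integral_add int) auto
  have "((\<lambda>z. (M z - M s) / (z - s)) \<longlongrightarrow> M') (at s)"
  proof (rule tendsto_at_iff_sequentially[THEN iffD2], intro allI impI)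
    fix X :: "nat \<Rightarrow> complex" assume X: "\<forall>i. X i \<in> UNIV - {s}" "X \<longlonglongrightarrow> s"
    define h where "h = (\<lambda>n. X n - s)"
    have h0: "h n \<noteq> 0" for n using X(1) by (simp add: h_def)
    have h: "h \<longlonglongrightarrow> 0" using X(2) by (simp add: h_def LIM_zero)
    then have "eventually (\<lambda>n. norm (h n) < e) sequentially"
      using e(1) by (simp add: tendsto_iff dist_norm)
    \<comment> \<open>The majorant is valid only for increments of modulus at most \<open>e\<close>,
      so the sequence is used from \<open>n0\<close> on.\<close>
    then obtain n0 where n0: "\<And>n. n \<ge> n0 \<Longrightarrow> norm (h n) < e" by (auto simp: eventually_sequentially)
    have "(\<lambda>n. LINT x|lborel. indicator {0<..} x *\<^sub>R (((of_real x powr (s + h (n + n0)) - of_real x powr s) / h (n + n0)) * f x)) \<longlonglongrightarrow>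
          (LINT x|lborel. indicator {0<..} x *\<^sub>R (Ln (of_real x) * of_real x powr s * f x))"
    proof (rule integral_dominated_convergence)
      show "integrable lborel (\<lambda>x. indicator {0<..} x *\<^sub>R w x)" using w by (simp add: set_integrable_def)
      show "AE x in lborel. (\<lambda>n. indicator {0<..} x *\<^sub>R (((of_real x powr (s + h (n + n0)) - of_real x powr s) / h (n + n0)) * f x)) \<longlonglongrightarrow>
          indicator {0<..} x *\<^sub>R (Ln (of_real x) * of_real x powr s * f x)"
      proof (rule AE_I2)
        fix x :: real
        show "(\<lambda>n. indicator {0<..} x *\<^sub>R (((of_real x powr (s + h (n + n0)) - of_real x powr s) / h (n + n0)) * f x)) \<longlonglongrightarrow>
          indicator {0<..} x *\<^sub>R (Ln (of_real x) * of_real x powr s * f x)"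
        proof (cases "x > 0")
          case True
          then have "((\<lambda>z. of_real x powr z) has_field_derivative Ln (of_real x) * of_real x powr s) (at s)"
            by (intro has_field_derivative_powr_right) auto
          then have lim: "((\<lambda>h. (of_real x powr (s + h) - of_real x powr s) / h) \<longlongrightarrow> Ln (of_real x) * of_real x powr s) (at 0)"
            by (simp add: DERIV_def)
          have "filterlim (\<lambda>n. h (n + n0)) (at 0) sequentially"
            using LIMSEQ_ignore_initial_segment[OF h] h0 by (intro filterlim_atI) auto
          note filterlim_compose[OF lim this]
          moreover have "indicator {0<..} x = (1 :: real)" using True by simp
          ultimately show ?thesis by (simp only: scaleR_one) (rule tendsto_mult[OF _ tendsto_const])
        qed auto
      qed
      show "AE x in lborel. norm (indicator {0<..} x *\<^sub>R (((of_real x powr (s + h (n + n0)) - of_real x powr s) / h (n + n0)) * f x)) \<le>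
         indicator {0<..} x *\<^sub>R w x" for n
      proof (rule AE_I2)
        fix x :: real
        show "norm (indicator {0<..} x *\<^sub>R (((of_real x powr (s + h (n + n0)) - of_real x powr s) / h (n + n0)) * f x)) \<le>
         indicator {0<..} x *\<^sub>R w x"
        proof (cases "x > 0")
          case True
          have "norm ((of_real x powr (s + h (n + n0)) - of_real x powr s) / h (n + n0) :: complex) * norm (f x) \<le>
              (x powr (Re s + 2 * e) + x powr (Re s - 2 * e)) / e * norm (f x)"
            using True e h0 n0[of "n + n0"]
            by (intro mult_right_mono norm_powr_difference_quotient_le) auto
          also have "\<dots> = w x" by (simp add: w_def add_divide_distrib distrib_right)
          finally show ?thesis using True by (simp add: norm_mult norm_divide)
        qed auto
      qed
    qed measurable
    moreover have "eventually (\<lambda>n. (LINT x|lborel. indicator {0<..} x *\<^sub>R (((of_real x powr (s + h (n + n0)) - of_real x powr s) / h (n + n0)) * f x)) =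
        (M (X (n + n0)) - M s) / (X (n + n0) - s)) sequentially"
    proof (rule always_eventually, rule allI)
      fix n
      define z where "z = X (n + n0)"
      have zs: "z = s + h (n + n0)" by (simp add: z_def h_def)
      have "\<bar>Re (h (n + n0))\<bar> < e" using n0[of "n + n0"] abs_Re_le_cmod[of "h (n + n0)"] by simp
      then have z: "\<alpha> < Re z" "Re z < \<beta>" using e by (auto simp: zs abs_less_iff)
      have "M z - M s = (LINT x:{0<..}|lborel. of_real x powr z * f x - of_real x powr s * f x)"
        unfolding M_def using i[OF z] i[of s] s by (intro set_integral_diff(2)[symmetric]) auto
      then have "(M z - M s) / h (n + n0) = (LINT x:{0<..}|lborel. (of_real x powr z * f x - of_real x powr s * f x) / h (n + n0))"
        by simp
      also have "\<dots> = (LINT x|lborel. indicator {0<..} x *\<^sub>R (((of_real x powr (s + h (n + n0)) - of_real x powr s) / h (n + n0)) * f x))"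
        unfolding set_lebesgue_integral_def zs by (simp add: left_diff_distrib)
      finally show "(LINT x|lborel. indicator {0<..} x *\<^sub>R (((of_real x powr (s + h (n + n0)) - of_real x powr s) / h (n + n0)) * f x)) =
        (M (X (n + n0)) - M s) / (X (n + n0) - s)" by (simp add: z_def h_def)
    qed
    ultimately have "(\<lambda>n. (M (X (n + n0)) - M s) / (X (n + n0) - s)) \<longlonglongrightarrow> M'"
      unfolding M'_def set_lebesgue_integral_def by (rule Lim_transform_eventually)
    then have "(\<lambda>n. (M (X n) - M s) / (X n - s)) \<longlonglongrightarrow> M'" by (rule LIMSEQ_offset)
    then show "((\<lambda>z. (M z - M s) / (z - s)) \<circ> X) \<longlonglongrightarrow> M'" by (simp add: o_def)
  qed
  then have "(M has_field_derivative M') (at s)" by (simp add: has_field_derivative_iff)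
  then show "(\<lambda>s. LINT x:{0<..}|lborel. of_real x powr s * f x) field_differentiable at s within {s. \<alpha> < Re s \<and> Re s < \<beta>}"
    unfolding M_def field_differentiable_def by (blast intro: has_field_derivative_at_within)
qed

section \<open>The kernel \<open>g\<close> and its Mellin transform\<close>

text \<open>Indicators make the dependence on \<open>y\<close> explicit: measurability follows, and
  the Mellin integral can be taken term by term.\<close>

lemma g_eq_suminf: "g y = (\<Sum>n. real_of_int (moebius_mu (Suc n)) / real (Suc n) * indicator {real (Suc n)..} y)"
proof -
  have "(\<Sum>n. real_of_int (moebius_mu (Suc n)) / real (Suc n) * indicator {real (Suc n)..} y) =
     (\<Sum>n | real (Suc n) \<le> y. real_of_int (moebius_mu (Suc n)) / real (Suc n) * indicator {real (Suc n)..} y)"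
  proof (rule suminf_finite)
    have "{n. real (Suc n) \<le> y} \<subseteq> {..nat \<lceil>y\<rceil>}"
    proof
      fix n assume "n \<in> {n. real (Suc n) \<le> y}"
      then have "real n \<le> y" by simp
      then show "n \<in> {..nat \<lceil>y\<rceil>}" by (simp add: le_nat_iff) linarith
    qed
    then show "finite {n. real (Suc n) \<le> y}" by (rule finite_subset) simp
  qed auto
  also have "\<dots> = (\<Sum>n | real (Suc n) \<le> y. real_of_int (moebius_mu (Suc n)) / real (Suc n))"
    by (intro sum.cong) auto
  also have "\<dots> = g y"
  proof -
    have "{n. 1 \<le> n \<and> real n \<le> y} = Suc ` {n. real (Suc n) \<le> y}"
      by (auto simp: image_iff) (metis Suc_pred less_eq_Suc_le of_nat_Suc One_nat_def)
    then show ?thesis unfolding g_def by (simp add: sum.reindex)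
  qed
  finally show ?thesis by simp
qed

lemma borel_measurable_g [measurable]: "g \<in> borel_measurable borel"
  unfolding g_eq_suminf[abs_def] by measurable

lemma abs_g_le_ln:
  assumes "y \<ge> 1"
  shows "\<bar>g y\<bar> \<le> 1 + ln y"
proof -
  define N where "N = nat \<lfloor>y\<rfloor>"
  have "\<bar>g y\<bar> = norm (complex_of_real (g (real N)))"
    using assms g_eq_floor[of y] by (simp add: N_def)
  also have "\<dots> \<le> (\<Sum>n<N. norm (of_int (moebius_mu (Suc n)) / of_nat (Suc n) :: complex))"
    unfolding g_of_nat_eq_sum by (rule norm_sum)
  also have "\<dots> \<le> (\<Sum>n<N. 1 / real (Suc n))"
  proof (intro sum_mono)
    fix n
    have "norm (of_int (moebius_mu (Suc n)) :: complex) \<le> 1" by (rule norm_moebius_mu_le)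
    then show "norm (of_int (moebius_mu (Suc n)) / of_nat (Suc n) :: complex) \<le> 1 / real (Suc n)"
      by (simp add: norm_divide divide_right_mono del: of_nat_Suc)
  qed
  also have "\<dots> \<le> 1 + ln (real N)"
  proof -
    have "N \<ge> 1 \<Longrightarrow> (\<Sum>n<N. 1 / real (Suc n)) \<le> 1 + ln (real N)"
    proof (induction N rule: dec_induct)
      case (step m)
      have "ln (real m / (real m + 1)) \<le> real m / (real m + 1) - 1" using step by (intro ln_le_minus_one) auto
      then have "1 / (real m + 1) \<le> ln (real m + 1) - ln (real m)" using step by (simp add: ln_div field_simps)
      then show ?case using step by (simp add: add.commute)
    qed simp
    moreover have "N \<ge> 1"
    proof -
      have "(1::int) \<le> \<lfloor>y\<rfloor>" using assms by (simp add: le_floor_iff)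
      then show ?thesis unfolding N_def by linarith
    qed
    ultimately show ?thesis by blast
  qed
  also have "\<dots> \<le> 1 + ln y"
  proof -
    have "(1::int) \<le> \<lfloor>y\<rfloor>" using assms by (simp add: le_floor_iff)
    then have "0 < real N" "real N \<le> y" unfolding N_def using assms by linarith+
    then show ?thesis using ln_le_cancel_iff[of "real N" y] by linarith
  qed
  finally show ?thesis .
qed

text \<open>\<open>1 + z \<le> exp z\<close> at \<open>z = a * ln y\<close> trades the logarithmic
  bound for an arbitrarily small power; below 1 the function \<open>g\<close> vanishes.\<close>

lemma abs_g_le_powr:
  assumes a: "0 < a" "a \<le> 1" and y: "y > 0"
  shows "\<bar>g y\<bar> \<le> y powr a / a"
proof (cases "y < 1")
  case True
  then show ?thesis using a by (simp add: g_eq_0)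
next
  case False
  then have "\<bar>g y\<bar> \<le> 1 + ln y" by (intro abs_g_le_ln) simp
  moreover have "a * (1 + ln y) \<le> 1 + a * ln y" using a by (simp add: distrib_left)
  moreover have "1 + a * ln y \<le> exp (a * ln y)" by (rule exp_ge_add_one_self)
  moreover have "exp (a * ln y) = y powr a" using y by (simp add: powr_def)
  moreover have "a * \<bar>g y\<bar> \<le> a * (1 + ln y)" using a \<open>\<bar>g y\<bar> \<le> 1 + ln y\<close> by (intro mult_left_mono) auto
  ultimately have "a * \<bar>g y\<bar> \<le> y powr a" by linarith
  then show ?thesis using a by (simp add: field_simps)
qed

lemma nn_integral_abs_g_reciprocal_le:
  assumes \<sigma>: "0 < \<sigma>" "\<sigma> < 1" and t: "t > 0"
  shows "(\<integral>\<^sup>+x\<in>{0<..}. ennreal (x powr (\<sigma> - 1) * \<bar>g (t / x)\<bar>) \<partial>lborel) \<le> ennreal (4 / \<sigma>\<^sup>2 * t powr \<sigma>)"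
proof -
  \<comment> \<open>Half of the exponent pays for the growth of \<open>g\<close>, the other half
    keeps \<open>x powr (b - 1)\<close> integrable at 0. Beyond \<open>t\<close> the kernel
    \<open>g (t / x)\<close> vanishes.\<close>
  define b where "b = \<sigma> / 2"
  have b: "0 < b" "b \<le> 1" "\<sigma> - b = b" using \<sigma> by (auto simp: b_def)
  have "(\<integral>\<^sup>+x\<in>{0<..}. ennreal (x powr (\<sigma> - 1) * \<bar>g (t / x)\<bar>) \<partial>lborel) \<le>
     (\<integral>\<^sup>+x. ennreal (t powr b / b) * (ennreal (x powr (b - 1)) * indicator {0..t} x) \<partial>lborel)"
  proof (intro nn_integral_mono)
    fix x :: real
    consider "x \<le> 0" | "x > t" "x > 0" | "0 < x" "x \<le> t" by linarith
    then show "ennreal (x powr (\<sigma> - 1) * \<bar>g (t / x)\<bar>) * indicator {0<..} x \<le>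
       ennreal (t powr b / b) * (ennreal (x powr (b - 1)) * indicator {0..t} x)"
    proof cases
      case 2
      then have "g (t / x) = 0" by (intro g_eq_0) simp
      then show ?thesis by simp
    next
      case 3
      have "x powr (\<sigma> - 1) * \<bar>g (t / x)\<bar> \<le> x powr (\<sigma> - 1) * ((t / x) powr b / b)"
        using 3 t b by (intro mult_left_mono abs_g_le_powr) auto
      also have "\<dots> = t powr b / b * (x powr (\<sigma> - 1) * x powr - b)"
        using 3 t by (simp add: powr_divide powr_minus field_simps)
      also have "x powr (\<sigma> - 1) * x powr - b = x powr (b - 1)"
        using b by (simp add: powr_add[symmetric])
      finally show ?thesis using 3 b by (simp add: ennreal_mult'[symmetric] ennreal_leI)
    qed simp
  qed
  also have "\<dots> = ennreal (t powr b / b) * ennreal (t powr (b - 1 + 1) / (b - 1 + 1))"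
    using t b by (subst nn_integral_cmult) (auto simp: set_nn_integral_powr_0_c)
  also have "\<dots> = ennreal (t powr b / b * (t powr b / b))" using b by (simp add: ennreal_mult'[symmetric])
  also have "t powr b / b * (t powr b / b) = 4 / \<sigma>\<^sup>2 * t powr \<sigma>"
  proof -
    have "t powr b * t powr b = t powr \<sigma>" using b by (simp add: powr_add[symmetric] b_def)
    then show ?thesis using \<sigma> by (simp add: b_def power2_eq_square field_simps)
  qed
  finally show ?thesis .
qed

lemma has_integral_powr_complex:
  assumes s: "Re s > 0" and b: "b > 0"
  shows "((\<lambda>x. of_real x powr (s - 1)) has_integral (of_real b powr s / s)) {0..b}"
    and "(\<lambda>x. of_real x powr (s - 1) :: complex) absolutely_integrable_on {0..b}"
proof -
  have s0: "s \<noteq> 0" using s by auto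
  have "((\<lambda>x. of_real x powr (s - 1)) has_integral (of_real b powr s / s - of_real 0 powr s / s)) {0..b}"
  proof (rule fundamental_theorem_of_calculus_interior)
    show "continuous_on {0..b} (\<lambda>x. of_real x powr s / s)"
    proof (intro continuous_on_divide continuous_on_const)
      show "continuous_on {0..b} (\<lambda>x. complex_of_real x powr s)"
        using s by (intro continuous_on_powr_complex continuous_intros) auto
    qed (use s0 in auto)
    fix x assume x: "x \<in> {0<..<b}"
    have "((\<lambda>z. z powr s / s) has_field_derivative s * of_real x powr (s - 1) / s) (at (of_real x))"
      using x by (intro DERIV_cdivide has_field_derivative_powr) auto
    from has_vector_derivative_real_field[OF this]
    show "((\<lambda>x. of_real x powr s / s) has_vector_derivative of_real x powr (s - 1)) (at x)"
      using s0 by simp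
  qed (use b in auto)
  then show I: "((\<lambda>x. of_real x powr (s - 1)) has_integral (of_real b powr s / s)) {0..b}" by simp
  have "(\<lambda>x. x powr (Re s - 1)) integrable_on {0..b}"
    using has_integral_powr_from_0[of "Re s - 1" b] s b by (auto simp: has_integral_integrable)
  moreover have "norm (of_real x powr (s - 1) :: complex) = x powr (Re s - 1)" if "x \<in> {0..b}" for x
    using that by (cases "x = 0") (auto simp: norm_of_real_powr)
  ultimately show "(\<lambda>x. of_real x powr (s - 1) :: complex) absolutely_integrable_on {0..b}"
    using I by (intro absolutely_integrable_onI) (auto intro: integrable_eq)
qed

text \<open>The condition \<open>n \<le> t / x\<close> reads \<open>x \<le> t / n\<close>, so the
  term of index \<open>n\<close> in \<open>g\<close> contributes the \<open>s\<close>-th power of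
  \<open>t / n\<close> over \<open>s\<close>, and the sum over \<open>n\<close> is the Moebius
  series at \<open>1 + s\<close>. The norms of the terms are O(n powr - (1 + Re s)), which justifies
  the exchange.\<close>

lemma integral_powr_g_reciprocal:
  assumes s: "0 < Re s" and t: "t > 0"
  shows "(LINT x:{0<..}|lborel. of_real x powr (s - 1) * of_real (g (t / x))) = of_real t powr s / reg_zeta s"
proof -
  define c where "c = (\<lambda>n. of_int (moebius_mu (Suc n)) / of_nat (Suc n) :: complex)"
  have c: "norm (c n) \<le> 1 / real (Suc n)" for n
  proof -
    have "norm (of_int (moebius_mu (Suc n)) :: complex) \<le> 1" by (rule norm_moebius_mu_le)
    then show ?thesis by (simp add: c_def norm_divide divide_right_mono del: of_nat_Suc)
  qed
  define b where "b = (\<lambda>n. t / real (Suc n))"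
  have b: "b n > 0" for n using t by (simp add: b_def)
  define f where "f = (\<lambda>n x. c n * (indicator {0..b n} x *\<^sub>R of_real x powr (s - 1)))"
  have ai: "set_integrable lborel {0..b n} (\<lambda>x. of_real x powr (s - 1) :: complex)" for n
    using has_integral_powr_complex(2)[OF s b[of n]] unfolding set_integrable_def
    by (subst (asm) integrable_completion) auto
  have f_int: "integrable lborel (f n)" for n
    unfolding f_def using ai[of n] by (intro integrable_mult_right) (simp add: set_integrable_def)
  have f_val: "integral\<^sup>L lborel (f n) = c n * (of_real (b n) powr s / s)" for n
  proof -
    have "(LINT x:{0..b n}|lebesgue. of_real x powr (s - 1) :: complex) = of_real (b n) powr s / s"
      using has_integral_powr_complex[OF s b[of n]]
      by (simp add: set_lebesgue_integral_eq_integral integral_unique)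
    then have "(LINT x:{0..b n}|lborel. of_real x powr (s - 1) :: complex) = of_real (b n) powr s / s"
      unfolding set_lebesgue_integral_def by (subst (asm) integral_completion) auto
    then show ?thesis unfolding f_def set_lebesgue_integral_def by (subst integral_mult_right_zero) simp
  qed
  have f_norm: "(LINT x|lborel. norm (f n x)) \<le> real (Suc n) powr - (Re s + 1) * (t powr Re s / Re s)" for n
  proof -
    have "(LINT x|lborel. norm (f n x)) = norm (c n) * (LINT x|lborel. indicator {0..b n} x *\<^sub>R x powr (Re s - 1))"
    proof -
      have "norm (f n x) = norm (c n) * (indicator {0..b n} x *\<^sub>R x powr (Re s - 1))" for x
        by (cases "x = 0") (auto simp: f_def norm_mult indicator_def norm_of_real_powr)
      then show ?thesis by simp
    qed
    also have "(LINT x|lborel. indicator {0..b n} x *\<^sub>R x powr (Re s - 1)) = b n powr Re s / Re s"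
    proof -
      have "(LINT x|lborel. indicator {0..b n} x *\<^sub>R x powr (Re s - 1)) =
         enn2real (\<integral>\<^sup>+x. ennreal (indicator {0..b n} x *\<^sub>R x powr (Re s - 1)) \<partial>lborel)"
        by (rule integral_eq_nn_integral) (auto simp: indicator_def)
      also have "(\<integral>\<^sup>+x. ennreal (indicator {0..b n} x *\<^sub>R x powr (Re s - 1)) \<partial>lborel) = (\<integral>\<^sup>+x\<in>{0..b n}. ennreal (x powr (Re s - 1)) \<partial>lborel)"
        by (intro nn_integral_cong) (auto simp: indicator_def)
      also have "\<dots> = ennreal (b n powr Re s / Re s)"
        using set_nn_integral_powr_0_c[of "Re s - 1" "b n"] s b[of n] by simp
      finally show ?thesis using s by simp
    qed
    also have "norm (c n) * (b n powr Re s / Re s) \<le> 1 / real (Suc n) * (b n powr Re s / Re s)"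
      using s by (intro mult_right_mono c) auto
    also have "\<dots> = real (Suc n) powr - (Re s + 1) * (t powr Re s / Re s)"
    proof -
      have "real (Suc n) powr - (Re s + 1) = 1 / (real (Suc n) powr Re s * real (Suc n))"
        unfolding powr_minus powr_add by (simp add: divide_inverse del: of_nat_Suc)
      then show ?thesis using t by (simp add: b_def powr_divide del: of_nat_Suc)
    qed
    finally show ?thesis .
  qed
  have sm: "summable (\<lambda>n. LINT x|lborel. norm (f n x))"
  proof (rule summable_comparison_test)
    show "summable (\<lambda>n. real (Suc n) powr - (Re s + 1) * (t powr Re s / Re s))"
      using s by (intro summable_mult2 summable_Suc_powr) auto
    show "\<exists>N. \<forall>n\<ge>N. norm (LINT x|lborel. norm (f n x)) \<le> real (Suc n) powr - (Re s + 1) * (t powr Re s / Re s)"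
      using f_norm by (intro exI[of _ 0]) simp
  qed
  have f_zero: "f n x = 0" if "x > 0" "n \<ge> nat \<lceil>t / x\<rceil>" for n x
  proof -
    have "real n \<ge> t / x" using that(2) by linarith
    then have "real (Suc n) > t / x" by simp
    then have "x > b n" using that(1) by (simp add: b_def field_simps)
    then show ?thesis by (simp add: f_def)
  qed
  have "(\<lambda>n. integral\<^sup>L lborel (f n)) sums (LINT x|lborel. (\<Sum>n. f n x))"
  proof (rule sums_integral[OF f_int _ sm])
    show "AE x in lborel. summable (\<lambda>n. norm (f n x))"
    proof (rule AE_I2)
      fix x :: real
      show "summable (\<lambda>n. norm (f n x))"
      proof (cases "x > 0")
        case True
        then show ?thesis using f_zero[OF True]
          by (intro summable_finite[of "{..<nat \<lceil>t / x\<rceil>}"]) (auto simp: not_less)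
      next
        case False
        \<comment> \<open>\<open>0 powr z\<close> is 0, so the closed end point 0 of
          \<open>{0..b n}\<close> contributes nothing.\<close>
        then have "f n x = 0" for n by (cases "x = 0") (auto simp: f_def indicator_def)
        then show ?thesis by simp
      qed
    qed
  qed
  also have "(LINT x|lborel. (\<Sum>n. f n x)) = (LINT x:{0<..}|lborel. of_real x powr (s - 1) * of_real (g (t / x)))"
    unfolding set_lebesgue_integral_def
  proof (rule Bochner_Integration.integral_cong[OF refl])
    fix x :: real
    show "(\<Sum>n. f n x) = indicator {0<..} x *\<^sub>R (of_real x powr (s - 1) * of_real (g (t / x)))"
    proof (cases "x > 0")
      case True
      have fn: "f n x = of_real x powr (s - 1) * of_real (real_of_int (moebius_mu (Suc n)) / real (Suc n) * indicator {real (Suc n)..} (t / x))" for n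
      proof -
        have "x \<le> b n \<longleftrightarrow> real (Suc n) \<le> t / x" using True by (simp add: b_def field_simps)
        then show ?thesis using True by (simp add: f_def c_def indicator_def del: of_nat_Suc)
      qed
      have sf: "summable (\<lambda>n. real_of_int (moebius_mu (Suc n)) / real (Suc n) * indicator {real (Suc n)..} (t / x))"
      proof (rule summable_finite[of "{..<nat \<lceil>t / x\<rceil>}"])
        fix n assume "n \<notin> {..<nat \<lceil>t / x\<rceil>}"
        then have "real n \<ge> t / x" by auto linarith
        then show "real_of_int (moebius_mu (Suc n)) / real (Suc n) * indicator {real (Suc n)..} (t / x) = 0"
          by (simp add: indicator_def)
      qed simp
      have "(\<Sum>n. f n x) = of_real x powr (s - 1) * of_real (\<Sum>n. real_of_int (moebius_mu (Suc n)) / real (Suc n) * indicator {real (Suc n)..} (t / x))"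
        unfolding fn using sf by (subst suminf_mult) (auto simp only: summable_of_real suminf_of_real)
      then show ?thesis unfolding g_eq_suminf[symmetric] using True by simp
    next
      case False
      then have "f n x = 0" for n by (cases "x = 0") (auto simp: f_def indicator_def)
      then show ?thesis using False by simp
    qed
  qed
  finally have sums1: "(\<lambda>n. c n * (of_real (b n) powr s / s)) sums (LINT x:{0<..}|lborel. of_real x powr (s - 1) * of_real (g (t / x)))"
    by (simp only: f_val)
  have "summable (\<lambda>n. norm (of_int (moebius_mu (Suc n)) / of_nat (Suc n) powr (1 + s) :: complex))"
  proof (rule dirichlet_summable)
    fix n :: nat assume "n > 0"
    have "norm (of_int (moebius_mu n) :: complex) \<le> 1" by (rule norm_moebius_mu_le)
    then show "norm (of_int (moebius_mu n) :: complex) \<le> 1 + ln (real n)"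
      using \<open>n > 0\<close> ln_ge_zero[of "real n"] by linarith
  qed (use s in simp)
  from summable_sums[OF summable_norm_cancel[OF this]]
  have "(\<lambda>n. of_int (moebius_mu (Suc n)) / of_nat (Suc n) powr (1 + s) * (of_real t powr s / s)) sums
      (dirichlet (\<lambda>n. of_int (moebius_mu n)) (1 + s) * (of_real t powr s / s))"
    unfolding dirichlet_def by (rule sums_mult2)
  moreover have "of_int (moebius_mu (Suc n)) / of_nat (Suc n) powr (1 + s) * (of_real t powr s / s) =
      c n * (of_real (b n) powr s / s)" for n
  proof -
    have "complex_of_real t powr s = (of_real (b n) * of_nat (Suc n)) powr s"
      by (simp add: b_def del: of_nat_Suc)
    also have "\<dots> = of_real (b n) powr s * of_nat (Suc n) powr s"
      using b[of n] by (intro powr_times_real) auto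
    finally show ?thesis by (simp add: c_def powr_add del: of_nat_Suc)
  qed
  ultimately have "(LINT x:{0<..}|lborel. of_real x powr (s - 1) * of_real (g (t / x))) =
      dirichlet (\<lambda>n. of_int (moebius_mu n)) (1 + s) * (of_real t powr s / s)"
    using sums1 by (simp only: sums_unique2)
  also have "dirichlet (\<lambda>n. of_int (moebius_mu n)) (1 + s) = 1 / riemann_zeta (1 + s)"
    using dirichlet_moebius_times_zeta_series[of "1 + s"] s riemann_zeta_eq_series[of "1 + s"]
      zeta_series_nonzero[of "1 + s"] by (simp add: field_simps)
  also have "1 / riemann_zeta (1 + s) * (of_real t powr s / s) = of_real t powr s / reg_zeta s"
    using s by (auto simp: reg_zeta_def)
  finally show ?thesis .
qed

section \<open>The transform \<open>h \<mapsto> x\<^sup>-\<^sup>1 \<integral> g(t/x) h(t) dt\<close>\<close>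

text \<open>For \<open>h t = \<phi> (1 / t) / t\<close> this is the function \<open>\<psi>\<close>:
  the argument \<open>1 / x\<close> of \<open>G_op\<close> enters the kernel as
  \<open>t / x\<close>.\<close>

definition g_transform :: "(real \<Rightarrow> complex) \<Rightarrow> real \<Rightarrow> complex" where
  "g_transform h x = (LINT t:{0<..}|lborel. of_real (g (t / x)) * h t) / of_real x"

lemma borel_measurable_g_transform [measurable]:
  assumes [measurable]: "h \<in> borel_measurable borel"
  shows "g_transform h \<in> borel_measurable borel"
  unfolding g_transform_def[abs_def] set_lebesgue_integral_def by measurable

text \<open>Inverting the variable turns the weight \<open>t powr (- s - 1)\<close> on
  \<open>\<phi>\<close> into \<open>t powr s\<close> on \<open>\<phi> (1 / t) / t\<close>. A Borel
  representative \<open>h\<close> of that function is chosen so that Fubini's theorem can be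
  applied; the integrals do not see the difference.\<close>

lemma proper_fun_kernel:
  assumes "proper_fun \<phi>"
  obtains h where "h \<in> borel_measurable borel"
    and "\<And>\<sigma>. - 1/2 < \<sigma> \<Longrightarrow> \<sigma> \<le> 1 \<Longrightarrow> set_integrable lborel {0<..} (\<lambda>t. t powr \<sigma> * norm (h t))"
    and "\<And>s. - 1/2 < Re s \<Longrightarrow> Re s \<le> 1 \<Longrightarrow> mellin \<phi> s = (LINT t:{0<..}|lborel. of_real t powr s * h t)"
    and "\<And>x. x > 0 \<Longrightarrow> G_op \<phi> (1 / x) / of_real x = g_transform h x"
proof -
  have meas: "(\<lambda>t. indicator {0<..} t *\<^sub>R \<phi> t) \<in> borel_measurable lebesgue"
    using assms by (simp add: proper_fun_def set_borel_measurable_def)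
  have int: "set_integrable lebesgue {0<..} (\<lambda>x. of_real x powr (- s - 1) * \<phi> x)"
    if s: "- 1/2 < Re s" "Re s \<le> 1" for s
    unfolding set_integrable_def
  proof (rule integrableI_bounded)
    have "(\<lambda>x. complex_of_real x powr (- s - 1)) \<in> borel_measurable lborel" by measurable
    then have "(\<lambda>x. complex_of_real x powr (- s - 1)) \<in> borel_measurable lebesgue" by (rule measurable_completion)
    from borel_measurable_times[OF this meas]
    show "(\<lambda>x. indicator {0<..} x *\<^sub>R (of_real x powr (- s - 1) * \<phi> x)) \<in> borel_measurable lebesgue"
      by (simp add: mult.commute mult.left_commute)
    have "(\<integral>\<^sup>+x. ennreal (norm (indicator {0<..} x *\<^sub>R (of_real x powr (- s - 1) * \<phi> x))) \<partial>lebesgue) = mellin_norm (Re s) \<phi>"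
      unfolding mellin_norm_def
      by (intro nn_integral_cong) (auto simp: indicator_def norm_mult norm_of_real_powr)
    also have "\<dots> < \<infinity>" using assms s by (simp add: proper_fun_def)
    finally show "(\<integral>\<^sup>+x. ennreal (norm (indicator {0<..} x *\<^sub>R (of_real x powr (- s - 1) * \<phi> x))) \<partial>lebesgue) < \<infinity>" .
  qed
  define H where "H = (\<lambda>t. indicator {0<..} t *\<^sub>R (\<phi> (1 / t) / complex_of_real t))"
  have subst: "indicator {0<..} t *\<^sub>R (of_real (1 / t\<^sup>2) * (of_real (1 / t) powr (- s - 1) * \<phi> (1 / t))) = of_real t powr s * H t" for t s
  proof (cases "t > 0")
    case True
    have "complex_of_real (1 / t) powr (- s - 1) = of_real t powr (s + 1)"
      using True by (simp add: powr_def Ln_of_real ln_div exp_minus algebra_simps del: of_real_divide)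
    then show ?thesis using True by (simp add: H_def powr_add power2_eq_square del: of_real_divide) (simp add: field_simps)
  qed (simp add: H_def)
  have Hint: "integrable lebesgue (\<lambda>t. of_real t powr s * H t)" "mellin \<phi> s = (LINT t|lebesgue. of_real t powr s * H t)"
    if s: "- 1/2 < Re s" "Re s \<le> 1" for s
    using set_integral_reciprocal_substitution[OF int[OF s]]
    unfolding set_integrable_def set_lebesgue_integral_def subst mellin_def by auto
  \<comment> \<open>Measurability of \<open>H\<close> is read off from the Mellin integrand at
    \<open>s = 0\<close>, whose power is 1 except at 0, where \<open>H\<close> itself
    vanishes.\<close>
  have "(\<lambda>t. of_real t powr 0 * H t) \<in> borel_measurable lebesgue" using Hint(1)[of 0] by (simp add: borel_measurable_integrable)
  moreover have "(\<lambda>t. of_real t powr 0 * H t) = H" by (rule ext) (simp add: H_def)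
  ultimately have Hm: "H \<in> borel_measurable lebesgue" by (simp only:)
  from lebesgue_measurable_AE_eq_borel[OF Hm] obtain h where h [measurable]: "h \<in> borel_measurable borel"
    and eq: "AE t in lborel. H t = h t" by blast
  have AE: "AE t in lebesgue. H t = indicator {0<..} t *\<^sub>R h t"
    using AE_completion[OF eq] by eventually_elim (auto simp: H_def indicator_def split: if_splits)
  have h_leb: "(\<lambda>t. u t * (indicator {0<..} t *\<^sub>R h t)) \<in> borel_measurable lborel"
    if [measurable]: "u \<in> borel_measurable borel" for u :: "real \<Rightarrow> complex" by measurable
  have leb: "(\<lambda>t. u t * (indicator {0<..} t *\<^sub>R h t)) \<in> borel_measurable lebesgue"
      "(\<lambda>t. u t * H t) \<in> borel_measurable lebesgue"
    if u: "u \<in> borel_measurable borel" for u :: "real \<Rightarrow> complex"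
  proof -
    show "(\<lambda>t. u t * (indicator {0<..} t *\<^sub>R h t)) \<in> borel_measurable lebesgue"
      using h_leb[OF u] by (rule measurable_completion)
    have "u \<in> borel_measurable lebesgue" using u by (intro measurable_completion) simp
    then show "(\<lambda>t. u t * H t) \<in> borel_measurable lebesgue" using Hm by (intro borel_measurable_times)
  qed
  have trans: "(LINT t|lebesgue. u t * H t) = (LINT t:{0<..}|lborel. u t * h t)"
      "integrable lebesgue (\<lambda>t. u t * H t) \<longleftrightarrow> set_integrable lborel {0<..} (\<lambda>t. u t * h t)"
    if u: "u \<in> borel_measurable borel" for u :: "real \<Rightarrow> complex"
  proof -
    have ae: "AE t in lebesgue. u t * H t = u t * (indicator {0<..} t *\<^sub>R h t)"
      using AE by eventually_elim simp
    have "(LINT t|lebesgue. u t * H t) = (LINT t|lebesgue. u t * (indicator {0<..} t *\<^sub>R h t))"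
      by (rule integral_cong_AE[OF leb(2)[OF u] leb(1)[OF u] ae])
    also have "\<dots> = (LINT t|lborel. u t * (indicator {0<..} t *\<^sub>R h t))"
      by (rule integral_completion[OF h_leb[OF u]])
    finally show "(LINT t|lebesgue. u t * H t) = (LINT t:{0<..}|lborel. u t * h t)"
      by (simp add: set_lebesgue_integral_def)
    have "integrable lebesgue (\<lambda>t. u t * H t) \<longleftrightarrow> integrable lebesgue (\<lambda>t. u t * (indicator {0<..} t *\<^sub>R h t))"
      by (rule integrable_cong_AE[OF leb(2)[OF u] leb(1)[OF u] ae])
    also have "\<dots> \<longleftrightarrow> integrable lborel (\<lambda>t. u t * (indicator {0<..} t *\<^sub>R h t))"
      by (rule integrable_completion[OF h_leb[OF u]])
    finally show "integrable lebesgue (\<lambda>t. u t * H t) \<longleftrightarrow> set_integrable lborel {0<..} (\<lambda>t. u t * h t)"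
      by (simp add: set_integrable_def)
  qed
  have powr_m: "(\<lambda>t. complex_of_real t powr s) \<in> borel_measurable borel" for s by measurable
  show ?thesis
  proof (rule that[OF h])
    fix \<sigma> :: real assume "- 1/2 < \<sigma>" "\<sigma> \<le> 1"
    then show "set_integrable lborel {0<..} (\<lambda>t. t powr \<sigma> * norm (h t))"
      using Hint(1)[of "of_real \<sigma>"] trans(2)[OF powr_m, of "of_real \<sigma>"] set_integrable_powr_mult_iff[OF h, of "of_real \<sigma>"] by simp
  next
    fix s assume "- 1/2 < Re s" "Re s \<le> 1"
    then show "mellin \<phi> s = (LINT t:{0<..}|lborel. of_real t powr s * h t)"
      using Hint(2)[of s] trans(1)[OF powr_m, of s] by simp
  next
    fix x :: real assume "x > 0"
    have "(\<lambda>t. complex_of_real (g (1 / x * t))) \<in> borel_measurable borel" by measurable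
    from trans(1)[OF this] show "G_op \<phi> (1 / x) / of_real x = g_transform h x"
      by (simp add: G_op_def g_transform_def set_lebesgue_integral_def H_def)
  qed
qed

text \<open>A power bound on the kernel separates the variables in \<open>t / x\<close>. It is used
  with \<open>\<sigma> = 1\<close> for the decay at infinity and, under the Riemann hypothesis, with
  \<open>\<sigma> = - a\<close> near 0.\<close>

lemma norm_g_transform_le:
  assumes h [measurable]: "h \<in> borel_measurable borel"
    and int: "set_integrable lborel {0<..} (\<lambda>t. t powr \<sigma> * norm (h t))"
    and g: "\<And>y. y > 0 \<Longrightarrow> \<bar>g y\<bar> \<le> C * y powr \<sigma>" and x: "x > 0"
  shows "norm (g_transform h x) \<le> C * (LINT t:{0<..}|lborel. t powr \<sigma> * norm (h t)) * x powr (- 1 - \<sigma>)"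
proof -
  define c where "c = C * x powr - \<sigma>"
  have bd: "norm (indicator {0<..} t *\<^sub>R (of_real (g (t / x)) * h t)) \<le> c * (indicator {0<..} t *\<^sub>R (t powr \<sigma> * norm (h t)))" for t
  proof (cases "t > 0")
    case True
    have "\<bar>g (t / x)\<bar> * norm (h t) \<le> C * (t / x) powr \<sigma> * norm (h t)"
      using True x by (intro mult_right_mono g) auto
    also have "(t / x) powr \<sigma> = x powr - \<sigma> * t powr \<sigma>" using True x by (simp add: powr_divide powr_minus field_simps)
    finally show ?thesis using True by (simp add: c_def norm_mult mult.assoc)
  qed simp
  have int': "integrable lborel (\<lambda>t. c * (indicator {0<..} t *\<^sub>R (t powr \<sigma> * norm (h t))))"
    using int unfolding set_integrable_def by (rule integrable_mult_right)
  have "norm (LINT t:{0<..}|lborel. of_real (g (t / x)) * h t) \<le> (LINT t|lborel. c * (indicator {0<..} t *\<^sub>R (t powr \<sigma> * norm (h t))))"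
    unfolding set_lebesgue_integral_def
  proof (rule Bochner_Integration.integral_norm_bound_integral[OF _ int' bd])
    show "integrable lborel (\<lambda>t. indicator {0<..} t *\<^sub>R (of_real (g (t / x)) * h t))"
    proof (rule Bochner_Integration.integrable_bound[OF int'])
      show "AE t in lborel. norm (indicator {0<..} t *\<^sub>R (of_real (g (t / x)) * h t)) \<le> norm (c * (indicator {0<..} t *\<^sub>R (t powr \<sigma> * norm (h t))))"
        using bd order_trans[OF bd abs_ge_self] by (intro AE_I2) simp
    qed measurable
  qed
  also have "\<dots> = c * (LINT t:{0<..}|lborel. t powr \<sigma> * norm (h t))"
    unfolding set_lebesgue_integral_def by (rule integral_mult_right_zero)
  finally have "norm (g_transform h x) \<le> c * (LINT t:{0<..}|lborel. t powr \<sigma> * norm (h t)) / x"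
    using x by (simp add: g_transform_def norm_divide divide_right_mono)
  also have "\<dots> = C * (LINT t:{0<..}|lborel. t powr \<sigma> * norm (h t)) * x powr (- 1 - \<sigma>)"
    using x by (simp add: c_def powr_diff powr_minus field_simps)
  finally show ?thesis .
qed

text \<open>After exchanging the integrals the inner one is
  \<open>integral_powr_g_reciprocal\<close>. Absolute convergence comes from
  \<open>nn_integral_abs_g_reciprocal_le\<close>, which needs \<open>Re s\<close> to be
  positive.\<close>

lemma mellin_g_transform:
  assumes h [measurable]: "h \<in> borel_measurable borel"
    and s: "0 < Re s" "Re s < 1"
    and int: "set_integrable lborel {0<..} (\<lambda>t. t powr Re s * norm (h t))"
  shows "(LINT x:{0<..}|lborel. of_real x powr s * g_transform h x) =
    (LINT t:{0<..}|lborel. of_real t powr s * h t) / reg_zeta s"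
proof -
  define f where "f = (\<lambda>(t, x). indicator {0<..} t *\<^sub>R indicator {0<..} x *\<^sub>R (of_real x powr (s - 1) * of_real (g (t / x)) * h t))"
  have [measurable]: "f \<in> borel_measurable (lborel \<Otimes>\<^sub>M lborel)" unfolding f_def by measurable
  have f_int: "integrable (lborel \<Otimes>\<^sub>M lborel) f"
  proof (rule integrableI_bounded)
    have "(\<integral>\<^sup>+p. ennreal (norm (f p)) \<partial>(lborel \<Otimes>\<^sub>M lborel)) = (\<integral>\<^sup>+t. (\<integral>\<^sup>+x. ennreal (norm (f (t, x))) \<partial>lborel) \<partial>lborel)"
      by (rule lborel.nn_integral_fst[symmetric]) measurable
    also have "\<dots> \<le> (\<integral>\<^sup>+t. ennreal (4 / (Re s)\<^sup>2) * ennreal (norm (indicator {0<..} t *\<^sub>R (t powr Re s * norm (h t)))) \<partial>lborel)"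
    proof (intro nn_integral_mono)
      fix t :: real
      show "(\<integral>\<^sup>+x. ennreal (norm (f (t, x))) \<partial>lborel) \<le>
         ennreal (4 / (Re s)\<^sup>2) * ennreal (norm (indicator {0<..} t *\<^sub>R (t powr Re s * norm (h t))))"
      proof (cases "t > 0")
        case True
        have "(\<integral>\<^sup>+x. ennreal (norm (f (t, x))) \<partial>lborel) =
            (\<integral>\<^sup>+x. ennreal (norm (h t)) * (ennreal (x powr (Re s - 1) * \<bar>g (t / x)\<bar>) * indicator {0<..} x) \<partial>lborel)"
          using True by (intro nn_integral_cong)
            (auto simp: f_def indicator_def norm_mult norm_of_real_powr ennreal_mult'[symmetric] mult_ac)
        also have "\<dots> = ennreal (norm (h t)) * (\<integral>\<^sup>+x\<in>{0<..}. ennreal (x powr (Re s - 1) * \<bar>g (t / x)\<bar>) \<partial>lborel)"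
          by (rule nn_integral_cmult) measurable
        also have "\<dots> \<le> ennreal (norm (h t)) * ennreal (4 / (Re s)\<^sup>2 * t powr Re s)"
          using s True by (intro mult_left_mono nn_integral_abs_g_reciprocal_le) auto
        finally show ?thesis using True by (simp add: ennreal_mult'[symmetric] mult_ac)
      qed (simp add: f_def)
    qed
    also have "\<dots> = ennreal (4 / (Re s)\<^sup>2) * (\<integral>\<^sup>+t. ennreal (norm (indicator {0<..} t *\<^sub>R (t powr Re s * norm (h t)))) \<partial>lborel)"
      by (rule nn_integral_cmult) measurable
    also have "\<dots> < \<infinity>"
      using int unfolding set_integrable_def integrable_iff_bounded by (simp add: ennreal_mult_less_top)
    finally show "(\<integral>\<^sup>+p. ennreal (norm (f p)) \<partial>(lborel \<Otimes>\<^sub>M lborel)) < \<infinity>" .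
  qed measurable
  have "(LINT x:{0<..}|lborel. of_real x powr s * g_transform h x) = (LINT x|lborel. (LINT t|lborel. f (t, x)))"
    unfolding set_lebesgue_integral_def
  proof (rule Bochner_Integration.integral_cong[OF refl])
    fix x :: real
    show "indicator {0<..} x *\<^sub>R (of_real x powr s * g_transform h x) = (LINT t|lborel. f (t, x))"
    proof (cases "x > 0")
      case True
      have "f (t, x) = of_real x powr (s - 1) * (indicator {0<..} t *\<^sub>R (of_real (g (t / x)) * h t))" for t
        using True by (simp add: f_def)
      then have "(LINT t|lborel. f (t, x)) = of_real x powr (s - 1) * (LINT t:{0<..}|lborel. of_real (g (t / x)) * h t)"
        unfolding set_lebesgue_integral_def by (simp only: integral_mult_right_zero)
      then show ?thesis using True by (simp add: g_transform_def powr_diff)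
    qed (simp add: f_def)
  qed
  also have "\<dots> = (LINT t|lborel. (LINT x|lborel. f (t, x)))"
    using lborel_pair.Fubini_integral[of "\<lambda>t x. f (t, x)"] f_int by simp
  also have "\<dots> = (LINT t|lborel. (indicator {0<..} t *\<^sub>R (of_real t powr s * h t)) / reg_zeta s)"
  proof (rule Bochner_Integration.integral_cong[OF refl])
    fix t :: real
    show "(LINT x|lborel. f (t, x)) = (indicator {0<..} t *\<^sub>R (of_real t powr s * h t)) / reg_zeta s"
    proof (cases "t > 0")
      case True
      have "f (t, x) = h t * (indicator {0<..} x *\<^sub>R (of_real x powr (s - 1) * of_real (g (t / x))))" for x
        using True by (simp add: f_def mult_ac)
      then have "(LINT x|lborel. f (t, x)) = h t * (LINT x:{0<..}|lborel. of_real x powr (s - 1) * of_real (g (t / x)))"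
        unfolding set_lebesgue_integral_def by (simp only: integral_mult_right_zero)
      then show ?thesis using True by (simp add: integral_powr_g_reciprocal[OF s(1) True])
    qed (simp add: f_def)
  qed
  also have "\<dots> = (LINT t:{0<..}|lborel. of_real t powr s * h t) / reg_zeta s"
    unfolding set_lebesgue_integral_def by (rule integral_divide_zero)
  finally show ?thesis .
qed

section \<open>\<open>L\<^sup>p\<close> estimates and the theorem\<close>

lemma Lp_norm_finite_iff:
  assumes f [measurable]: "f \<in> borel_measurable borel" and eq: "\<And>x. x > 0 \<Longrightarrow> \<psi> x = f x"
  shows "Lp_norm p \<psi> < \<infinity> \<longleftrightarrow> (\<integral>\<^sup>+x\<in>{0<..}. ennreal (norm (f x) powr p) \<partial>lborel) < \<infinity>"
proof -
  have "(\<integral>\<^sup>+x\<in>{0<..}. ennreal (cmod (\<psi> x) powr p) \<partial>lebesgue) = (\<integral>\<^sup>+x\<in>{0<..}. ennreal (norm (f x) powr p) \<partial>lebesgue)"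
    by (intro nn_integral_cong) (auto simp: eq indicator_def)
  also have "\<dots> = (\<integral>\<^sup>+x\<in>{0<..}. ennreal (norm (f x) powr p) \<partial>lborel)"
    by (rule nn_integral_completion)
  finally show ?thesis by (simp add: Lp_norm_def Let_def top.not_eq_extremum)
qed

lemma nn_integral_powr_p_finite:
  fixes f :: "real \<Rightarrow> complex"
  assumes p: "p \<ge> 1" and bp: "b * p < 1"
    and A: "\<And>x. x > 0 \<Longrightarrow> norm (f x) \<le> A * x powr - b"
    and C: "\<And>x. x > 0 \<Longrightarrow> norm (f x) \<le> C * x powr - 2"
  shows "(\<integral>\<^sup>+x\<in>{0<..}. ennreal (norm (f x) powr p) \<partial>lborel) < \<infinity>"
proof -
  have nn: "A \<ge> 0" "C \<ge> 0" using A[of 1] C[of 1] norm_ge_zero[of "f 1"] by (simp_all del: norm_ge_zero)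
  have bound: "norm (f x) powr p \<le> K powr p * x powr - (c * p)" if "norm (f x) \<le> K * x powr - c" "K \<ge> 0" "x > 0" for K c x
  proof -
    have "norm (f x) powr p \<le> (K * x powr - c) powr p" using that p by (intro powr_mono2) auto
    also have "\<dots> = K powr p * x powr - (c * p)" using that by (simp add: powr_mult powr_powr)
    finally show ?thesis .
  qed
  have "(\<integral>\<^sup>+x\<in>{0<..}. ennreal (norm (f x) powr p) \<partial>lborel) \<le>
      (\<integral>\<^sup>+x. ennreal (A powr p) * (ennreal (x powr - (b * p)) * indicator {0..1} x) +
         ennreal (C powr p) * (ennreal (x powr - (2 * p)) * indicator {1..} x) \<partial>lborel)"
  proof (intro nn_integral_mono)
    fix x :: real
    consider "x \<le> 0" | "0 < x" "x \<le> 1" | "x > 1" by linarith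
    then show "ennreal (norm (f x) powr p) * indicator {0<..} x \<le>
       ennreal (A powr p) * (ennreal (x powr - (b * p)) * indicator {0..1} x) +
         ennreal (C powr p) * (ennreal (x powr - (2 * p)) * indicator {1..} x)"
    proof cases
      case 2
      then have "ennreal (norm (f x) powr p) \<le> ennreal (A powr p * x powr - (b * p))"
        using nn by (intro ennreal_leI bound A) auto
      then show ?thesis using 2 by (simp add: ennreal_mult' add_increasing2)
    next
      case 3
      then have "ennreal (norm (f x) powr p) \<le> ennreal (C powr p * x powr - (2 * p))"
        using nn C by (intro ennreal_leI bound) auto
      then show ?thesis using 3 by (simp add: ennreal_mult')
    qed simp
  qed
  also have "\<dots> = ennreal (A powr p) * (\<integral>\<^sup>+x\<in>{0..1}. ennreal (x powr - (b * p)) \<partial>lborel) +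
      ennreal (C powr p) * (\<integral>\<^sup>+x\<in>{1..}. ennreal (x powr - (2 * p)) \<partial>lborel)"
    by (subst nn_integral_add) (auto simp: nn_integral_cmult)
  also have "\<dots> < \<infinity>"
    using set_nn_integral_powr_0_c[of "- (b * p)" 1] set_nn_integral_powr_1_inf[of "- (2 * p)"] p bp
    by (simp add: ennreal_mult_less_top)
  finally show ?thesis .
qed

text \<open>Near 0 Young's inequality is applied to the factors \<open>l * x powr \<sigma>\<close>
  and \<open>norm (f x) / l\<close>; the free scale \<open>l\<close> stands for the optimisation
  hidden in Hoelder's inequality and is fixed by the user of the lemma. Beyond 1 the inverse-square
  bound takes over.\<close>

lemma nn_integral_mellin_le_Lp:
  fixes f :: "real \<Rightarrow> complex"
  assumes f [measurable]: "f \<in> borel_measurable borel"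
    and pq: "p > 1" "q > 1" "1 / p + 1 / q = 1" and \<sigma>: "- 1 < \<sigma> * q" "\<sigma> < 1" and "l > 0" "I \<ge> 0"
    and I: "(\<integral>\<^sup>+x\<in>{0<..}. ennreal (norm (f x) powr p) \<partial>lborel) \<le> ennreal I"
    and C: "\<And>x. x > 0 \<Longrightarrow> norm (f x) \<le> C * x powr - 2"
  shows "(\<integral>\<^sup>+x\<in>{0<..}. ennreal (x powr \<sigma> * norm (f x)) \<partial>lborel) \<le>
    ennreal (l powr q / (\<sigma> * q + 1) + I / l powr p + C / (1 - \<sigma>))"
proof -
  have nn: "C \<ge> 0" using C[of 1] norm_ge_zero[of "f 1"] by (simp del: norm_ge_zero)
  have "(\<integral>\<^sup>+x\<in>{0<..}. ennreal (x powr \<sigma> * norm (f x)) \<partial>lborel) \<le>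
      (\<integral>\<^sup>+x. ennreal (l powr q) * (ennreal (x powr (\<sigma> * q)) * indicator {0..1} x) +
         (ennreal (1 / l powr p) * (ennreal (norm (f x) powr p) * indicator {0<..} x) +
         ennreal C * (ennreal (x powr (\<sigma> - 2)) * indicator {1..} x)) \<partial>lborel)"
  proof (intro nn_integral_mono)
    fix x :: real
    consider "x \<le> 0" | "0 < x" "x \<le> 1" | "x > 1" by linarith
    then show "ennreal (x powr \<sigma> * norm (f x)) * indicator {0<..} x \<le>
       ennreal (l powr q) * (ennreal (x powr (\<sigma> * q)) * indicator {0..1} x) +
         (ennreal (1 / l powr p) * (ennreal (norm (f x) powr p) * indicator {0<..} x) +
         ennreal C * (ennreal (x powr (\<sigma> - 2)) * indicator {1..} x))"
    proof cases
      case 2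
      define u v where "u = l * x powr \<sigma>" and "v = norm (f x) / l"
      have uv: "u \<ge> 0" "v \<ge> 0" using \<open>l > 0\<close> by (auto simp: u_def v_def)
      have "x powr \<sigma> * norm (f x) = v * u" using \<open>l > 0\<close> by (simp add: u_def v_def)
      also have "\<dots> \<le> v powr p / p + u powr q / q" using pq uv by (intro Youngs_inequality) auto
      also have "\<dots> \<le> v powr p + u powr q" using pq mult_left_mono[of 1 p "v powr p"] mult_left_mono[of 1 q "u powr q"]
        by (intro add_mono) (simp_all add: divide_le_eq)
      also have "v powr p = 1 / l powr p * norm (f x) powr p" using \<open>l > 0\<close> by (simp add: v_def powr_divide)
      also have "u powr q = l powr q * x powr (\<sigma> * q)" using \<open>l > 0\<close> 2 by (simp add: u_def powr_mult powr_powr)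
      finally have "ennreal (x powr \<sigma> * norm (f x)) \<le> ennreal (1 / l powr p * norm (f x) powr p + l powr q * x powr (\<sigma> * q))"
        by (rule ennreal_leI)
      also have "\<dots> = ennreal (l powr q) * ennreal (x powr (\<sigma> * q)) + ennreal (1 / l powr p) * ennreal (norm (f x) powr p)"
        by (simp add: ennreal_plus[symmetric] ennreal_mult'[symmetric] add.commute del: ennreal_plus)
      finally have *: "ennreal (x powr \<sigma> * norm (f x)) \<le> ennreal (l powr q) * ennreal (x powr (\<sigma> * q)) + ennreal (1 / l powr p) * ennreal (norm (f x) powr p)" .
      show ?thesis using 2 by (simp add: add.assoc[symmetric]) (rule order_trans[OF *], simp)
    next
      case 3
      have "x powr \<sigma> * norm (f x) \<le> x powr \<sigma> * (C * x powr - 2)" using 3 by (intro mult_left_mono C) auto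
      also have "\<dots> = C * (x powr \<sigma> * x powr - 2)" by simp
      also have "x powr \<sigma> * x powr - 2 = x powr (\<sigma> - 2)" by (simp add: powr_add[symmetric])
      finally have "ennreal (x powr \<sigma> * norm (f x)) \<le> ennreal C * ennreal (x powr (\<sigma> - 2))"
        using nn by (simp add: ennreal_mult'[symmetric] ennreal_leI)
      then show ?thesis using 3 by (simp add: add_increasing)
    qed simp
  qed
  also have "\<dots> = ennreal (l powr q) * (\<integral>\<^sup>+x\<in>{0..1}. ennreal (x powr (\<sigma> * q)) \<partial>lborel) +
      (ennreal (1 / l powr p) * (\<integral>\<^sup>+x\<in>{0<..}. ennreal (norm (f x) powr p) \<partial>lborel) +
       ennreal C * (\<integral>\<^sup>+x\<in>{1..}. ennreal (x powr (\<sigma> - 2)) \<partial>lborel))"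
    by (subst nn_integral_add, measurable, subst nn_integral_add, measurable) (auto simp: nn_integral_cmult)
  also have "\<dots> \<le> ennreal (l powr q) * ennreal (1 / (\<sigma> * q + 1)) +
      (ennreal (1 / l powr p) * ennreal I + ennreal C * ennreal (1 / (1 - \<sigma>)))"
  proof (intro add_mono mult_left_mono I)
    show "(\<integral>\<^sup>+x\<in>{0..1}. ennreal (x powr (\<sigma> * q)) \<partial>lborel) \<le> ennreal (1 / (\<sigma> * q + 1))"
      using set_nn_integral_powr_0_c[of "\<sigma> * q" 1] \<sigma> by simp
    have "- 1 / (\<sigma> - 2 + 1) = 1 / (1 - \<sigma>)" using \<sigma> by (simp add: field_simps)
    then show "(\<integral>\<^sup>+x\<in>{1..}. ennreal (x powr (\<sigma> - 2)) \<partial>lborel) \<le> ennreal (1 / (1 - \<sigma>))"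
      using set_nn_integral_powr_1_inf[of "\<sigma> - 2"] \<sigma> by simp
  qed auto
  also have "\<dots> = ennreal (l powr q * (1 / (\<sigma> * q + 1)) + (1 / l powr p * I + C * (1 / (1 - \<sigma>))))"
    using \<sigma> \<open>I \<ge> 0\<close> nn by (simp add: ennreal_plus[symmetric] ennreal_mult'[symmetric] del: ennreal_plus)
  finally show ?thesis by (simp add: add.assoc)
qed

lemma set_integrable_lborel_iff_finite:
  fixes f :: "real \<Rightarrow> real"
  assumes [measurable]: "f \<in> borel_measurable borel" and nn: "\<And>x. x > 0 \<Longrightarrow> f x \<ge> 0"
  shows "set_integrable lborel {0<..} f \<longleftrightarrow> (\<integral>\<^sup>+x\<in>{0<..}. ennreal (f x) \<partial>lborel) < \<infinity>"
proof -
  have "(\<integral>\<^sup>+x\<in>{0<..}. ennreal (f x) \<partial>lborel) = (\<integral>\<^sup>+x. ennreal (norm (indicator {0<..} x *\<^sub>R f x)) \<partial>lborel)"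
    by (intro nn_integral_cong) (auto simp: indicator_def nn)
  then show ?thesis unfolding set_integrable_def integrable_iff_bounded by simp
qed

context
  fixes h :: "real \<Rightarrow> complex"
  assumes h [measurable]: "h \<in> borel_measurable borel"
    and h_int: "\<And>\<sigma>. - 1/2 < \<sigma> \<Longrightarrow> \<sigma> \<le> 1 \<Longrightarrow> set_integrable lborel {0<..} (\<lambda>t. t powr \<sigma> * norm (h t))"
begin

lemma norm_g_transform_le_powr:
  assumes "- 1/2 < \<sigma>" "\<sigma> \<le> 1" and "\<And>y. y > 0 \<Longrightarrow> \<bar>g y\<bar> \<le> C * y powr \<sigma>"
  obtains A where "\<And>x. x > 0 \<Longrightarrow> norm (g_transform h x) \<le> A * x powr (- 1 - \<sigma>)"
  using norm_g_transform_le[OF h h_int assms(3)] assms(1,2) that by blast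

lemma norm_g_transform_le_inverse_square:
  obtains C where "\<And>x. x > 0 \<Longrightarrow> norm (g_transform h x) \<le> C * x powr - 2"
proof -
  have "\<bar>g y\<bar> \<le> 1 * y powr 1" if "y > 0" for y using abs_g_le_powr[of 1 y] that by simp
  from norm_g_transform_le_powr[of 1, OF _ _ this] that show ?thesis by auto
qed

lemma g_transform_Lp_of_RH:
  assumes RH: riemann_hypothesis and p: "1 \<le> p" "p < 2"
  shows "(\<integral>\<^sup>+x\<in>{0<..}. ennreal (norm (g_transform h x) powr p) \<partial>lborel) < \<infinity>"
proof -
  define u where "u = 1 / p"
  \<comment> \<open>The midpoint of \<open>1 - u\<close> and \<open>1 / 2\<close>: the bound on
    \<open>g\<close> asks for \<open>a < 1 / 2\<close>, and integrability of the \<open>p\<close>-th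
    power at 0 asks for \<open>a > 1 - u\<close>.\<close>
  define a where "a = 3 / 4 - u / 2"
  have "u \<le> 1" "u > 1 / 2" using p by (simp_all add: u_def field_simps)
  then have a: "0 < a" "a < 1/2" and "1 - a < u" unfolding a_def by simp_all
  then have ap: "(1 - a) * p < 1" using p by (simp add: u_def field_simps)
  obtain C where "\<And>x. x > 0 \<Longrightarrow> \<bar>g x\<bar> \<le> C * x powr - a" using riemann_hypothesis_g_bound[OF RH a] by blast
  then obtain A where "\<And>x. x > 0 \<Longrightarrow> norm (g_transform h x) \<le> A * x powr (- 1 - - a)"
    using norm_g_transform_le_powr[of "- a" C] a by auto
  then have A: "norm (g_transform h x) \<le> A * x powr - (1 - a)" if "x > 0" for x using that by simp
  obtain C' where "\<And>x. x > 0 \<Longrightarrow> norm (g_transform h x) \<le> C' * x powr - 2"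
    using norm_g_transform_le_inverse_square by blast
  with nn_integral_powr_p_finite[OF p(1) ap A] show ?thesis by blast
qed

section \<open>Consequences of a finite \<open>L\<^sup>p\<close> norm of the transform\<close>

context
  fixes p q I C :: real
  assumes pq: "1 < p" "p \<le> 2" "1 < q" "1 / p + 1 / q = 1"
    and I: "I \<ge> 0" "(\<integral>\<^sup>+x\<in>{0<..}. ennreal (norm (g_transform h x) powr p) \<partial>lborel) \<le> ennreal I"
    and C: "\<And>x. x > 0 \<Longrightarrow> norm (g_transform h x) \<le> C * x powr - 2"
begin

lemma nn_integral_mellin_g_transform_le:
  assumes "- 1 / q < \<sigma>" "\<sigma> < 1" "l > 0"
  shows "(\<integral>\<^sup>+x\<in>{0<..}. ennreal (x powr \<sigma> * norm (g_transform h x)) \<partial>lborel) \<le>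
    ennreal (l powr q / (\<sigma> * q + 1) + I / l powr p + C / (1 - \<sigma>))"
proof -
  have "- 1 < \<sigma> * q" using mult_strict_right_mono[OF assms(1), of q] pq(3) by simp
  from nn_integral_mellin_le_Lp[OF borel_measurable_g_transform[OF h] pq(1,3,4) this assms(2,3) I C]
  show ?thesis .
qed

lemma set_integrable_mellin_g_transform:
  assumes "- 1 / q < \<sigma>" "\<sigma> < 1"
  shows "set_integrable lborel {0<..} (\<lambda>x. x powr \<sigma> * norm (g_transform h x))"
proof -
  have "(\<integral>\<^sup>+x\<in>{0<..}. ennreal (x powr \<sigma> * norm (g_transform h x)) \<partial>lborel) < \<infinity>"
    by (rule le_less_trans[OF nn_integral_mellin_g_transform_le[OF assms zero_less_one]]) simp
  then show ?thesis by (subst set_integrable_lborel_iff_finite) simp_all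
qed

text \<open>The identity is kept in product form, since dividing by \<open>reg_zeta\<close> to the
  left of 0 would presuppose the absence of zeros. Both sides are holomorphic for
  \<open>- 1 / q < Re s < 1\<close> and agree for \<open>0 < Re s < 1\<close>.\<close>

lemma reg_zeta_times_mellin_g_transform:
  assumes s: "- 1 / q < Re s" "Re s < 1"
  shows "reg_zeta s * (LINT x:{0<..}|lborel. of_real x powr s * g_transform h x) = (LINT t:{0<..}|lborel. of_real t powr s * h t)"
proof -
  define S where "S = {s. - 1 / q < Re s \<and> Re s < 1}"
  have S: "S = {s. - 1 / q < Re s} \<inter> {s. Re s < 1}" by (auto simp: S_def)
  have q2: "- 1 / 2 \<le> - 1 / q"
  proof -
    have "1 / p \<ge> 1 / 2" using pq(1,2) by (simp add: field_simps)
    then show ?thesis using pq(4) by simp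
  qed
  show ?thesis
  proof (rule analytic_continuation_open[of "{s. 0 < Re s} \<inter> {s. Re s < 1}" S
        "\<lambda>s. reg_zeta s * (LINT x:{0<..}|lborel. of_real x powr s * g_transform h x)" "\<lambda>s. LINT t:{0<..}|lborel. of_real t powr s * h t"])
    show "open ({s. 0 < Re s} \<inter> {s. Re s < 1})" by (intro open_Int open_halfspace_Re_gt open_halfspace_Re_lt)
    show "open S" unfolding S by (intro open_Int open_halfspace_Re_gt open_halfspace_Re_lt)
    show "connected S" unfolding S by (intro convex_connected convex_Int convex_halfspace_Re_gt convex_halfspace_Re_lt)
    have "(1/2 :: complex) \<in> {s. 0 < Re s} \<inter> {s. Re s < 1}" by simp
    then show "{s. 0 < Re s} \<inter> {s. Re s < 1} \<noteq> {}" by blast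
    have "- 1 / q < 0" using pq by simp
    then show "{s. 0 < Re s} \<inter> {s. Re s < 1} \<subseteq> S" by (auto simp: S_def intro: less_trans[of _ 0])
    have "(\<lambda>s. LINT x:{0<..}|lborel. of_real x powr s * g_transform h x) holomorphic_on S"
      unfolding S_def by (intro mellin_integral_holomorphic set_integrable_mellin_g_transform borel_measurable_g_transform h)
    then show "(\<lambda>s. reg_zeta s * (LINT x:{0<..}|lborel. of_real x powr s * g_transform h x)) holomorphic_on S"
      by (intro holomorphic_intros reg_zeta_holomorphic)
    show "(\<lambda>s. LINT t:{0<..}|lborel. of_real t powr s * h t) holomorphic_on S"
      unfolding S_def using q2 by (intro mellin_integral_holomorphic h h_int) auto
    show "s \<in> S" using s by (simp add: S_def)
    fix z assume "z \<in> {s. 0 < Re s} \<inter> {s. Re s < 1}"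
    then have z: "0 < Re z" "Re z < 1" by auto
    have "riemann_zeta (1 + z) \<noteq> 0"
      using z by (intro riemann_zeta_nonzero_of_Re_ge_1) auto
    then have "reg_zeta z \<noteq> 0" using z by (auto simp: reg_zeta_def)
    then show "reg_zeta z * (LINT x:{0<..}|lborel. of_real x powr z * g_transform h x) = (LINT t:{0<..}|lborel. of_real t powr z * h t)"
      using mellin_g_transform[OF h z h_int] z by simp
  qed
qed

end

end

text \<open>Either the zero or its mirror image under \<open>s \<mapsto> 1 - s\<close> lies to the
  right of the critical line; the shift by 1 places it where the transform of a mellin-proper
  function does not vanish.\<close>

lemma nontrivial_zero_right_half:
  assumes "0 < Re s" "Re s < 1" "riemann_zeta s = 0" "Re s \<noteq> 1 / 2"
  obtains w where "- 1/2 < Re w" "Re w < 0" "reg_zeta w = 0"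
proof (cases "Re s > 1 / 2")
  case True
  show ?thesis using True assms by (intro that[of "s - 1"]) (auto simp: reg_zeta_def)
next
  case False
  have "riemann_zeta (1 - s) = 0" by (rule riemann_zeta_zero_reflect[OF assms(1-3)])
  with False assms show ?thesis by (intro that[of "- s"]) (auto simp: reg_zeta_def)
qed

text \<open>\<open>F\<close> stands for the continuation of \<open>mellin \<phi>\<close> to the
  closed edge \<open>Re s = - 1/2\<close>, where the integral itself need not converge;
  \<open>analytic_on\<close> refers to a neighbourhood of each point of the set.\<close>

theorem theorem4p2:
  fixes \<phi> \<psi> :: "real \<Rightarrow> complex"
  assumes "mellin_proper \<phi>"
    and "\<And>x. x > 0 \<Longrightarrow> \<psi> x = G_op \<phi> (1 / x) / complex_of_real x"
  shows "(riemann_hypothesis \<longleftrightarrow> (\<forall>p::real. 1 \<le> p \<and> p < 2 \<longrightarrow> Lp_norm p \<psi> < \<infinity>)) \<and>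
    (\<forall>F. F analytic_on {s. - 1 / 2 \<le> Re s \<and> Re s < 0} \<and>
         (\<forall>s. - 1 / 2 < Re s \<and> Re s < 0 \<longrightarrow> F s = mellin \<phi> s) \<and>
         (\<forall>s. Re s = - 1 / 2 \<longrightarrow> F s \<noteq> 0)
       \<longrightarrow> Lp_norm 2 \<psi> = \<infinity>)"
proof -
  have \<phi>: "proper_fun \<phi>" "\<And>s. - 1/2 < Re s \<Longrightarrow> Re s < 0 \<Longrightarrow> mellin \<phi> s \<noteq> 0"
    using assms(1) by (auto simp: mellin_proper_def)
  obtain h where h: "h \<in> borel_measurable borel"
    and h_int: "\<And>\<sigma>. - 1/2 < \<sigma> \<Longrightarrow> \<sigma> \<le> 1 \<Longrightarrow> set_integrable lborel {0<..} (\<lambda>t. t powr \<sigma> * norm (h t))"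
    and mellin: "\<And>s. - 1/2 < Re s \<Longrightarrow> Re s \<le> 1 \<Longrightarrow> mellin \<phi> s = (LINT t:{0<..}|lborel. of_real t powr s * h t)"
    and G: "\<And>x. x > 0 \<Longrightarrow> G_op \<phi> (1 / x) / of_real x = g_transform h x"
    using proper_fun_kernel[OF \<phi>(1)] by blast
  define f where "f = g_transform h"
  define W where "W = (\<lambda>s. LINT x:{0<..}|lborel. of_real x powr s * f x)"
  have f: "f \<in> borel_measurable borel" unfolding f_def by (rule borel_measurable_g_transform[OF h])
  have Lp: "Lp_norm p \<psi> < \<infinity> \<longleftrightarrow> (\<integral>\<^sup>+x\<in>{0<..}. ennreal (norm (f x) powr p) \<partial>lborel) < \<infinity>" for p
    by (rule Lp_norm_finite_iff[OF f]) (simp add: assms(2) G f_def)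
  obtain C where C: "\<And>x. x > 0 \<Longrightarrow> norm (f x) \<le> C * x powr - 2"
    using norm_g_transform_le_inverse_square[OF h h_int] unfolding f_def by blast
  have Lp_I: "\<exists>I\<ge>0. (\<integral>\<^sup>+x\<in>{0<..}. ennreal (norm (f x) powr p) \<partial>lborel) \<le> ennreal I" if "Lp_norm p \<psi> < \<infinity>" for p
    using that unfolding Lp by (intro exI[of _ "enn2real (\<integral>\<^sup>+x\<in>{0<..}. ennreal (norm (f x) powr p) \<partial>lborel)"]) simp
  have factor: "reg_zeta s * W s = mellin \<phi> s"
    if fin: "Lp_norm p \<psi> < \<infinity>" and p: "1 < p" "p \<le> 2" and s: "1 / p - 1 < Re s" "Re s < 1" for p s
  proof -
    define q where "q = p / (p - 1)"
    have q: "1 < q" "1 / p + 1 / q = 1" using p by (auto simp: q_def field_simps)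
    have "- 1 / 2 \<le> 1 / p - 1" using p by (simp add: field_simps)
    moreover have e: "- 1 / q = 1 / p - 1" using q(2) by simp
    moreover obtain I where I: "I \<ge> 0" "(\<integral>\<^sup>+x\<in>{0<..}. ennreal (norm (f x) powr p) \<partial>lborel) \<le> ennreal I"
      using Lp_I[OF fin] by blast
    ultimately show ?thesis
      using reg_zeta_times_mellin_g_transform[OF h h_int p q I[unfolded f_def] C[unfolded f_def], of s] s mellin[of s]
      unfolding W_def f_def by simp
  qed
  have nonzero: "reg_zeta s \<noteq> 0" if "Lp_norm p \<psi> < \<infinity>" "1 < p" "p \<le> 2" "1 / p - 1 < Re s" "Re s < 0" for p s
  proof -
    have "- 1 / 2 \<le> 1 / p - 1" using that(2,3) by (simp add: field_simps)
    then have "mellin \<phi> s \<noteq> 0" using that by (intro \<phi>(2)) auto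
    then show ?thesis using factor[of p s] that by auto
  qed
  have "riemann_hypothesis \<longleftrightarrow> (\<forall>p::real. 1 \<le> p \<and> p < 2 \<longrightarrow> Lp_norm p \<psi> < \<infinity>)"
  proof
    assume riemann_hypothesis
    then show "\<forall>p::real. 1 \<le> p \<and> p < 2 \<longrightarrow> Lp_norm p \<psi> < \<infinity>"
      unfolding Lp f_def using g_transform_Lp_of_RH[OF h h_int] by blast
  next
    assume L: "\<forall>p::real. 1 \<le> p \<and> p < 2 \<longrightarrow> Lp_norm p \<psi> < \<infinity>"
    show riemann_hypothesis
      unfolding riemann_hypothesis_def
    proof (intro allI impI, rule ccontr)
      fix s assume "0 < Re s \<and> Re s < 1 \<and> riemann_zeta s = 0" "Re s \<noteq> 1 / 2"
      then obtain w where w: "- 1/2 < Re w" "Re w < 0" "reg_zeta w = 0"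
        using nontrivial_zero_right_half by blast
      \<comment> \<open>\<open>1 / p\<close> is the midpoint of \<open>1 / 2\<close> and
        \<open>1 + Re w\<close>, which gives both \<open>p < 2\<close> and
        \<open>1 / p - 1 < Re w\<close>.\<close>
      define p where "p = 1 / (Re w / 2 + 3 / 4)"
      have p: "1 < p" "p < 2" "1 / p - 1 < Re w" using w by (auto simp: p_def field_simps)
      then show False using nonzero[of p w] L w by auto
    qed
  qed
  moreover have "Lp_norm 2 \<psi> = \<infinity>"
    if F: "F analytic_on {s. - 1 / 2 \<le> Re s \<and> Re s < 0}"
      and F_eq: "\<And>s. - 1 / 2 < Re s \<Longrightarrow> Re s < 0 \<Longrightarrow> F s = mellin \<phi> s"
      and F_nz: "\<And>s. Re s = - 1 / 2 \<Longrightarrow> F s \<noteq> 0" for F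
  proof (rule ccontr)
    assume "Lp_norm 2 \<psi> \<noteq> \<infinity>"
    then have L2: "Lp_norm 2 \<psi> < \<infinity>" by (simp add: top.not_eq_extremum)
    obtain \<rho> where \<rho>: "0 < Re \<rho>" "Re \<rho> < 1" "riemann_zeta \<rho> = 0"
      using riemann_zeta_has_nontrivial_zero by blast
    \<comment> \<open>A finite \<open>L\<^sup>2\<close> norm already excludes zeros of
      \<open>reg_zeta\<close> in \<open>- 1/2 < Re s < 0\<close>, so the zero at hand must lie on
      the critical line.\<close>
    have "Re \<rho> = 1 / 2"
    proof (rule ccontr)
      assume "Re \<rho> \<noteq> 1 / 2"
      with \<rho> obtain w where "- 1/2 < Re w" "Re w < 0" "reg_zeta w = 0" using nontrivial_zero_right_half by blast
      then show False using nonzero[OF L2, of w] by simp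
    qed
    define s where "s = \<rho> - 1"
    have s: "Re s = - 1 / 2" using \<open>Re \<rho> = 1 / 2\<close> by (simp add: s_def)
    have zero: "reg_zeta s = 0" using \<rho> by (auto simp: s_def reg_zeta_def)
    obtain I where I: "I \<ge> 0" "(\<integral>\<^sup>+x\<in>{0<..}. ennreal (norm (f x) powr 2) \<partial>lborel) \<le> ennreal I"
      using Lp_I[OF L2] by blast
    have C0: "C \<ge> 0" using C[of 1] norm_ge_zero[of "f 1"] by (simp del: norm_ge_zero)
    have W_bound: "norm (of_real r * W (s + of_real r)) \<le> sqrt r * (1 / 2 + I) + r * (2 * C)" if r: "0 < r" "r < 1" for r
    proof -
      define \<sigma> where "\<sigma> = r - 1/2"
      \<comment> \<open>Balances the two terms of the bound: with
        \<open>\<sigma> * 2 + 1 = 2 * r\<close>, the choice \<open>l\<^sup>2 = sqrt r\<close> makes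
        both of them of size 1 / sqrt r.\<close>
      define l where "l = sqrt (sqrt r)"
      have l: "l > 0" "l\<^sup>2 = sqrt r" using r by (auto simp: l_def)
      have fin: "(\<integral>\<^sup>+x\<in>{0<..}. ennreal (x powr \<sigma> * norm (f x)) \<partial>lborel) \<le>
          ennreal (l powr 2 / (\<sigma> * 2 + 1) + I / l powr 2 + C / (1 - \<sigma>))"
        unfolding f_def using r l I C
        by (intro nn_integral_mellin_g_transform_le[OF h h_int]) (auto simp: \<sigma>_def f_def)
      have "norm (W (s + of_real r)) \<le> (LINT x:{0<..}|lborel. x powr \<sigma> * norm (f x))"
      proof -
        have "norm (W (s + of_real r)) \<le> (LINT x|lborel. norm (indicator {0<..} x *\<^sub>R (of_real x powr (s + of_real r) * f x)))"
          unfolding W_def set_lebesgue_integral_def by (rule integral_norm_bound)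
        also have "\<dots> = (LINT x:{0<..}|lborel. x powr \<sigma> * norm (f x))"
          unfolding set_lebesgue_integral_def
          by (intro Bochner_Integration.integral_cong) (auto simp: indicator_def norm_mult norm_of_real_powr s \<sigma>_def)
        finally show ?thesis .
      qed
      also have "\<dots> \<le> l powr 2 / (\<sigma> * 2 + 1) + I / l powr 2 + C / (1 - \<sigma>)"
      proof -
        have "(LINT x:{0<..}|lborel. x powr \<sigma> * norm (f x)) = enn2real (\<integral>\<^sup>+x. ennreal (indicator {0<..} x *\<^sub>R (x powr \<sigma> * norm (f x))) \<partial>lborel)"
          unfolding set_lebesgue_integral_def using f by (intro integral_eq_nn_integral) auto
        also have "(\<integral>\<^sup>+x. ennreal (indicator {0<..} x *\<^sub>R (x powr \<sigma> * norm (f x))) \<partial>lborel) = (\<integral>\<^sup>+x\<in>{0<..}. ennreal (x powr \<sigma> * norm (f x)) \<partial>lborel)"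
          by (intro nn_integral_cong) (auto simp: indicator_def)
        finally show ?thesis using fin r C0 I(1) by (auto intro!: enn2real_leI add_nonneg_nonneg simp: \<sigma>_def)
      qed
      also have "\<dots> \<le> sqrt r / (2 * r) + I / sqrt r + 2 * C"
      proof -
        have "C / (1 - \<sigma>) \<le> C / (1 / 2)" using r C0 by (intro divide_left_mono) (auto simp: \<sigma>_def)
        then show ?thesis using l by (simp add: \<sigma>_def)
      qed
      finally have "norm (of_real r * W (s + of_real r)) \<le> r * (sqrt r / (2 * r) + I / sqrt r + 2 * C)"
        using r by (simp add: norm_mult mult_left_mono)
      also have "\<dots> = sqrt r * (1 / 2 + I) + r * (2 * C)"
      proof -
        have "r / sqrt r = sqrt r" using r by (simp add: real_div_sqrt)
        then have "r * (I / sqrt r) = sqrt r * I" by (metis times_divide_eq_left times_divide_eq_right)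
        then show ?thesis using r by (simp add: distrib_left)
      qed
      finally show ?thesis .
    qed
    have lim1: "((\<lambda>r. of_real r * W (s + of_real r)) \<longlongrightarrow> 0) (at_right 0)"
    proof (rule Lim_null_comparison)
      show "\<forall>\<^sub>F r in at_right 0. norm (of_real r * W (s + of_real r)) \<le> sqrt r * (1 / 2 + I) + r * (2 * C)"
        using eventually_at_right_real[of 0 1] W_bound by (auto elim!: eventually_mono)
      have "((\<lambda>r. sqrt r * (1 / 2 + I) + r * (2 * C)) \<longlongrightarrow> sqrt 0 * (1 / 2 + I) + 0 * (2 * C)) (at_right 0)"
        by (intro tendsto_intros)
      then show "((\<lambda>r. sqrt r * (1 / 2 + I) + r * (2 * C)) \<longlongrightarrow> 0) (at_right 0)" by simp
    qed
    have at0: "filterlim complex_of_real (at 0) (at_right 0)"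
    proof (rule filterlim_atI)
      have "((\<lambda>x. complex_of_real x) \<longlongrightarrow> of_real 0) (at_right 0)" by (intro tendsto_intros)
      then show "(complex_of_real \<longlongrightarrow> 0) (at_right 0)" by simp
      show "\<forall>\<^sub>F x in at_right 0. complex_of_real x \<noteq> 0"
        using eventually_at_right_real[of 0 1] by (auto elim!: eventually_mono)
    qed
    obtain D where "(reg_zeta has_field_derivative D) (at s)"
      using holomorphic_on_imp_differentiable_at[OF reg_zeta_holomorphic[of UNIV], of s] by (auto simp: field_differentiable_def)
    then have "((\<lambda>w. (reg_zeta (s + w) - reg_zeta s) / w) \<longlongrightarrow> D) (at 0)" by (simp add: DERIV_def)
    from filterlim_compose[OF this at0] zero
    have lim2: "((\<lambda>r. reg_zeta (s + of_real r) / of_real r) \<longlongrightarrow> D) (at_right 0)" by simp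
    \<comment> \<open>The simple or higher zero at \<open>s\<close> gives the first factor the
      finite limit \<open>D\<close>, and the second tends to 0 because \<open>W\<close> grows at
      most like 1 / sqrt r. The product is \<open>F\<close>, which is thus forced to vanish at
      \<open>s\<close>.\<close>
    have "((\<lambda>r. reg_zeta (s + of_real r) / of_real r * (of_real r * W (s + of_real r))) \<longlongrightarrow> D * 0) (at_right 0)"
      by (rule tendsto_mult[OF lim2 lim1])
    moreover have "\<forall>\<^sub>F r in at_right 0. reg_zeta (s + of_real r) / of_real r * (of_real r * W (s + of_real r)) = F (s + of_real r)"
    proof -
      \<comment> \<open>\<open>r < 1/2\<close> keeps \<open>s + r\<close> in the open strip where
        \<open>F\<close> coincides with the transform.\<close>
      have "\<forall>\<^sub>F r in at_right (0::real). r \<in> {0<..<1/2}" by (rule eventually_at_right_real) simp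
      then show ?thesis
      proof eventually_elim
        case (elim r)
        then show ?case using factor[OF L2, of "s + of_real r"] F_eq[of "s + of_real r"] s by simp
      qed
    qed
    ultimately have "((\<lambda>r. F (s + of_real r)) \<longlongrightarrow> 0) (at_right 0)"
      by (simp add: tendsto_cong)
    moreover have "((\<lambda>r. F (s + of_real r)) \<longlongrightarrow> F s) (at_right 0)"
    proof -
      have "F analytic_on {s}" using s by (intro analytic_on_subset[OF F]) auto
      then have "isCont F s" by (rule analytic_at_imp_isCont)
      moreover have "((\<lambda>r. s + complex_of_real r) \<longlongrightarrow> s + of_real 0) (at_right 0)" by (intro tendsto_intros)
      then have "((\<lambda>r. s + complex_of_real r) \<longlongrightarrow> s) (at_right 0)" by simp
      ultimately show ?thesis by (rule isCont_tendsto_compose)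
    qed
    ultimately have "F s = 0" using tendsto_unique[of "at_right (0::real)"] by simp blast
    then show False using F_nz[OF s] by simp
  qed
  ultimately show ?thesis by blast
qed

end
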